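(* Let $\gamma$ be a probability measure on $\mathbf{X}$ and let $q$ be a $Q$-function such that $\int_{T_0}^s q(x,t)\,dt<\infty$ for each $s\in\,]T_0,T_1[$ and each $x\in\mathbf{X}$. Then the jump process $\{\mathbb{X}_t: t\in[T_0,T_1[\}$, constructed from $\gamma$ and $q$ as described in the context, is a jump Markov process (with respect to the filtration $\{\mathcal{F}_t\}_{t\in[T_0,T_1[}$ on $(\Omega,\mathcal{F},\mathbb{P})$) with the transition function $\bar P$.
   Context: Intervals: $]a,b[$, $[a,b[$, $]a,b]$ denote open and half-open intervals. $(\mathbf{X},\mathfrak{B}(\mathbf{X}))$ is a standard Borel space; $0\le T_0<T_1\le\infty$; measurability means Borel measurability. $Q$-function: a function $q(x,t,B)$, $x\in\mathbf{X}$, $t\in[T_0,T_1[$, $B\in\mathfrak{B}(\mathbf{X})$, such that (a) for all $x,t$, $q(x,t,\cdot)$ is a (finite) signed measure with $q(x,t,\mathbf{X})\le 0$ and $0\le q(x,t,B\setminus\{x\})<\infty$ for all $B$; (b) for each $B$, $q(x,t,B)$ is measurable in $(x,t)$. Standing assumption: $q$ is conservative, i.e. $q(x,t,\mathbf{X})=0$ for all $x,t$. Put $q(x,t):=-q(x,t,\{x\})$ and $q^+(x,t,B):=q(x,t,B\setminus\{x\})$. Transition function: a function $P(u,x;t,B)\in[0,1]$, $u\in[T_0,T_1[$, $t\in\,]u,T_1[$, $x\in\mathbf{X}$, $B\in\mathfrak{B}(\mathbf{X})$, which is a measure in $B$, is measurable in $(u,x,t)$ for each $B$, and satisfies $P(u,x;t,B)=\int_{\mathbf{X}}P(s,y;t,B)P(u,x;s,dy)$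 for $u<s<t$. The function $\bar P$: for $x\in\mathbf{X}$, $u\in[T_0,T_1[$, $t\in\,]u,T_1[$, $B\in\mathfrak{B}(\mathbf{X})$, $\bar P^{(0)}(u,x;t,B):=\mathbf{I}\{x\in B\}e^{-\int_u^t q(x,s)ds}$, $\bar P^{(n)}(u,x;t,B):=\int_u^t\int_{\mathbf{X}}e^{-\int_u^w q(x,\theta)d\theta}\,\bar P^{(n-1)}(w,y;t,B)\,q^+(x,w,dy)\,dw$ for $n\ge1$, and $\bar P:=\sum_{n=0}^\infty\bar P^{(n)}$. Construction of the process: let $x_\infty\notin\mathbf{X}$ be an isolated point and $\bar{\mathbf{X}}:=\mathbf{X}\cup\{x_\infty\}$ with $\sigma$-field generated by $\mathfrak{B}(\mathbf{X})$ and $\{x_\infty\}$. $\Omega$ is the set of sequences $\omega=(x_0,t_1,x_1,t_2,x_2,\ldots)$ with $x_n\in\bar{\mathbf{X}}$, $t_{n+1}\in\,]T_0,T_1]$ ($n\ge 0$), such that $x_0\in\mathbf{X}$ and, for all $n\ge1$: if $t_n<T_1$ then $t_n<t_{n+1}$ and $x_n\in\mathbf{X}$; if $t_n=T_1$ then $t_{n+1}=t_n$ and $x_n=x_\infty$. $\mathcal{F}$ is the trace on $\Omega$ of the product Borel $\sigma$-field; $x_n,t_{n}$ are also viewed as the coordinate random variables; $t_0:=T_0$, $t_\infty:=\lim_n t_n$. $\mathcal{F}_t$ is the $\sigma$-field generated by $x_0$ and by $\mathcal{G}_t:=\sigma(\mathbf{I}\{x_n\in B\}\mathbf{I}\{t_n\le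 s\}: n\ge1,\ T_0\le s\le t,\ B\in\mathfrak{B}(\mathbf{X}))$. Define the predictable random measure $\nu$ on $[T_0,T_1[\,\times\mathbf{X}$ by $$\nu(\omega;[T_0,t],B):=\int_{T_0}^t\sum_{n\ge0}\mathbf{I}\{t_n<s\le t_{n+1}\}\,q(x_n,s,B\setminus\{x_n\})\,ds,\quad t\in[T_0,T_1[,\ B\in\mathfrak{B}(\mathbf{X}).$$ $\mathbb{P}$ is the unique probability measure on $(\Omega,\mathcal{F})$ (it exists and is unique by a theorem of Jacod) such that $\mathbb{P}(x_0\in B)=\gamma(B)$ for $B\in\mathfrak{B}(\mathbf{X})$ and $\nu$ is the compensator of the random measure $\mu(\omega;dt,dx)=\sum_{n\ge1,\,t_n<T_1}\delta_{(t_n,x_n)}(dt,dx)$ of the multivariate point process $(t_n,x_n)_{n\ge1}$; that is, $\mathbb{E}\int W\,d\mu=\mathbb{E}\int W\,d\nu$ for every nonnegative function $W(\omega,t,x)$ measurable with respect to the $\sigma$-field generated by the sets $A\times\,]s,r]\times B$, $T_0\le s<r<T_1$, $A\in\mathcal{F}_s$, $B\in\mathfrak{B}(\mathbf{X})$, together with (for completeness) sets contained in $\Omega\times\{T_0\}\times\mathbf{X}$ of the form $A\times\{T_0\}\times B$, $A\in\mathcal{F}_{T_0}$. The process is $$\mathbb{X}_t:=\sum_{n\ge0}\mathbf{I}\{t_n\le t<t_{n+1}\}x_n+\mathbf{I}\{t_\infty\le t\}x_\infty,\qquad t\in[T_0,T_1[$$ (i.e. $\mathbb{X}_t=x_n$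 on $\{t_n\le t<t_{n+1}\}$ and $\mathbb{X}_t=x_\infty$ on $\{t_\infty\le t\}$). Markov: the process is Markov if $\mathbb{P}(\mathbb{X}_t\in B\mid\mathcal{F}_u)=\mathbb{P}(\mathbb{X}_t\in B\mid\mathbb{X}_u)$ $\mathbb{P}$-a.s. for all $u\in[T_0,T_1[$, $t\in\,]u,T_1[$, $B\in\mathfrak{B}(\mathbf{X})$; it has transition function $P$ if $\mathbb{P}(\mathbb{X}_t\in B\mid\mathbb{X}_u)=P(u,\mathbb{X}_u;t,B)$ $\mathbb{P}$-a.s. for all such $u,t,B$, with the convention $P(u,x_\infty;t,B):=0$ for $B\in\mathfrak{B}(\mathbf{X})$. A jump Markov process is a Markov process each of whose sample paths is a right-continuous piecewise constant function of $t$ with finitely or countably many discontinuity points on $[T_0,T_1[$. *)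

theory Defs
  imports "HOL-Probability.Probability"
begin

section \<open>State space and time interval\<close>

definition standard_borel :: "'a measure \<Rightarrow> bool" where
  "standard_borel M \<longleftrightarrow>
    (\<exists>S. completely_metrizable_space S \<and> second_countable S \<and> topspace S = space M \<and>
         sets M = sigma_sets (topspace S) {U. openin S U})"

definition time_set :: "real \<Rightarrow> ereal \<Rightarrow> real set" where
  "time_set T0 T1 = {t. T0 \<le> t \<and> ereal t < T1}"

text \<open>The adjoined isolated point is \<^term>\<open>None\<close>.\<close>

definition extended_space :: "'a measure \<Rightarrow> 'a option measure" where
  "extended_space M =
    sigma (insert None (Some ` space M)) (insert {None} ((\<lambda>B. Some ` B) ` sets M))"

section \<open>Q-functions\<close>

definition finite_signed_measure :: "'a measure \<Rightarrow> ('a set \<Rightarrow> real) \<Rightarrow> bool" where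
  "finite_signed_measure M m \<longleftrightarrow> m {} = 0 \<and>
    (\<forall>A :: nat \<Rightarrow> 'a set. range A \<subseteq> sets M \<longrightarrow> disjoint_family A \<longrightarrow>
      (\<lambda>i. m (A i)) sums m (\<Union>i. A i))"

definition Q_function ::
  "'a measure \<Rightarrow> real \<Rightarrow> ereal \<Rightarrow> ('a \<Rightarrow> real \<Rightarrow> 'a set \<Rightarrow> real) \<Rightarrow> bool" where
  "Q_function M T0 T1 q \<longleftrightarrow>
    (\<forall>x\<in>space M. \<forall>t\<in>time_set T0 T1.
       finite_signed_measure M (q x t) \<and> q x t (space M) \<le> 0 \<and>
       (\<forall>B\<in>sets M. 0 \<le> q x t (B - {x}))) \<and>
    (\<forall>B\<in>sets M. (\<lambda>(x, t). q x t B) \<in>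
       borel_measurable (M \<Otimes>\<^sub>M restrict_space borel (time_set T0 T1)))"

definition conservative ::
  "'a measure \<Rightarrow> real \<Rightarrow> ereal \<Rightarrow> ('a \<Rightarrow> real \<Rightarrow> 'a set \<Rightarrow> real) \<Rightarrow> bool" where
  "conservative M T0 T1 q \<longleftrightarrow> (\<forall>x\<in>space M. \<forall>t\<in>time_set T0 T1. q x t (space M) = 0)"

definition q_rate :: "('a \<Rightarrow> real \<Rightarrow> 'a set \<Rightarrow> real) \<Rightarrow> 'a \<Rightarrow> real \<Rightarrow> real" where
  "q_rate q x t = - q x t {x}"

definition q_plus ::
  "'a measure \<Rightarrow> ('a \<Rightarrow> real \<Rightarrow> 'a set \<Rightarrow> real) \<Rightarrow> 'a \<Rightarrow> real \<Rightarrow> 'a measure" where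
  "q_plus M q x t = measure_of (space M) (sets M) (\<lambda>B. ennreal (q x t (B - {x})))"

section \<open>Transition functions and the function constructed from \<open>q\<close>\<close>

text \<open>The arguments of a transition function are ordered as in \<open>P(u, x; t, B)\<close>.\<close>

definition transition_function ::
  "'a measure \<Rightarrow> real \<Rightarrow> ereal \<Rightarrow> (real \<Rightarrow> 'a \<Rightarrow> real \<Rightarrow> 'a set \<Rightarrow> ennreal) \<Rightarrow> bool" where
  "transition_function M T0 T1 P \<longleftrightarrow>
    (\<forall>u\<in>time_set T0 T1. \<forall>t\<in>time_set T0 T1. u < t \<longrightarrow> (\<forall>x\<in>space M.
       measure_space (space M) (sets M) (P u x t) \<and> (\<forall>B\<in>sets M. P u x t B \<le> 1))) \<and>
    (\<forall>B\<in>sets M. (\<lambda>(u, x, t). P u x t B) \<in>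
       borel_measurable (restrict_space (borel \<Otimes>\<^sub>M M \<Otimes>\<^sub>M borel)
         {(u, x, t). u \<in> time_set T0 T1 \<and> t \<in> time_set T0 T1 \<and> u < t \<and> x \<in> space M})) \<and>
    (\<forall>u\<in>time_set T0 T1. \<forall>s\<in>time_set T0 T1. \<forall>t\<in>time_set T0 T1. u < s \<longrightarrow> s < t \<longrightarrow>
       (\<forall>x\<in>space M. \<forall>B\<in>sets M.
          P u x t B = (\<integral>\<^sup>+ y. P s y t B \<partial>measure_of (space M) (sets M) (P u x s))))"

text \<open>The integral in the exponent is a Lebesgue integral of real functions (hence \<open>0\<close> if
  the integrand is not integrable), so these definitions are meant for rates \<^term>\<open>q_rate q x\<close>
  that are integrable on compact subintervals.\<close>

definition survival :: "('a \<Rightarrow> real \<Rightarrow> 'a set \<Rightarrow> real) \<Rightarrow> 'a \<Rightarrow> real \<Rightarrow> real \<Rightarrow> real" where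
  "survival q x u t = exp (- (LBINT s:{u..t}. q_rate q x s))"

primrec P_bar_step ::
  "'a measure \<Rightarrow> ('a \<Rightarrow> real \<Rightarrow> 'a set \<Rightarrow> real) \<Rightarrow> nat \<Rightarrow>
   real \<Rightarrow> 'a \<Rightarrow> real \<Rightarrow> 'a set \<Rightarrow> ennreal" where
  "P_bar_step M q 0 u x t B = indicator B x * ennreal (survival q x u t)"
| "P_bar_step M q (Suc n) u x t B =
    (\<integral>\<^sup>+ w\<in>{u<..<t}.
       (\<integral>\<^sup>+ y. ennreal (survival q x u w) * P_bar_step M q n w y t B \<partial>q_plus M q x w) \<partial>lborel)"

definition P_bar ::
  "'a measure \<Rightarrow> ('a \<Rightarrow> real \<Rightarrow> 'a set \<Rightarrow> real) \<Rightarrow>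
   real \<Rightarrow> 'a \<Rightarrow> real \<Rightarrow> 'a set \<Rightarrow> ennreal" where
  "P_bar M q u x t B = (\<Sum>n. P_bar_step M q n u x t B)"

section \<open>The sequence space\<close>

text \<open>A sequence \<open>(x\<^sub>0, t\<^sub>1, x\<^sub>1, t\<^sub>2, \<dots>)\<close> is encoded as the function
  \<open>n \<mapsto> (x\<^sub>n, t\<^sub>n\<^sub>+\<^sub>1)\<close>.\<close>

type_synonym 'a jump_seq = "nat \<Rightarrow> 'a option \<times> ereal"

definition jump_state :: "nat \<Rightarrow> 'a jump_seq \<Rightarrow> 'a option" where
  "jump_state n \<omega> = fst (\<omega> n)"

fun jump_time :: "real \<Rightarrow> nat \<Rightarrow> 'a jump_seq \<Rightarrow> ereal" where
  "jump_time T0 0 \<omega> = ereal T0"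
| "jump_time T0 (Suc n) \<omega> = snd (\<omega> n)"

definition explosion_time :: "real \<Rightarrow> 'a jump_seq \<Rightarrow> ereal" where
  "explosion_time T0 \<omega> = lim (\<lambda>n. jump_time T0 n \<omega>)"

definition Omega :: "'a measure \<Rightarrow> real \<Rightarrow> ereal \<Rightarrow> 'a jump_seq set" where
  "Omega M T0 T1 = {\<omega>.
    (\<forall>n. jump_state n \<omega> \<in> space (extended_space M) \<and> jump_time T0 (Suc n) \<omega> \<in> {ereal T0<..T1}) \<and>
    jump_state 0 \<omega> \<in> Some ` space M \<and>
    (\<forall>n\<ge>1.
      (jump_time T0 n \<omega> < T1 \<longrightarrow>
         jump_time T0 n \<omega> < jump_time T0 (Suc n) \<omega> \<and> jump_state n \<omega> \<in> Some ` space M) \<and>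
      (jump_time T0 n \<omega> = T1 \<longrightarrow>
         jump_time T0 (Suc n) \<omega> = jump_time T0 n \<omega> \<and> jump_state n \<omega> = None))}"

definition sequence_space :: "'a measure \<Rightarrow> real \<Rightarrow> ereal \<Rightarrow> 'a jump_seq measure" where
  "sequence_space M T0 T1 =
    restrict_space (\<Pi>\<^sub>M n\<in>UNIV. extended_space M \<Otimes>\<^sub>M borel) (Omega M T0 T1)"

definition history ::
  "'a measure \<Rightarrow> real \<Rightarrow> ereal \<Rightarrow> real \<Rightarrow> 'a jump_seq measure" where
  "history M T0 T1 t = sigma (Omega M T0 T1)
    ({{\<omega> \<in> Omega M T0 T1. jump_state 0 \<omega> \<in> Some ` B} | B. B \<in> sets M} \<union>
     {{\<omega> \<in> Omega M T0 T1. jump_state n \<omega> \<in> Some ` B \<and> jump_time T0 n \<omega> \<le> ereal s} | n s B.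
        1 \<le> n \<and> T0 \<le> s \<and> s \<le> t \<and> B \<in> sets M})"

definition jump_process :: "real \<Rightarrow> real \<Rightarrow> 'a jump_seq \<Rightarrow> 'a option" where
  "jump_process T0 t \<omega> =
    (if explosion_time T0 \<omega> \<le> ereal t then None
     else jump_state (THE n. jump_time T0 n \<omega> \<le> ereal t \<and> ereal t < jump_time T0 (Suc n) \<omega>) \<omega>)"

section \<open>Jump measure, compensator and the law of the process\<close>

definition mark_space :: "'a measure \<Rightarrow> real \<Rightarrow> ereal \<Rightarrow> (real \<times> 'a) measure" where
  "mark_space M T0 T1 = restrict_space borel (time_set T0 T1) \<Otimes>\<^sub>M M"

text \<open>The sum of the unit masses at the points \<open>(t\<^sub>n, x\<^sub>n)\<close>, as the image of a counting measure.
  On \<^const>\<open>Omega\<close>, \<open>t\<^sub>n\<close> is finite and \<open>x\<^sub>n \<noteq> None\<close> for all \<open>n \<ge> 1\<close> with \<open>t\<^sub>n < T1\<close>.\<close>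

definition jump_measure ::
  "'a measure \<Rightarrow> real \<Rightarrow> ereal \<Rightarrow> 'a jump_seq \<Rightarrow> (real \<times> 'a) measure" where
  "jump_measure M T0 T1 \<omega> =
    distr (count_space {n. 1 \<le> n \<and> jump_time T0 n \<omega> < T1}) (mark_space M T0 T1)
      (\<lambda>n. (real_of_ereal (jump_time T0 n \<omega>), the (jump_state n \<omega>)))"

text \<open>For \<open>E = {T0..t} \<times> B\<close> the integral below is that of
  \<open>\<Sum>n. I{t\<^sub>n < s \<le> t\<^sub>n\<^sub>+\<^sub>1} q(x\<^sub>n, s, B - {x\<^sub>n})\<close> over \<open>s\<close> in \<open>{T0..t}\<close>.
  If \<open>x\<^sub>n = None\<close> then \<open>t\<^sub>n = T1\<close>, and the \<open>n\<close>-th summand vanishes.\<close>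

definition predicted_measure ::
  "'a measure \<Rightarrow> real \<Rightarrow> ereal \<Rightarrow> ('a \<Rightarrow> real \<Rightarrow> 'a set \<Rightarrow> real) \<Rightarrow>
   'a jump_seq \<Rightarrow> (real \<times> 'a) measure" where
  "predicted_measure M T0 T1 q \<omega> =
    measure_of (space (mark_space M T0 T1)) (sets (mark_space M T0 T1))
      (\<lambda>E. \<integral>\<^sup>+ s\<in>time_set T0 T1.
         (\<Sum>n. indicator {s. jump_time T0 n \<omega> < ereal s \<and> ereal s \<le> jump_time T0 (Suc n) \<omega>} s *
                emeasure (q_plus M q (the (jump_state n \<omega>)) s) {x. (s, x) \<in> E}) \<partial>lborel)"

definition predictable_space ::
  "'a measure \<Rightarrow> real \<Rightarrow> ereal \<Rightarrow> ('a jump_seq \<times> real \<times> 'a) measure" where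
  "predictable_space M T0 T1 = sigma (Omega M T0 T1 \<times> time_set T0 T1 \<times> space M)
    ({A \<times> {s<..r} \<times> B | A s r B.
        T0 \<le> s \<and> s < r \<and> ereal r < T1 \<and> A \<in> sets (history M T0 T1 s) \<and> B \<in> sets M} \<union>
     {A \<times> {T0} \<times> B | A B. A \<in> sets (history M T0 T1 T0) \<and> B \<in> sets M})"

definition compensates ::
  "'a measure \<Rightarrow> real \<Rightarrow> ereal \<Rightarrow> 'a jump_seq measure \<Rightarrow>
   ('a jump_seq \<Rightarrow> (real \<times> 'a) measure) \<Rightarrow> ('a jump_seq \<Rightarrow> (real \<times> 'a) measure) \<Rightarrow> bool" where
  "compensates M T0 T1 Pr \<nu> \<mu> \<longleftrightarrow>
    (\<forall>W :: 'a jump_seq \<times> real \<times> 'a \<Rightarrow> ennreal.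
       W \<in> borel_measurable (predictable_space M T0 T1) \<longrightarrow>
       (\<integral>\<^sup>+ \<omega>. (\<integral>\<^sup>+ z. W (\<omega>, z) \<partial>\<mu> \<omega>) \<partial>Pr) = (\<integral>\<^sup>+ \<omega>. (\<integral>\<^sup>+ z. W (\<omega>, z) \<partial>\<nu> \<omega>) \<partial>Pr))"

text \<open>For the Q-functions considered here, a theorem of Jacod gives exactly one such \<open>Pr\<close>.\<close>

definition jump_process_law ::
  "'a measure \<Rightarrow> real \<Rightarrow> ereal \<Rightarrow> 'a measure \<Rightarrow> ('a \<Rightarrow> real \<Rightarrow> 'a set \<Rightarrow> real) \<Rightarrow>
   'a jump_seq measure \<Rightarrow> bool" where
  "jump_process_law M T0 T1 \<gamma> q Pr \<longleftrightarrow>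
    prob_space Pr \<and> space Pr = Omega M T0 T1 \<and> sets Pr = sets (sequence_space M T0 T1) \<and>
    (\<forall>B\<in>sets M. emeasure Pr {\<omega> \<in> space Pr. jump_state 0 \<omega> \<in> Some ` B} = emeasure \<gamma> B) \<and>
    compensates M T0 T1 Pr (predicted_measure M T0 T1 q) (jump_measure M T0 T1)"

section \<open>Jump Markov processes\<close>

text \<open>Processes with values in \<^term>\<open>extended_space M\<close>.\<close>

definition cond_prob_given ::
  "'w measure \<Rightarrow> 'w measure \<Rightarrow> (real \<Rightarrow> 'w \<Rightarrow> 'a option) \<Rightarrow> real \<Rightarrow> 'a set \<Rightarrow> 'w \<Rightarrow> real" where
  "cond_prob_given Pr G X t B =
    real_cond_exp Pr G (indicator {\<omega> \<in> space Pr. X t \<omega> \<in> Some ` B})"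

definition sigma_gen :: "'a measure \<Rightarrow> 'w measure \<Rightarrow> (real \<Rightarrow> 'w \<Rightarrow> 'a option) \<Rightarrow> real \<Rightarrow> 'w measure"
  where
  "sigma_gen M Pr X u = vimage_algebra (space Pr) (X u) (extended_space M)"

text \<open>The first two conjuncts (\<open>X\<close> is adapted to sub-\<open>\<sigma>\<close>-fields of \<open>Pr\<close>) guarantee that
  the conditional expectations are not the default value of \<^const>\<open>real_cond_exp\<close>.\<close>

definition markov_process ::
  "'a measure \<Rightarrow> real \<Rightarrow> ereal \<Rightarrow> 'w measure \<Rightarrow> (real \<Rightarrow> 'w measure) \<Rightarrow>
   (real \<Rightarrow> 'w \<Rightarrow> 'a option) \<Rightarrow> bool" where
  "markov_process M T0 T1 Pr F X \<longleftrightarrow>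
    (\<forall>u\<in>time_set T0 T1. subalgebra Pr (F u)) \<and>
    (\<forall>u\<in>time_set T0 T1. X u \<in> F u \<rightarrow>\<^sub>M extended_space M) \<and>
    (\<forall>u\<in>time_set T0 T1. \<forall>t\<in>time_set T0 T1. u < t \<longrightarrow> (\<forall>B\<in>sets M.
       AE \<omega> in Pr. cond_prob_given Pr (F u) X t B \<omega> =
                    cond_prob_given Pr (sigma_gen M Pr X u) X t B \<omega>))"

definition has_transition_function ::
  "'a measure \<Rightarrow> real \<Rightarrow> ereal \<Rightarrow> 'w measure \<Rightarrow> (real \<Rightarrow> 'w \<Rightarrow> 'a option) \<Rightarrow>
   (real \<Rightarrow> 'a \<Rightarrow> real \<Rightarrow> 'a set \<Rightarrow> ennreal) \<Rightarrow> bool" where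
  "has_transition_function M T0 T1 Pr X P \<longleftrightarrow>
    transition_function M T0 T1 P \<and>
    (\<forall>u\<in>time_set T0 T1. \<forall>t\<in>time_set T0 T1. u < t \<longrightarrow> (\<forall>B\<in>sets M.
       AE \<omega> in Pr. cond_prob_given Pr (sigma_gen M Pr X u) X t B \<omega> =
         (case X u \<omega> of None \<Rightarrow> 0 | Some x \<Rightarrow> enn2real (P u x t B))))"

text \<open>A standard Borel space carries no distinguished topology. Continuity of paths is therefore
  taken with respect to the discrete topology, for which right-continuity is the strongest and
  the set of discontinuity points is the largest.\<close>

definition jump_path :: "real \<Rightarrow> ereal \<Rightarrow> (real \<Rightarrow> 'b) \<Rightarrow> bool" where
  "jump_path T0 T1 \<xi> \<longleftrightarrow>
    (\<exists>\<J>. countable \<J> \<and> disjoint \<J> \<and> \<Union>\<J> = time_set T0 T1 \<and>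
          (\<forall>J\<in>\<J>. is_interval J \<and> \<xi> constant_on J)) \<and>
    (\<forall>t\<in>time_set T0 T1. limitin (discrete_topology UNIV) \<xi> (\<xi> t) (at_right t)) \<and>
    countable {t \<in> time_set T0 T1.
      \<not> limitin (discrete_topology UNIV) \<xi> (\<xi> t) (at t within time_set T0 T1)}"

definition jump_markov_process ::
  "'a measure \<Rightarrow> real \<Rightarrow> ereal \<Rightarrow> 'w measure \<Rightarrow> (real \<Rightarrow> 'w measure) \<Rightarrow>
   (real \<Rightarrow> 'w \<Rightarrow> 'a option) \<Rightarrow> bool" where
  "jump_markov_process M T0 T1 Pr F X \<longleftrightarrow>
    markov_process M T0 T1 Pr F X \<and> (\<forall>\<omega>\<in>space Pr. jump_path T0 T1 (\<lambda>t. X t \<omega>))"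

end

(* Write t_n for the jump times, x_n for the states, S(x,u,t) for the survival probability. A
   predictable integrand carried by ]t_j, t_(j+1)] turns the compensator property into an identity
   between the jump at t_(j+1) and the rates of x_j. Weighting that jump at time s by S(x_j,s,w)
   makes the integral over the rates explicit, since s -> S(x,s,w) has density q(x,s) S(x,s,w), and
   yields the conditional law of no jump up to w given the history at u. Inserting this law into
   the identity for the integrand P^(n)(s,y;t,B) shows that the conditional expectation of
   P^(n+1)(max u t_j, x_j; t, B) on {t_j < t} is that of P^(n)(t_(j+1), x_(j+1); t, B) on
   {t_(j+1) < t}. Iterating, P^(n)(u,X_u;t,B) is the conditional probability of X_t being in B after
   exactly n jumps in ]u,t], and summation over n gives both the Markov property and the
   transition function. The Chapman-Kolmogorov equation is proved analytically, for each number of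
   jumps, because it is required for all initial data (u,x). *)

theory Submission
  imports Defs
begin

text \<open>The rates are only measurable in time, so survival probabilities need not be
  differentiable everywhere. Their density property is obtained by pushing the measure with density
  \<open>q(x,s)\<close> forward under its own cumulative function, which leaves an integral of the
  exponential function. The weight \<open>S(x_j,s,w)\<close> is chosen because its integral against
  the rates over \<open>]p,e]\<close> is \<open>S(x_j,e,w) - S(x_j,p,w)\<close>. With
  \<open>e\<close> the minimum of \<open>w\<close> and \<open>t_(j+1)\<close>, the first term is the
  weight of the jump itself if that happens before \<open>w\<close>, and is 1 otherwise. The
  indicator of no jump thus appears on its own, and no integral equation for the conditional
  survival probability has to be solved. All conditioning is on events of the history at a fixed
  time \<open>u\<close>, because such events generate the predictable sigma-field; hence the state
  \<open>x_j\<close> is observed from \<open>max u t_j\<close> on. Identities in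
  \<open>ennreal\<close> are written as sums, since subtraction there is truncated.\<close>

section \<open>Substitution by a cumulative function\<close>

text \<open>The probability integral transform. It suffices to compare the masses of the half-lines
  \<open>{c<..}\<close>; continuity of \<open>cdf M\<close>, due to the absence of atoms, turns
  their preimages into half-lines. The points \<open>a\<close> and \<open>b\<close> provide a
  bounded interval for the intermediate value theorem and for compactness.\<close>

lemma (in finite_borel_measure) distr_cdf:
  assumes atomless: "\<And>s. measure M {s} = 0"
    and supp: "measure M {..a} = 0" "measure M {..b} = measure M UNIV" "a \<le> b"
  shows "distr M borel (cdf M) = density lborel (indicator {0..measure M UNIV})"
proof -
  let ?T = "measure M UNIV"
  have sp: "space M = UNIV" by (rule borel_UNIV)
  have [measurable_cong]: "sets M = sets borel" by (rule M_is_borel)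
  have cont: "continuous_on UNIV (cdf M)"
    using isCont_cdf atomless by (simp add: continuous_on_eq_continuous_at)
  then have [measurable]: "cdf M \<in> borel_measurable M"
    by (simp add: borel_measurable_continuous_onI measurable_cong_sets[OF M_is_borel refl])
  have cdf_a: "cdf M a = 0" and cdf_b: "cdf M b = ?T" using supp by (auto simp: cdf_def2)
  have upper: "measure M {s<..} = ?T - cdf M s" for s
  proof -
    have "measure M (UNIV - {..s}) = ?T - cdf M s"
      unfolding cdf_def2 using finite_measure_compl[of "{..s}"] by (simp add: sp M_is_borel)
    then show ?thesis by (simp add: Compl_eq_Diff_UNIV[symmetric] Compl_atMost)
  qed
  show ?thesis
  proof (rule measure_eqI_lessThan)
    fix c :: real
    have eq1: "emeasure (distr M borel (cdf M)) {c<..} = ennreal (measure M {s. c < cdf M s})"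
      by (subst emeasure_distr) (auto simp: sp vimage_def emeasure_eq_measure)
    have eq2: "emeasure (density lborel (indicator {0..?T})) {c<..} = ennreal (?T - max 0 c)"
    proof -
      have "emeasure (density lborel (indicator {0..?T})) {c<..} = emeasure lborel ({0..?T} \<inter> {c<..})"
        by (subst emeasure_density) (auto simp: indicator_inter_arith[symmetric])
      also have "{0..?T} \<inter> {c<..} = (if c < 0 then {0..?T} else {c<..?T})" by auto
      also have "emeasure lborel \<dots> = ennreal (?T - max 0 c)"
        by (cases "c \<le> ?T") (auto simp: max_def ennreal_neg)
      finally show ?thesis .
    qed
    show "emeasure (distr M borel (cdf M)) {c<..} < \<infinity>"
      by (simp add: eq1)
    have "ennreal (measure M {s. c < cdf M s}) = ennreal (?T - max 0 c)"
    proof -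
      consider "c < 0" | "c \<ge> ?T" | "0 \<le> c" "c < ?T" by linarith
      then show ?thesis
      proof cases
        case 1
        then have "{s. c < cdf M s} = UNIV"
          using cdf_nonneg by (auto intro: less_le_trans)
        with 1 show ?thesis by simp
      next
        case 2
        then have "{s. c < cdf M s} = {}"
          using cdf_bounded by (auto simp: sp not_less intro: order_trans)
        with 2 show ?thesis by (simp add: ennreal_neg)
      next
        case 3
        let ?L = "{s \<in> {a..b}. cdf M s = c}"
        have "\<exists>s\<ge>a. s \<le> b \<and> cdf M s = c"
          by (rule IVT') (use 3 cdf_a cdf_b supp(3) cont in \<open>auto intro: continuous_on_subset\<close>)
        then have ne: "?L \<noteq> {}" by auto
        have "closed ?L"
          by (intro continuous_closed_preimage_constant continuous_on_subset[OF cont]) auto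
        moreover have "bounded ?L"
          by (rule bounded_subset[of "{a..b}"]) auto
        ultimately have "compact ?L"
          by (simp add: compact_eq_bounded_closed)
        \<comment> \<open>\<open>cdf M\<close> may be flat, so the level \<open>c\<close> can be
          attained on a whole interval; its largest point is the left end of
          \<open>{s. c < cdf M s}\<close>.\<close>
        then obtain z where z: "z \<in> ?L" "\<And>s. s \<in> ?L \<Longrightarrow> s \<le> z"
          using compact_attains_sup[of ?L] ne by auto
        have "{s. c < cdf M s} = {z<..}"
        proof (intro set_eqI iffI; simp)
          fix s assume "c < cdf M s"
          then show "z < s" using z(1) cdf_nondecreasing[of s z] by (auto simp: not_less[symmetric])
        next
          fix s assume s: "z < s"
          have "c \<le> cdf M s" using cdf_nondecreasing[of z s] s z(1) by auto
          moreover have "c \<noteq> cdf M s"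
          proof (cases "s \<le> b")
            case True
            then show ?thesis using z(1) z(2)[of s] s by auto
          next
            case False
            then have "cdf M s \<ge> ?T" using cdf_b cdf_nondecreasing[of b s] by auto
            then show ?thesis using 3 by auto
          qed
          ultimately show "c < cdf M s" by auto
        qed
        then show ?thesis using upper[of z] z(1) 3 by simp
      qed
    qed
    then show "emeasure (distr M borel (cdf M)) {c<..} = emeasure (density lborel (indicator {0..?T})) {c<..}"
      by (simp add: eq1 eq2)
  qed auto
qed

text \<open>The substitution \<open>v = Q s\<close> for a density that is only measurable:
  \<open>Q\<close> is the distribution function of the atomless measure \<open>f ds\<close> on
  \<open>[a,b]\<close>, so \<open>distr_cdf\<close> takes the place of differentiating
  \<open>Q\<close>.\<close>

lemma nn_integral_substitution_cumulative:
  fixes f :: "real \<Rightarrow> ennreal"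
  assumes [measurable]: "f \<in> borel_measurable borel" "g \<in> borel_measurable borel"
    and fin: "(\<integral>\<^sup>+ s\<in>{a..b}. f s \<partial>lborel) < \<infinity>" and "a \<le> b"
  defines "Q \<equiv> \<lambda>t. enn2real (\<integral>\<^sup>+ s\<in>{a..t}. f s \<partial>lborel)"
  shows "(\<integral>\<^sup>+ s\<in>{a..b}. f s * g (Q s) \<partial>lborel) = (\<integral>\<^sup>+ v\<in>{0..Q b}. g v \<partial>lborel)"
proof -
  define N where "N = density lborel (\<lambda>s. f s * indicator {a..b} s)"
  have em: "emeasure N A = (\<integral>\<^sup>+ s\<in>A. f s * indicator {a..b} s \<partial>lborel)" if "A \<in> sets borel" for A
    unfolding N_def using that by (subst emeasure_density) auto
  have "emeasure N (space N) \<noteq> \<infinity>"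
    using em[of UNIV] fin by (simp add: N_def)
  then interpret N: finite_borel_measure N
    by (intro finite_borel_measure.intro finite_measureI finite_borel_measure_axioms.intro)
       (auto simp: N_def)
  have cdf: "cdf N t = Q t" if "t \<in> {a..b}" for t
    unfolding cdf_def2 measure_def Q_def em[OF borel_closed[OF closed_atMost]]
    by (intro arg_cong[where f=enn2real] nn_integral_cong) (use that in \<open>auto split: split_indicator\<close>)
  have total: "measure N UNIV = Q b"
    unfolding measure_def Q_def by (subst em) auto
  have at: "measure N {s} = 0" for s
  proof -
    have "(\<integral>\<^sup>+ x. f x * indicator {a..b} x * indicator {s} x \<partial>lborel) = 0"
      by (rule nn_integral_null_set) (simp add: finite_imp_null_set_lborel)
    then show ?thesis unfolding measure_def by (subst em) auto
  qed
  have at2: "measure N {..a} = 0"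
  proof -
    have "(\<integral>\<^sup>+ x. f x * indicator {a..b} x * indicator {..a} x \<partial>lborel)
       = (\<integral>\<^sup>+ x. f x * indicator {a..b} x * indicator {a} x \<partial>lborel)"
      by (intro nn_integral_cong) (auto split: split_indicator)
    also have "\<dots> = 0" by (rule nn_integral_null_set) (simp add: finite_imp_null_set_lborel)
    finally show ?thesis unfolding measure_def by (subst em) auto
  qed
  have at3: "measure N {..b} = measure N UNIV"
    using cdf[of b] total \<open>a \<le> b\<close> by (simp add: cdf_def2)
  have d: "distr N borel (cdf N) = density lborel (indicator {0..Q b})"
    using N.distr_cdf[OF at at2 at3 \<open>a \<le> b\<close>] by (simp add: total)
  have [measurable]: "cdf N \<in> borel_measurable borel"
    by (intro borel_measurable_continuous_onI) (simp add: continuous_on_eq_continuous_at N.isCont_cdf at)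
  have "(\<integral>\<^sup>+ s\<in>{a..b}. f s * g (Q s) \<partial>lborel) = (\<integral>\<^sup>+ s. f s * indicator {a..b} s * g (cdf N s) \<partial>lborel)"
    by (intro nn_integral_cong) (auto simp: cdf split: split_indicator)
  also have "\<dots> = (\<integral>\<^sup>+ s. g (cdf N s) \<partial>N)"
    unfolding N_def[symmetric] by (subst (2) N_def, subst nn_integral_density) auto
  also have "\<dots> = (\<integral>\<^sup>+ v. g v \<partial>distr N borel (cdf N))"
    by (subst nn_integral_distr) (auto simp: measurable_cong_sets[OF N.M_is_borel refl])
  also have "\<dots> = (\<integral>\<^sup>+ v\<in>{0..Q b}. g v \<partial>lborel)"
    unfolding d by (subst nn_integral_density) (auto simp: mult.commute)
  finally show ?thesis .
qed


section \<open>Jump kernels and survival functions\<close>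

lemma nn_integral_Ioo_eq_Icc:
  fixes f :: "real \<Rightarrow> ennreal"
  shows "(\<integral>\<^sup>+ s\<in>{a<..<b}. f s \<partial>lborel) = (\<integral>\<^sup>+ s\<in>{a..b}. f s \<partial>lborel)"
proof (rule nn_integral_cong_AE)
  show "AE s in lborel. f s * indicator {a<..<b} s = f s * indicator {a..b} s"
    by (rule AE_I[of _ _ "{a, b}"])
       (auto split: split_indicator simp: emeasure_lborel_countable less_le)
qed

text \<open>The analytic part rests on a jump kernel defined for all real times. Rates are finite at
  each time and integrable along segments of \<open>I\<close>, but may be unbounded;
  \<open>interval\<close> keeps the intermediate jump times of a segment in
  \<open>I\<close>.\<close>

locale rate_kernel =
  fixes M :: "'a measure" and k :: "'a \<Rightarrow> real \<Rightarrow> 'a measure" and I :: "real set"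
  assumes sets_k [measurable_cong, simp]: "sets (k x s) = sets M"
    and finite_k: "x \<in> space M \<Longrightarrow> emeasure (k x s) (space M) < \<infinity>"
    and measurable_k: "B \<in> sets M \<Longrightarrow>
      (\<lambda>(x, s). emeasure (k x s) B) \<in> borel_measurable (M \<Otimes>\<^sub>M borel)"
    and interval: "u \<in> I \<Longrightarrow> t \<in> I \<Longrightarrow> {u..t} \<subseteq> I"
    and integrable_k: "x \<in> space M \<Longrightarrow> u \<in> I \<Longrightarrow> t \<in> I \<Longrightarrow>
      (\<integral>\<^sup>+ s\<in>{u..t}. emeasure (k x s) (space M) \<partial>lborel) < \<infinity>"
begin

definition rate :: "'a \<Rightarrow> real \<Rightarrow> ennreal" where
  "rate x s = emeasure (k x s) (space M)"

definition cum :: "'a \<Rightarrow> real \<Rightarrow> real \<Rightarrow> ennreal" where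
  "cum x u t = (\<integral>\<^sup>+ s\<in>{u..t}. rate x s \<partial>lborel)"

text \<open>\<open>enn2real\<close> would turn an infinite cumulative rate into 0, hence survival
  into 1; \<open>cum_finite\<close> excludes this for states in \<open>space M\<close> and times in
  \<open>I\<close>.\<close>

definition surv :: "'a \<Rightarrow> real \<Rightarrow> real \<Rightarrow> ennreal" where
  "surv x u t = ennreal (exp (- enn2real (cum x u t)))"

text \<open>\<open>J n f u x t\<close> integrates \<open>f\<close> over the state at time \<open>t\<close>, restricted to the paths from \<open>x\<close> at
  time \<open>u\<close> with exactly \<open>n\<close> jumps in \<open>]u, t]\<close>.\<close>

primrec J :: "nat \<Rightarrow> ('a \<Rightarrow> ennreal) \<Rightarrow> real \<Rightarrow> 'a \<Rightarrow> real \<Rightarrow> ennreal" where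
  "J 0 f u x t = f x * surv x u t"
| "J (Suc n) f u x t =
    (\<integral>\<^sup>+ w\<in>{u<..<t}. (\<integral>\<^sup>+ y. surv x u w * J n f w y t \<partial>k x w) \<partial>lborel)"

lemma space_k [simp]: "space (k x s) = space M"
  by (rule sets_eq_imp_space_eq) simp

lemma measurable_emeasure_k:
  assumes [measurable]: "g \<in> N \<rightarrow>\<^sub>M M" "h \<in> borel_measurable N" "B \<in> sets M"
  shows "(\<lambda>z. emeasure (k (g z) (h z)) B) \<in> borel_measurable N"
proof -
  have "(\<lambda>z. (g z, h z)) \<in> N \<rightarrow>\<^sub>M M \<Otimes>\<^sub>M borel" by measurable
  from measurable_compose[OF this measurable_k[OF assms(3)]] show ?thesis by simp
qed

lemma measurable_rate [measurable]:
  assumes "g \<in> N \<rightarrow>\<^sub>M M" "h \<in> borel_measurable N"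
  shows "(\<lambda>z. rate (g z) (h z)) \<in> borel_measurable N"
  unfolding rate_def using assms by (intro measurable_emeasure_k) auto

text \<open>Dividing by one plus the total mass turns the kernel into a sub-probability kernel.\<close>

lemma measurable_nn_integral_k [measurable (raw)]:
  assumes [measurable]: "(\<lambda>(z, y). f z y) \<in> borel_measurable (N \<Otimes>\<^sub>M M)"
    "g \<in> N \<rightarrow>\<^sub>M M" "h \<in> borel_measurable N"
  shows "(\<lambda>z. \<integral>\<^sup>+ y. f z y \<partial>k (g z) (h z)) \<in> borel_measurable N"
proof -
  define L where "L z = scale_measure (inverse (1 + rate (g z) (h z))) (k (g z) (h z))" for z
  have gM: "g z \<in> space M" if "z \<in> space N" for z
    using measurable_space[OF assms(2) that] .
  have inv: "(1 + rate (g z) (h z)) * inverse (1 + rate (g z) (h z)) = 1" if "z \<in> space N" for z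
    using finite_k[OF gM[OF that], of "h z"]
    by (subst divide_ennreal_def[symmetric], intro ennreal_divide_self) (auto simp: rate_def)
  have L: "L \<in> N \<rightarrow>\<^sub>M subprob_algebra M"
  proof (rule measurable_subprob_algebra)
    fix z assume z: "z \<in> space N"
    let ?r = "rate (g z) (h z)"
    have "inverse (1 + ?r) * ?r \<le> (1 + ?r) * inverse (1 + ?r)"
      unfolding mult.commute[of "1 + ?r"] by (intro mult_left_mono) auto
    also have "\<dots> = 1" by (rule inv[OF z])
    finally show "subprob_space (L z)"
      using gM[OF z] by (auto intro!: subprob_spaceI simp: L_def space_scale_measure rate_def)
    show "sets (L z) = sets M" by (simp add: L_def)
  next
    fix B assume [measurable]: "B \<in> sets M"
    have [measurable]: "(\<lambda>z. emeasure (k (g z) (h z)) B) \<in> borel_measurable N"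
      by (intro measurable_emeasure_k) auto
    show "(\<lambda>z. emeasure (L z) B) \<in> borel_measurable N"
      unfolding L_def emeasure_scale_measure by measurable
  qed
  have "(\<lambda>z. (1 + rate (g z) (h z)) * (\<integral>\<^sup>+ y. f z y \<partial>L z)) \<in> borel_measurable N"
    using nn_integral_measurable_subprob_algebra2[OF assms(1) L] by measurable
  then show ?thesis
  proof (rule measurable_cong[THEN iffD1, rotated])
    fix z assume z: "z \<in> space N"
    have "f z \<in> borel_measurable (k (g z) (h z))"
      using z assms(1) by measurable
    then have "(\<integral>\<^sup>+ y. f z y \<partial>L z) = inverse (1 + rate (g z) (h z)) * (\<integral>\<^sup>+ y. f z y \<partial>k (g z) (h z))"
      by (simp add: L_def nn_integral_scale_measure)
    then show "(1 + rate (g z) (h z)) * (\<integral>\<^sup>+ y. f z y \<partial>L z) = (\<integral>\<^sup>+ y. f z y \<partial>k (g z) (h z))"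
      by (simp add: mult.assoc[symmetric] inv[OF z])
  qed
qed

lemma measurable_cum [measurable]:
  assumes [measurable]: "g \<in> N \<rightarrow>\<^sub>M M" "a \<in> borel_measurable N" "b \<in> borel_measurable N"
  shows "(\<lambda>z. cum (g z) (a z) (b z)) \<in> borel_measurable N"
proof -
  \<comment> \<open>The moving endpoints become a condition on the pair \<open>(z, s)\<close>, which
    makes the integrand jointly measurable.\<close>
  have "(\<lambda>z. \<integral>\<^sup>+ s. rate (g z) s * (if a z \<le> s \<and> s \<le> b z then 1 else 0) \<partial>lborel) \<in> borel_measurable N"
    by measurable
  then show ?thesis
    unfolding cum_def by (simp add: indicator_def)
qed

lemma measurable_surv [measurable]:
  assumes [measurable]: "g \<in> N \<rightarrow>\<^sub>M M" "a \<in> borel_measurable N" "b \<in> borel_measurable N"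
  shows "(\<lambda>z. surv (g z) (a z) (b z)) \<in> borel_measurable N"
  unfolding surv_def by measurable

lemma surv_le_1: "surv x u t \<le> 1"
  by (simp add: surv_def)

lemma surv_refl [simp]: "surv x u u = 1"
proof -
  have "cum x u u = 0"
    unfolding cum_def by (rule nn_integral_null_set) (simp add: finite_imp_null_set_lborel)
  then show ?thesis by (simp add: surv_def)
qed

lemma cum_finite: "x \<in> space M \<Longrightarrow> u \<in> I \<Longrightarrow> t \<in> I \<Longrightarrow> cum x u t < \<infinity>"
  using integrable_k by (simp add: cum_def rate_def)

lemma cum_split:
  assumes x: "x \<in> space M" and "u \<le> s" "s \<le> t"
  shows "cum x u t = cum x u s + cum x s t"
proof -
  have [measurable]: "(\<lambda>s. rate x s) \<in> borel_measurable borel" using x by measurable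
  have "cum x u t = (\<integral>\<^sup>+ r. rate x r * indicator {u..s} r + rate x r * indicator {s<..t} r \<partial>lborel)"
    unfolding cum_def by (intro nn_integral_cong) (use assms in \<open>auto split: split_indicator\<close>)
  also have "\<dots> = cum x u s + (\<integral>\<^sup>+ r\<in>{s<..t}. rate x r \<partial>lborel)"
    unfolding cum_def by (rule nn_integral_add) auto
  also have "(\<integral>\<^sup>+ r\<in>{s<..t}. rate x r \<partial>lborel) = cum x s t"
    unfolding cum_def
    by (intro nn_integral_cong_AE AE_I[of _ _ "{s}"]) (auto split: split_indicator simp: less_le)
  finally show ?thesis .
qed

lemma surv_mult:
  assumes "x \<in> space M" "u \<in> I" "t \<in> I" "u \<le> s" "s \<le> t"
  shows "surv x u s * surv x s t = surv x u t"
proof -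
  have "s \<in> I" using interval[of u t] assms by auto
  then have "enn2real (cum x u t) = enn2real (cum x u s) + enn2real (cum x s t)"
    using assms cum_finite by (simp add: cum_split[of x u s t] enn2real_plus)
  then show ?thesis by (simp add: surv_def ennreal_mult[symmetric] exp_add[symmetric])
qed

text \<open>The first jump after \<open>u\<close> has density \<open>rate x w * surv x u w\<close>,
  and \<open>surv x u t\<close> is the remaining mass. Substituting the cumulative rate leaves the
  integral of \<open>exp (- v)\<close> from 0 to the cumulative rate up to \<open>t\<close>.\<close>

lemma nn_integral_rate_surv:
  assumes x: "x \<in> space M" and "u \<in> I" "t \<in> I" "u \<le> t"
  shows "(\<integral>\<^sup>+ w\<in>{u<..<t}. rate x w * surv x u w \<partial>lborel) + surv x u t = 1"
proof -
  let ?Q = "enn2real (cum x u t)"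
  have [measurable]: "(\<lambda>s. rate x s) \<in> borel_measurable borel" using x by measurable
  have "(\<integral>\<^sup>+ w\<in>{u<..<t}. rate x w * surv x u w \<partial>lborel) =
      (\<integral>\<^sup>+ w\<in>{u..t}. rate x w * ennreal (exp (- enn2real (\<integral>\<^sup>+ s\<in>{u..w}. rate x s \<partial>lborel))) \<partial>lborel)"
    by (simp add: nn_integral_Ioo_eq_Icc surv_def cum_def)
  also have "\<dots> = (\<integral>\<^sup>+ v\<in>{0..?Q}. ennreal (exp (- v)) \<partial>lborel)"
    using nn_integral_substitution_cumulative[of "rate x" "\<lambda>v. ennreal (exp (- v))" u t]
      cum_finite[of x u t] assms by (simp add: cum_def)
  also have "\<dots> = ennreal (- exp (- ?Q) - (- exp (- 0)))"
    by (intro nn_integral_FTC_Icc) (auto intro!: derivative_eq_intros)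
  finally show ?thesis by (simp add: surv_def flip: ennreal_plus)
qed

text \<open>Here the left end of the survival interval moves. With cumulative rates measured from
  \<open>a\<close>, \<open>surv x s w\<close> is \<open>exp (Q s - Q w)\<close>, and the same
  substitution applies up to \<open>b\<close>. The case \<open>b < w\<close> will be that of a jump
  before \<open>w\<close>.\<close>

lemma nn_integral_rate_surv_backward:
  assumes x: "x \<in> space M" and "a \<in> I" "w \<in> I" "a \<le> b" "b \<le> w"
  shows "(\<integral>\<^sup>+ s\<in>{a<..<b}. rate x s * surv x s w \<partial>lborel) + surv x a w = surv x b w"
proof -
  have bI: "b \<in> I" using assms interval[of a w] by auto
  let ?Q = "\<lambda>s. enn2real (cum x a s)"
  have [measurable]: "(\<lambda>s. rate x s) \<in> borel_measurable borel" using x by measurable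
  have Q: "enn2real (cum x s w) = ?Q w - ?Q s" if "s \<in> {a..b}" for s
  proof -
    have "s \<in> I" using interval[of a b] that assms bI by auto
    then show ?thesis using assms that cum_finite by (simp add: cum_split[of x a s w] enn2real_plus)
  qed
  have Q': "- enn2real (cum x s w) = ?Q s - ?Q w" if "a \<le> s" "s \<le> b" for s
    using Q[of s] that by simp
  have "(\<integral>\<^sup>+ s\<in>{a<..<b}. rate x s * surv x s w \<partial>lborel) =
      (\<integral>\<^sup>+ s\<in>{a..b}. rate x s * ennreal (exp (?Q s - ?Q w)) \<partial>lborel)"
    unfolding nn_integral_Ioo_eq_Icc
    by (intro nn_integral_cong) (auto simp: surv_def Q' split: split_indicator)
  also have "\<dots> = (\<integral>\<^sup>+ v\<in>{0..?Q b}. ennreal (exp (v - ?Q w)) \<partial>lborel)"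
    using nn_integral_substitution_cumulative[of "rate x" "\<lambda>v. ennreal (exp (v - ?Q w))" a b]
      cum_finite[of x a b] assms bI by (simp add: cum_def)
  also have "\<dots> = ennreal (exp (?Q b - ?Q w) - exp (0 - ?Q w))"
    by (intro nn_integral_FTC_Icc) (auto intro!: derivative_eq_intros)
  also have "\<dots> + surv x a w = surv x b w"
    using Q[of b] assms(4) by (simp add: surv_def flip: ennreal_plus)
  finally show ?thesis .
qed

lemma measurable_J_aux:
  assumes [measurable]: "f \<in> borel_measurable M"
  shows "(\<lambda>(u, x, t). J n f u x t) \<in> borel_measurable (borel \<Otimes>\<^sub>M M \<Otimes>\<^sub>M borel)"
proof (induction n)
  case 0
  then show ?case by simp
next
  case (Suc n)
  note Suc [measurable]
  \<comment> \<open>The induction hypothesis under composition, at the type of the tuples formed by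
    \<open>(u, x, t)\<close>, the jump time \<open>w\<close> and the new state
    \<open>y\<close>.\<close>
  have [measurable]: "(\<lambda>z. J n f (a z) (g z) (b z)) \<in> borel_measurable N"
    if [measurable]: "a \<in> borel_measurable N" "b \<in> borel_measurable N" "g \<in> N \<rightarrow>\<^sub>M M"
    for a b g and N :: "(((real \<times> 'a \<times> real) \<times> real) \<times> 'a) measure"
  proof -
    have "(\<lambda>z. (a z, g z, b z)) \<in> N \<rightarrow>\<^sub>M borel \<Otimes>\<^sub>M M \<Otimes>\<^sub>M borel" by measurable
    from measurable_compose[OF this Suc] show ?thesis by simp
  qed
  have "(\<lambda>(u, x, t). \<integral>\<^sup>+ w. (\<integral>\<^sup>+ y. surv x u w * J n f w y t \<partial>k x w) *
      (if u < w \<and> w < t then 1 else 0) \<partial>lborel) \<in> borel_measurable (borel \<Otimes>\<^sub>M M \<Otimes>\<^sub>M borel)"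
    unfolding case_prod_unfold by measurable
  then show ?case by (simp add: indicator_def)
qed

lemma measurable_J [measurable (raw)]:
  assumes [measurable]: "f \<in> borel_measurable M" "a \<in> borel_measurable N" "b \<in> borel_measurable N" "g \<in> N \<rightarrow>\<^sub>M M"
  shows "(\<lambda>z. J n f (a z) (g z) (b z)) \<in> borel_measurable N"
proof -
  have "(\<lambda>z. (a z, g z, b z)) \<in> N \<rightarrow>\<^sub>M borel \<Otimes>\<^sub>M M \<Otimes>\<^sub>M borel" by measurable
  from measurable_compose[OF this measurable_J_aux] show ?thesis by simp
qed

end


section \<open>The backward recursion\<close>

lemma suminf_single:
  fixes f :: "nat \<Rightarrow> 'a::{comm_monoid_add, t2_space}"
  assumes "\<And>n. n \<noteq> i \<Longrightarrow> f n = 0"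
  shows "(\<Sum>n. f n) = f i"
  using suminf_finite[of "{i}" f] assms by simp

lemma suminf_swap_ennreal:
  fixes g :: "nat \<Rightarrow> nat \<Rightarrow> ennreal"
  shows "(\<Sum>n. \<Sum>i. g i n) = (\<Sum>i. \<Sum>n. g i n)"
proof -
  have "(\<Sum>n. \<Sum>i. g i n) = (\<integral>\<^sup>+ n. (\<Sum>i. g i n) \<partial>count_space UNIV)"
    by (rule nn_integral_count_space_nat[symmetric])
  also have "\<dots> = (\<Sum>i. \<integral>\<^sup>+ n. g i n \<partial>count_space UNIV)"
    by (rule nn_integral_suminf) simp
  finally show ?thesis by (simp only: nn_integral_count_space_nat)
qed

text \<open>Pairs \<open>(i, m)\<close> are grouped by their sum \<open>n\<close>. This recombines
  the numbers of jumps before and after an intermediate time.\<close>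

lemma suminf_triangle_ennreal:
  fixes a :: "nat \<Rightarrow> nat \<Rightarrow> ennreal"
  shows "(\<Sum>n. \<Sum>i\<le>n. a i (n - i)) = (\<Sum>i. \<Sum>m. a i m)"
proof -
  have "(\<Sum>n. \<Sum>i\<le>n. a i (n - i)) = (\<Sum>n. \<Sum>i. if i \<le> n then a i (n - i) else 0)"
  proof (intro suminf_cong)
    fix n
    show "(\<Sum>i\<le>n. a i (n - i)) = (\<Sum>i. if i \<le> n then a i (n - i) else 0)"
      using suminf_finite[of "{..n}" "\<lambda>i. if i \<le> n then a i (n - i) else 0"] by auto
  qed
  also have "\<dots> = (\<Sum>i. \<Sum>n. if i \<le> n then a i (n - i) else 0)"
    by (rule suminf_swap_ennreal)
  also have "\<dots> = (\<Sum>i. \<Sum>m. a i m)"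
  proof (rule suminf_cong)
    fix i
    show "(\<Sum>n. if i \<le> n then a i (n - i) else 0) = (\<Sum>m. a i m)"
      by (subst suminf_offset[where i=i]) (auto intro!: sum.neutral)
  qed
  finally show ?thesis .
qed

text \<open>Monotone limits are reduced to series by telescoping, so that countable additivity of the
  functional suffices.\<close>

lemma
  fixes I :: "('b \<Rightarrow> ennreal) \<Rightarrow> ennreal"
  assumes cong: "\<And>f g. (\<And>x. x \<in> space K \<Longrightarrow> f x = g x) \<Longrightarrow> I f = I g"
    and cmult: "\<And>f c. f \<in> borel_measurable K \<Longrightarrow> I (\<lambda>x. c * f x) = c * I f"
    and suminf: "\<And>f :: nat \<Rightarrow> 'b \<Rightarrow> ennreal. (\<And>i. f i \<in> borel_measurable K) \<Longrightarrow>
      I (\<lambda>x. \<Sum>i. f i x) = (\<Sum>i. I (f i))"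
  shows measure_space_functional: "measure_space (space K) (sets K) (\<lambda>E. I (indicator E))"
    and nn_integral_functional: "f \<in> borel_measurable K \<Longrightarrow>
      (\<integral>\<^sup>+ x. f x \<partial>measure_of (space K) (sets K) (\<lambda>E. I (indicator E))) = I f"
proof -
  let ?N = "measure_of (space K) (sets K) (\<lambda>E. I (indicator E))"
  have zero: "I (\<lambda>_. 0) = 0"
    using cmult[of "\<lambda>_. 0" 0] by simp
  have sum: "I (\<lambda>x. \<Sum>i\<le>n. d i x) = (\<Sum>i\<le>n. I (d i))"
    if [measurable]: "\<And>i::nat. d i \<in> borel_measurable K" for d n
  proof -
    have fin: "(\<Sum>i. if i \<le> n then c i else 0) = (\<Sum>i\<le>n. c i)" for c :: "nat \<Rightarrow> ennreal"
      using suminf_finite[of "{..n}" "\<lambda>i. if i \<le> n then c i else 0"] by auto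
    have "I (\<lambda>x. \<Sum>i. if i \<le> n then d i x else 0) = (\<Sum>i. I (\<lambda>x. if i \<le> n then d i x else 0))"
      by (rule suminf) measurable
    also have "\<dots> = (\<Sum>i. if i \<le> n then I (d i) else 0)"
      by (intro suminf_cong) (auto simp: zero)
    finally show ?thesis unfolding fin .
  qed
  show ms: "measure_space (space K) (sets K) (\<lambda>E. I (indicator E))"
    unfolding measure_space_def
  proof (intro conjI sets.sigma_algebra_axioms)
    show "positive (sets K) (\<lambda>E. I (indicator E))"
      using zero by (simp add: positive_def indicator_def[abs_def])
    show "countably_additive (sets K) (\<lambda>E. I (indicator E))"
    proof (rule countably_additiveI)
      fix A :: "nat \<Rightarrow> 'b set" assume A: "range A \<subseteq> sets K" "disjoint_family A"
      then have [measurable]: "A i \<in> sets K" for i by auto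
      have "(\<Sum>i. I (indicator (A i))) = I (\<lambda>x. \<Sum>i. indicator (A i) x)"
        by (rule suminf[symmetric]) measurable
      then show "(\<Sum>i. I (indicator (A i))) = I (indicator (\<Union>i. A i))"
        by (simp add: suminf_indicator[OF A(2)])
    qed
  qed
  have [measurable_cong]: "sets ?N = sets K" by simp
  have em: "emeasure ?N E = I (indicator E)" if "E \<in> sets K" for E
    using ms that by (intro emeasure_measure_of_sigma) (auto simp: measure_space_def)
  show "(\<integral>\<^sup>+ x. f x \<partial>?N) = I f" if "f \<in> borel_measurable K"
    using that
  proof induction
    case (cong f g)
    have "(\<integral>\<^sup>+ x. f x \<partial>?N) = (\<integral>\<^sup>+ x. g x \<partial>?N)"
      by (intro nn_integral_cong) (use cong in auto)
    then show ?case using cong.IH assms(1)[of f g] cong.hyps by simp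
  next
    case (set A)
    then show ?case by (simp add: em)
  next
    case (mult u c)
    then have "u \<in> borel_measurable ?N" by (simp cong: measurable_cong_sets)
    then show ?case using mult by (simp add: nn_integral_cmult cmult)
  next
    case (add f g)
    then have [measurable]: "f \<in> borel_measurable K" "g \<in> borel_measurable K" by auto
    have "I (\<lambda>x. \<Sum>i\<le>Suc 0. (if i = 0 then f else g) x) = (\<Sum>i\<le>Suc 0. I (if i = 0 then f else g))"
      by (rule sum) auto
    then have "I (\<lambda>x. f x + g x) = I f + I g" by simp
    moreover have "(\<integral>\<^sup>+ x. f x + g x \<partial>?N) = (\<integral>\<^sup>+ x. f x \<partial>?N) + (\<integral>\<^sup>+ x. g x \<partial>?N)"
      by (rule nn_integral_add) measurable
    ultimately show ?case using add by (simp add: add.commute)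
  next
    case (seq U)
    then have [measurable]: "U i \<in> borel_measurable K" for i by auto
    define d where "d i x = (case i of 0 \<Rightarrow> U 0 x | Suc j \<Rightarrow> U (Suc j) x - U j x)" for i x
    have [measurable]: "d i \<in> borel_measurable K" for i
      unfolding d_def by (cases i) auto
    have U: "U n x = (\<Sum>i\<le>n. d i x)" for n x
    proof (induction n)
      case (Suc n)
      have "U n x \<le> U (Suc n) x" using seq by (auto simp: incseq_def le_fun_def)
      then show ?case using Suc by (simp add: d_def add_diff_inverse_ennreal)
    qed (simp add: d_def)
    have "(SUP n. U n) x = (\<Sum>i. d i x)" for x
    proof -
      have "incseq (\<lambda>n. U n x)" using seq by (auto simp: incseq_def le_fun_def)
      then have "(\<lambda>n. \<Sum>i\<le>n. d i x) \<longlonglongrightarrow> (SUP n. U n x)"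
        unfolding U[symmetric] by (rule LIMSEQ_SUP)
      then have "(\<lambda>i. d i x) sums (SUP n. U n x)" by (simp add: sums_def_le)
      then show ?thesis by (simp add: sums_unique image_comp)
    qed
    then have "I (SUP n. U n) = (\<Sum>i. I (d i))"
      using suminf[of d] by (simp add: assms(1)[of "SUP n. U n"])
    also have "\<dots> = (SUP n. I (U n))"
    proof -
      have IU: "I (U n) = (\<Sum>i\<le>n. I (d i))" for n
        using sum[of d n] by (simp add: U[abs_def])
      have "incseq (\<lambda>n. I (U n))"
        unfolding IU by (intro incseq_SucI) simp
      then have "(\<lambda>n. \<Sum>i\<le>n. I (d i)) \<longlonglongrightarrow> (SUP n. I (U n))"
        unfolding IU[symmetric] by (rule LIMSEQ_SUP)
      then have "(\<lambda>i. I (d i)) sums (SUP n. I (U n))" by (simp add: sums_def_le)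
      then show ?thesis by (rule sums_unique[symmetric])
    qed
    also have "\<dots> = (SUP n. \<integral>\<^sup>+ x. U n x \<partial>?N)" using seq by simp
    also have "\<dots> = (\<integral>\<^sup>+ x. (SUP n. U n x) \<partial>?N)"
      by (rule nn_integral_monotone_convergence_SUP[symmetric]) (use seq in \<open>auto cong: measurable_cong_sets\<close>)
    also have "\<dots> = (\<integral>\<^sup>+ x. (SUP n. U n) x \<partial>?N)" by (simp only: SUP_apply)
    finally show ?case by (rule sym)
  qed
qed

section \<open>Linearity, total mass and Chapman-Kolmogorov equation of the recursion\<close>

context rate_kernel
begin

lemma measurable_J_section:
  assumes [measurable]: "f \<in> borel_measurable M"
  shows "(\<lambda>y. J n f w y t) \<in> borel_measurable M"
  by measurable

lemma J_cong:
  assumes "\<And>y. y \<in> space M \<Longrightarrow> f y = g y" "x \<in> space M"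
  shows "J n f u x t = J n g u x t"
  using assms(2)
proof (induction n arbitrary: u x)
  case (Suc n)
  then show ?case
    by (auto intro!: nn_integral_cong arg_cong2[where f="(*)"])
qed (simp add: assms)

lemma J_Suc':
  assumes [measurable]: "f \<in> borel_measurable M"
  shows "J (Suc n) f u x t =
    (\<integral>\<^sup>+ w\<in>{u<..<t}. surv x u w * (\<integral>\<^sup>+ y. J n f w y t \<partial>k x w) \<partial>lborel)"
  by (simp add: nn_integral_cmult)

lemma J_cmult:
  assumes [measurable]: "f \<in> borel_measurable M" and "x \<in> space M"
  shows "J n (\<lambda>y. c * f y) u x t = c * J n f u x t"
  using assms(2)
proof (induction n arbitrary: u x)
  case (Suc n)
  note [measurable] = Suc.prems
  have "J (Suc n) (\<lambda>y. c * f y) u x t =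
      (\<integral>\<^sup>+ w\<in>{u<..<t}. surv x u w * (\<integral>\<^sup>+ y. c * J n f w y t \<partial>k x w) \<partial>lborel)"
    unfolding J_Suc'[OF borel_measurable_times_ennreal[OF borel_measurable_const assms(1)]]
    by (intro nn_integral_cong arg_cong2[where f="(*)"] refl) (simp add: Suc.IH)
  also have "\<dots> = (\<integral>\<^sup>+ w. c * (surv x u w * (\<integral>\<^sup>+ y. J n f w y t \<partial>k x w) * indicator {u<..<t} w) \<partial>lborel)"
    by (intro nn_integral_cong) (simp add: nn_integral_cmult ac_simps)
  also have "\<dots> = c * J (Suc n) f u x t"
    unfolding J_Suc'[OF assms(1)] by (rule nn_integral_cmult) measurable
  finally show ?case .
qed (simp add: ac_simps)

lemma J_suminf:
  assumes [measurable]: "\<And>i. f i \<in> borel_measurable M" and "x \<in> space M"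
  shows "J n (\<lambda>y. \<Sum>i. f i y) u x t = (\<Sum>i. J n (f i) u x t)"
  using assms(2)
proof (induction n arbitrary: u x)
  case (Suc n)
  note [measurable] = Suc.prems
  have "J (Suc n) (\<lambda>y. \<Sum>i. f i y) u x t =
      (\<integral>\<^sup>+ w\<in>{u<..<t}. surv x u w * (\<integral>\<^sup>+ y. (\<Sum>i. J n (f i) w y t) \<partial>k x w) \<partial>lborel)"
    by (subst J_Suc') (auto intro!: nn_integral_cong arg_cong2[where f="(*)"] simp: Suc.IH)
  also have "\<dots> = (\<integral>\<^sup>+ w. (\<Sum>i. surv x u w * (\<integral>\<^sup>+ y. J n (f i) w y t \<partial>k x w) * indicator {u<..<t} w) \<partial>lborel)"
    by (intro nn_integral_cong) (simp add: nn_integral_suminf)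
  also have "\<dots> = (\<Sum>i. J (Suc n) (f i) u x t)"
    unfolding J_Suc'[OF assms(1)] by (rule nn_integral_suminf) measurable
  finally show ?case .
qed simp

text \<open>Induction on the number of terms, for all starting points at once. After a first jump at
  \<open>w\<close>, the remaining terms form a shorter sum started at \<open>(w, y)\<close> and
  bounded by 1, so the jump part is at most the mass of \<open>rate x w * surv x u w\<close>;
  \<open>nn_integral_rate_surv\<close> adds this and the survival term up to 1.\<close>

lemma sum_J_le_1:
  assumes [measurable]: "f \<in> borel_measurable M" and f: "\<And>y. y \<in> space M \<Longrightarrow> f y \<le> 1"
    and "x \<in> space M" "u \<in> I" "t \<in> I" "u \<le> t"
  shows "(\<Sum>n<N. J n f u x t) \<le> 1"
  using assms(3-)
proof (induction N arbitrary: u x)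
  case (Suc N)
  note [measurable] = Suc.prems(1)
  have "(\<Sum>n<Suc N. J n f u x t) = J 0 f u x t + (\<Sum>n<N. J (Suc n) f u x t)"
    by (rule sum.lessThan_Suc_shift)
  also have "(\<Sum>n<N. J (Suc n) f u x t) =
      (\<integral>\<^sup>+ w. (\<Sum>n<N. surv x u w * (\<integral>\<^sup>+ y. J n f w y t \<partial>k x w) * indicator {u<..<t} w) \<partial>lborel)"
    unfolding J_Suc'[OF assms(1)] by (rule nn_integral_sum[symmetric]) measurable
  also have "\<dots> = (\<integral>\<^sup>+ w\<in>{u<..<t}. surv x u w * (\<integral>\<^sup>+ y. (\<Sum>n<N. J n f w y t) \<partial>k x w) \<partial>lborel)"
    by (intro nn_integral_cong) (simp add: sum_distrib_left sum_distrib_right nn_integral_sum)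
  also have "\<dots> \<le> (\<integral>\<^sup>+ w\<in>{u<..<t}. rate x w * surv x u w \<partial>lborel)"
  proof (intro nn_integral_mono)
    fix w
    have "(\<integral>\<^sup>+ y. (\<Sum>n<N. J n f w y t) \<partial>k x w) \<le> rate x w" if "w \<in> {u<..<t}"
    proof -
      have "w \<in> I" using that interval[of u t] Suc.prems by auto
      then have "(\<integral>\<^sup>+ y. (\<Sum>n<N. J n f w y t) \<partial>k x w) \<le> (\<integral>\<^sup>+ y. 1 \<partial>k x w)"
        using Suc that by (intro nn_integral_mono) auto
      then show ?thesis by (simp add: rate_def)
    qed
    then show "surv x u w * (\<integral>\<^sup>+ y. (\<Sum>n<N. J n f w y t) \<partial>k x w) * indicator {u<..<t} w
        \<le> rate x w * surv x u w * indicator {u<..<t} w"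
      by (auto split: split_indicator simp: mult.commute[of "rate x w"] intro!: mult_left_mono)
  qed
  finally have "(\<Sum>n<Suc N. J n f u x t) \<le>
      J 0 f u x t + (\<integral>\<^sup>+ w\<in>{u<..<t}. rate x w * surv x u w \<partial>lborel)"
    by (simp only: add_left_mono)
  also have "\<dots> \<le> surv x u t + (\<integral>\<^sup>+ w\<in>{u<..<t}. rate x w * surv x u w \<partial>lborel)"
    using mult_right_mono[OF f[OF Suc.prems(1)], of "surv x u t"] by (intro add_right_mono) simp
  finally have "(\<Sum>n<Suc N. J n f u x t) \<le>
      surv x u t + (\<integral>\<^sup>+ w\<in>{u<..<t}. rate x w * surv x u w \<partial>lborel)" .
  then show ?case
    using nn_integral_rate_surv[OF Suc.prems] by (simp add: add.commute)
qed simp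

lemma suminf_J_le_1:
  assumes "f \<in> borel_measurable M" "\<And>y. y \<in> space M \<Longrightarrow> f y \<le> 1"
    and "x \<in> space M" "u \<in> I" "t \<in> I" "u \<le> t"
  shows "(\<Sum>n. J n f u x t) \<le> 1"
  by (rule suminf_le_const) (use sum_J_le_1[OF assms] in auto)

text \<open>The paths with \<open>n\<close> jumps in \<open>]u, t]\<close> are split according to the number \<open>i\<close> of jumps
  in \<open>]u, s]\<close>.\<close>

lemma J_Chapman_Kolmogorov:
  assumes [measurable]: "f \<in> borel_measurable M"
    and "x \<in> space M" "u \<in> I" "t \<in> I" "u < s" "s < t"
  shows "J n f u x t = (\<Sum>i\<le>n. J i (\<lambda>y. J (n - i) f s y t) u x s)"
  using assms(2-5)
proof (induction n arbitrary: u x)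
  case 0
  then show ?case
    using surv_mult[of x u t s] assms by (simp add: ac_simps)
next
  case (Suc n)
  note [measurable] = Suc.prems(1)
  define F where "F w = (\<integral>\<^sup>+ y. J n f w y t \<partial>k x w)" for w
  have [measurable]: "F \<in> borel_measurable borel" unfolding F_def by measurable
  have "J (Suc n) f u x t = (\<integral>\<^sup>+ w\<in>{u<..<t}. surv x u w * F w \<partial>lborel)"
    unfolding F_def by (rule J_Suc'[OF assms(1)])
  \<comment> \<open>The first jump falls before or after \<open>s\<close>; the point
    \<open>s\<close> itself is Lebesgue null.\<close>
  also have "\<dots> = (\<integral>\<^sup>+ w. surv x u w * F w * indicator {u<..<s} w + surv x u w * F w * indicator {s<..<t} w \<partial>lborel)"
    by (intro nn_integral_cong_AE AE_I[of _ _ "{s}"])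
       (use Suc.prems assms in \<open>auto split: split_indicator\<close>)
  also have "\<dots> = (\<integral>\<^sup>+ w\<in>{u<..<s}. surv x u w * F w \<partial>lborel) + (\<integral>\<^sup>+ w\<in>{s<..<t}. surv x u w * F w \<partial>lborel)"
    by (rule nn_integral_add) auto
  \<comment> \<open>A first jump after \<open>s\<close> means survival up to \<open>s\<close>:
    \<open>surv_mult\<close> splits off \<open>surv x u s\<close> and leaves the recursion restarted
    at \<open>(s, x)\<close>. This is the term \<open>i = 0\<close> of the result.\<close>
  also have "(\<integral>\<^sup>+ w\<in>{s<..<t}. surv x u w * F w \<partial>lborel) = surv x u s * J (Suc n) f s x t"
  proof -
    have "(\<integral>\<^sup>+ w\<in>{s<..<t}. surv x u w * F w \<partial>lborel)
        = (\<integral>\<^sup>+ w. surv x u s * (surv x s w * F w * indicator {s<..<t} w) \<partial>lborel)"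
    proof (intro nn_integral_cong)
      fix w
      show "surv x u w * F w * indicator {s<..<t} w = surv x u s * (surv x s w * F w * indicator {s<..<t} w)"
        using surv_mult[of x u w s] Suc.prems subsetD[OF interval[of u t], of w]
        by (auto split: split_indicator simp: mult.assoc[symmetric])
    qed
    also have "\<dots> = surv x u s * J (Suc n) f s x t"
      unfolding F_def J_Suc'[OF assms(1)] by (rule nn_integral_cmult) measurable
    finally show ?thesis .
  qed
  \<comment> \<open>A first jump at \<open>w\<close> before \<open>s\<close> leaves \<open>n\<close>
    jumps from \<open>(w, y)\<close>, which the induction hypothesis splits at \<open>s\<close>;
    counting the first jump raises \<open>i\<close> by one.\<close>
  also have "(\<integral>\<^sup>+ w\<in>{u<..<s}. surv x u w * F w \<partial>lborel)
      = (\<Sum>i\<le>n. J (Suc i) (\<lambda>y. J (n - i) f s y t) u x s)"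
  proof -
    have "F w = (\<integral>\<^sup>+ y. (\<Sum>i\<le>n. J i (\<lambda>y. J (n - i) f s y t) w y s) \<partial>k x w)" if "w \<in> {u<..<s}" for w
      unfolding F_def
    proof (intro nn_integral_cong)
      fix y assume "y \<in> space (k x w)"
      moreover have "w \<in> I" using that Suc.prems interval[of u t] assms by auto
      ultimately show "J n f w y t = (\<Sum>i\<le>n. J i (\<lambda>y. J (n - i) f s y t) w y s)"
        using that Suc by auto
    qed
    then have "(\<integral>\<^sup>+ w\<in>{u<..<s}. surv x u w * F w \<partial>lborel) = (\<integral>\<^sup>+ w\<in>{u<..<s}. surv x u w *
        (\<integral>\<^sup>+ y. (\<Sum>i\<le>n. J i (\<lambda>y. J (n - i) f s y t) w y s) \<partial>k x w) \<partial>lborel)"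
      by (auto intro!: nn_integral_cong split: split_indicator)
    also have "\<dots> = (\<integral>\<^sup>+ w. (\<Sum>i\<le>n. surv x u w *
        (\<integral>\<^sup>+ y. J i (\<lambda>y. J (n - i) f s y t) w y s \<partial>k x w) * indicator {u<..<s} w) \<partial>lborel)"
      by (intro nn_integral_cong) (simp add: nn_integral_sum sum_distrib_left sum_distrib_right)
    also have "\<dots> = (\<Sum>i\<le>n. J (Suc i) (\<lambda>y. J (n - i) f s y t) u x s)"
      unfolding J_Suc'[OF measurable_J_section[OF assms(1)]] by (rule nn_integral_sum) measurable
    finally show ?thesis .
  qed
  also have "(\<Sum>i\<le>n. J (Suc i) (\<lambda>y. J (n - i) f s y t) u x s) + surv x u s * J (Suc n) f s x t
      = (\<Sum>i\<le>Suc n. J i (\<lambda>y. J (Suc n - i) f s y t) u x s)"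
    unfolding sum.atMost_Suc_shift by (simp add: ac_simps del: J.simps(2))
  finally show ?case .
qed

text \<open>Summing over all \<open>n\<close> makes the numbers of jumps before and after
  \<open>s\<close> independent indices; \<open>J_suminf\<close> then moves the second sum into the
  function integrated at time \<open>s\<close>.\<close>

lemma suminf_J_Chapman_Kolmogorov:
  assumes [measurable]: "f \<in> borel_measurable M"
    and "x \<in> space M" "u \<in> I" "t \<in> I" "u < s" "s < t"
  shows "(\<Sum>n. J n f u x t) = (\<Sum>i. J i (\<lambda>y. \<Sum>n. J n f s y t) u x s)"
proof -
  let ?a = "\<lambda>i m. J i (\<lambda>y. J m f s y t) u x s"
  have "(\<Sum>n. J n f u x t) = (\<Sum>n. \<Sum>i\<le>n. ?a i (n - i))"
    by (intro suminf_cong J_Chapman_Kolmogorov assms)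
  also have "\<dots> = (\<Sum>i. \<Sum>m. ?a i m)"
    by (rule suminf_triangle_ennreal)
  also have "\<dots> = (\<Sum>i. J i (\<lambda>y. \<Sum>n. J n f s y t) u x s)"
    by (intro suminf_cong J_suminf[symmetric] assms) measurable
  finally show ?thesis .
qed

end


section \<open>Q-functions\<close>

text \<open>A countable base separates points because metrizable spaces are T1. The sequence yields
  measurable singletons and, through the partitions it generates, joint measurability of the jump
  kernel off the diagonal.\<close>

lemma standard_borel_separating_sequence:
  assumes "standard_borel M"
  obtains b :: "nat \<Rightarrow> 'a set" where "\<And>i. b i \<in> sets M"
    and "\<And>x y. x \<in> space M \<Longrightarrow> y \<in> space M \<Longrightarrow> x \<noteq> y \<Longrightarrow> \<exists>i. x \<in> b i \<and> y \<notin> b i"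
proof -
  obtain S where S: "completely_metrizable_space S" "second_countable S" "topspace S = space M"
    "sets M = sigma_sets (topspace S) {U. openin S U}"
    using assms by (auto simp: standard_borel_def)
  obtain \<B> where B: "countable \<B>" "\<forall>V\<in>\<B>. openin S V"
    "\<forall>U x. openin S U \<and> x \<in> U \<longrightarrow> (\<exists>V\<in>\<B>. x \<in> V \<and> V \<subseteq> U)"
    using S(2) unfolding second_countable_def by (elim exE conjE) (rule that)
  have t1: "t1_space S"
    by (intro metrizable_imp_t1_space completely_metrizable_imp_metrizable_space S)
  \<comment> \<open>Adding the whole space keeps the base nonempty, as
    \<open>range_from_nat_into\<close> requires.\<close>
  define b where "b = from_nat_into (insert (topspace S) \<B>)"
  have b: "range b = insert (topspace S) \<B>"
    unfolding b_def using B(1) by (intro range_from_nat_into) auto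
  show thesis
  proof (rule that)
    fix i
    have "b i \<in> insert (topspace S) \<B>" unfolding b[symmetric] by (rule rangeI)
    then have "openin S (b i)" using B(2) by auto
    then show "b i \<in> sets M" unfolding S(4) by auto
  next
    fix x y assume xy: "x \<in> space M" "y \<in> space M" "x \<noteq> y"
    then obtain U where "openin S U" "x \<in> U" "y \<notin> U"
      using t1[unfolded t1_space_def S(3)] by blast
    then obtain V where "V \<in> \<B>" "x \<in> V" "y \<notin> V" using B(3) by blast
    then have "V \<in> range b" unfolding b by simp
    then show "\<exists>i. x \<in> b i \<and> y \<notin> b i"
      using \<open>x \<in> V\<close> \<open>y \<notin> V\<close> by auto
  qed
qed

lemma finite_signed_measure_sums:
  "finite_signed_measure M m \<Longrightarrow> range A \<subseteq> sets M \<Longrightarrow> disjoint_family A \<Longrightarrow>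
    (\<lambda>i. m (A i)) sums m (\<Union>i. A i)"
  by (simp add: finite_signed_measure_def)

lemma finite_signed_measure_Un:
  assumes "finite_signed_measure M m" "A \<in> sets M" "B \<in> sets M" "A \<inter> B = {}"
  shows "m (A \<union> B) = m A + m B"
proof -
  have "range (binaryset A B) \<subseteq> sets M" "disjoint_family (binaryset A B)"
    using assms by (auto simp: binaryset_def disjoint_family_on_def)
  then have "(\<lambda>i. m (binaryset A B i)) sums m (\<Union>i. binaryset A B i)"
    by (rule finite_signed_measure_sums[OF assms(1)])
  moreover have "(\<lambda>i. m (binaryset A B i)) sums (m A + m B)"
    using assms by (intro binaryset_sums) (simp add: finite_signed_measure_def)
  ultimately show ?thesis
    by (simp add: UN_binaryset_eq sums_unique2)
qed

locale jump_rates =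
  fixes M :: "'a measure" and T0 :: real and T1 :: ereal
    and q :: "'a \<Rightarrow> real \<Rightarrow> 'a set \<Rightarrow> real"
  assumes standard_borel: "standard_borel M"
    and T0_less_T1: "ereal T0 < T1"
    and Q: "Q_function M T0 T1 q" and conservative: "conservative M T0 T1 q"
    and locally_integrable: "\<And>x s. x \<in> space M \<Longrightarrow> T0 < s \<Longrightarrow> ereal s < T1 \<Longrightarrow>
           (\<integral>\<^sup>+ t\<in>{T0..s}. ennreal (q_rate q x t) \<partial>lborel) < \<infinity>"
begin

abbreviation "T \<equiv> time_set T0 T1"

text \<open>Extending the kernel by zero outside the time set makes it total, so that measurability
  in time refers to all of \<open>borel\<close>.\<close>

definition kern :: "'a \<Rightarrow> real \<Rightarrow> 'a measure" where
  "kern x s = (if s \<in> T then q_plus M q x s else null_measure M)"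

lemma
  assumes "x \<in> space M" "t \<in> T"
  shows Q_signed: "finite_signed_measure M (q x t)"
    and Q_nonneg: "B \<in> sets M \<Longrightarrow> 0 \<le> q x t (B - {x})"
    and Q_total: "q x t (space M) = 0"
  using Q conservative assms by (auto simp: Q_function_def conservative_def)

lemma Q_measurable: "B \<in> sets M \<Longrightarrow>
    (\<lambda>(x, t). q x t B) \<in> borel_measurable (M \<Otimes>\<^sub>M restrict_space borel T)"
  using Q[unfolded Q_function_def, THEN conjunct2] by (rule bspec)

lemma T_borel [measurable]: "T \<in> sets borel"
proof -
  have "T = {t. T0 \<le> t} \<inter> {t. ereal t < T1}" by (auto simp: time_set_def)
  then show ?thesis by simp
qed

lemma T_interval: "u \<in> T \<Longrightarrow> t \<in> T \<Longrightarrow> {u..t} \<subseteq> T"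
    using le_less_trans[of "ereal s" "ereal t" T1 for s] by (auto simp: time_set_def)

text \<open>\<open>{x}\<close> is the intersection of all members of the separating sequence that
  contain \<open>x\<close>.\<close>

lemma singleton_sets:
  assumes "x \<in> space M"
  shows "{x} \<in> sets M"
proof -
  obtain b :: "nat \<Rightarrow> 'a set" where [measurable]: "\<And>i. b i \<in> sets M"
    and b: "\<And>x y. x \<in> space M \<Longrightarrow> y \<in> space M \<Longrightarrow> x \<noteq> y \<Longrightarrow> \<exists>i. x \<in> b i \<and> y \<notin> b i"
    using standard_borel_separating_sequence[OF standard_borel] by blast
  have "{x} = space M - (\<Union>i\<in>{i. x \<in> b i}. space M - b i)"
    using b[of x] assms by auto
  moreover have "space M - (\<Union>i\<in>{i. x \<in> b i}. space M - b i) \<in> sets M"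
    by (intro sets.Diff sets.countable_UN'') auto
  ultimately show ?thesis by simp
qed

lemma sets_q_plus [simp]: "sets (q_plus M q x s) = sets M"
  by (simp add: q_plus_def)

lemma space_q_plus [simp]: "space (q_plus M q x s) = space M"
  by (simp add: q_plus_def)

text \<open>\<open>measure_of\<close> returns the given set function only if that is a measure.
  Signed additivity on the sets \<open>A i - {x}\<close> carries over to \<open>ennreal\<close>
  because all these values are nonnegative.\<close>

lemma emeasure_q_plus:
  assumes x: "x \<in> space M" and t: "t \<in> T" and B: "B \<in> sets M"
  shows "emeasure (q_plus M q x t) B = ennreal (q x t (B - {x}))"
  unfolding q_plus_def
proof (rule emeasure_measure_of_sigma)
  have emp: "q x t {} = 0" using Q_signed[OF x t] by (simp add: finite_signed_measure_def)
  then show "positive (sets M) (\<lambda>B. ennreal (q x t (B - {x})))"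
    by (simp add: positive_def)
  show "countably_additive (sets M) (\<lambda>B. ennreal (q x t (B - {x})))"
  proof (rule countably_additiveI)
    fix A :: "nat \<Rightarrow> 'a set" assume A: "range A \<subseteq> sets M" "disjoint_family A"
    have "range (\<lambda>i. A i - {x}) \<subseteq> sets M" "disjoint_family (\<lambda>i. A i - {x})"
      using A singleton_sets[OF x] by (auto simp: disjoint_family_on_def)
    then have "(\<lambda>i. q x t (A i - {x})) sums q x t (\<Union>i. A i - {x})"
      by (rule finite_signed_measure_sums[OF Q_signed[OF x t]])
    moreover have "(\<Union>i. A i - {x}) = (\<Union>i. A i) - {x}" by auto
    ultimately have "(\<lambda>i. q x t (A i - {x})) sums q x t ((\<Union>i. A i) - {x})"
      by simp
    then show "(\<Sum>i. ennreal (q x t (A i - {x}))) = ennreal (q x t (\<Union> (range A) - {x}))"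
      by (rule suminf_ennreal_eq[rotated]) (use A Q_nonneg[OF x t] in auto)
  qed
qed (use B sets.sigma_algebra_axioms in auto)

text \<open>This is where conservativity enters: the mass off \<open>x\<close> balances
  \<open>q x t {x}\<close>, so the total jump intensity is exactly the rate in the exponent of
  \<open>survival\<close>.\<close>

lemma emeasure_q_plus_space:
  assumes x: "x \<in> space M" and t: "t \<in> T"
  shows "emeasure (q_plus M q x t) (space M) = ennreal (q_rate q x t)"
proof -
  have "q x t ({x} \<union> (space M - {x})) = q x t {x} + q x t (space M - {x})"
    by (rule finite_signed_measure_Un[OF Q_signed[OF x t]]) (use singleton_sets[OF x] in auto)
  moreover have "{x} \<union> (space M - {x}) = space M" using x by auto
  ultimately have "q x t (space M - {x}) = q_rate q x t"
    using Q_total[OF x t] by (simp add: q_rate_def)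
  then show ?thesis using emeasure_q_plus[OF x t] by simp
qed

lemma q_rate_nonneg:
  assumes x: "x \<in> space M" and t: "t \<in> T"
  shows "0 \<le> q_rate q x t"
proof -
  have "q x t ({x} \<union> (space M - {x})) = q x t {x} + q x t (space M - {x})"
    by (rule finite_signed_measure_Un[OF Q_signed[OF x t]]) (use singleton_sets[OF x] in auto)
  moreover have "{x} \<union> (space M - {x}) = space M" using x by auto
  ultimately show ?thesis
    using Q_total[OF x t] Q_nonneg[OF x t, of "space M"] by (simp add: q_rate_def)
qed

text \<open>The set \<open>{x}\<close> is the limit of the decreasing cells containing \<open>x\<close> of an increasing sequence of
  finite measurable partitions; this makes \<open>q x t (B - {x})\<close> jointly measurable.\<close>

lemma measurable_q_plus:
  assumes B: "B \<in> sets M"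
  shows "(\<lambda>(x, t). emeasure (q_plus M q x t) B) \<in> borel_measurable (M \<Otimes>\<^sub>M restrict_space borel T)"
proof -
  let ?N = "M \<Otimes>\<^sub>M restrict_space borel T"
  obtain b :: "nat \<Rightarrow> 'a set" where [measurable]: "\<And>i. b i \<in> sets M"
    and b: "\<And>x y. x \<in> space M \<Longrightarrow> y \<in> space M \<Longrightarrow> x \<noteq> y \<Longrightarrow> \<exists>i. x \<in> b i \<and> y \<notin> b i"
    using standard_borel_separating_sequence[OF standard_borel] by blast
  define cell where "cell n x = (\<Inter>i<n. if x \<in> b i then b i else - b i)" for n :: nat and x
  have cell_Suc: "cell (Suc n) x = cell n x \<inter> (if x \<in> b n then b n else - b n)" for n x
    by (auto simp: cell_def lessThan_Suc)
  have cell_sets: "C \<inter> cell n x \<in> sets M" if "C \<in> sets M" for C n x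
    using that
  proof (induction n arbitrary: C)
    case (Suc n)
    have "C \<inter> cell (Suc n) x = (if x \<in> b n then C \<inter> b n else C - b n) \<inter> cell n x"
      by (auto simp: cell_Suc)
    then show ?case using Suc by auto
  qed (simp add: cell_def)
  \<comment> \<open>\<open>C\<close> is generalised because membership of \<open>x\<close> in
    \<open>b n\<close> decides whether \<open>C\<close> is replaced by \<open>C \<inter> b n\<close>
    or \<open>C - b n\<close>; for each \<open>n\<close> the set argument takes only finitely many
    values as \<open>x\<close> varies.\<close>
  have meas: "(\<lambda>(x, t). q x t (C \<inter> cell n x)) \<in> borel_measurable ?N" if "C \<in> sets M" for C n
    using that
  proof (induction n arbitrary: C)
    case 0
    then show ?case using Q_measurable by (simp add: cell_def)
  next
    case (Suc n)
    note [measurable] = Suc.prems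
    have [measurable]: "(\<lambda>z. q (fst z) (snd z) ((C \<inter> b n) \<inter> cell n (fst z))) \<in> borel_measurable ?N"
      "(\<lambda>z. q (fst z) (snd z) ((C - b n) \<inter> cell n (fst z))) \<in> borel_measurable ?N"
      using Suc.IH[of "C \<inter> b n"] Suc.IH[of "C - b n"] by (auto simp: case_prod_unfold)
    have "(\<lambda>z. if fst z \<in> b n then q (fst z) (snd z) ((C \<inter> b n) \<inter> cell n (fst z))
        else q (fst z) (snd z) ((C - b n) \<inter> cell n (fst z))) \<in> borel_measurable ?N"
      by measurable
    also have "(\<lambda>z. if fst z \<in> b n then q (fst z) (snd z) ((C \<inter> b n) \<inter> cell n (fst z))
        else q (fst z) (snd z) ((C - b n) \<inter> cell n (fst z))) = (\<lambda>(x, t). q x t (C \<inter> cell (Suc n) x))"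
      by (auto simp: fun_eq_iff cell_Suc Int_assoc Diff_eq Int_commute Int_left_commute)
    finally show ?case .
  qed
  \<comment> \<open>Complements of the cells increase to the complement of \<open>{x}\<close>, so
    continuity from below of \<open>q_plus\<close> suffices. Each difference is the
    \<open>q_plus\<close> mass of \<open>B - cell n x\<close>, hence nonnegative.\<close>
  have "(\<lambda>z. SUP n. ennreal (q (fst z) (snd z) B - q (fst z) (snd z) (B \<inter> cell n (fst z)))) \<in> borel_measurable ?N"
    using meas[OF B] Q_measurable[OF B] by (auto simp: case_prod_unfold)
  then show ?thesis
  proof (rule measurable_cong[THEN iffD1, rotated])
    fix z assume "z \<in> space ?N"
    then obtain x t where z: "z = (x, t)" and x: "x \<in> space M" and t: "t \<in> T"
      by (auto simp: space_pair_measure space_restrict_space)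
    have diff: "q x t B - q x t (B \<inter> cell n x) = q x t (B - cell n x - {x})" for n
    proof -
      have "x \<in> cell n x" by (auto simp: cell_def)
      then have eq: "B - cell n x - {x} = B - B \<inter> cell n x" by auto
      have "q x t ((B \<inter> cell n x) \<union> (B - B \<inter> cell n x)) = q x t (B \<inter> cell n x) + q x t (B - B \<inter> cell n x)"
        by (rule finite_signed_measure_Un[OF Q_signed[OF x t]]) (use cell_sets[OF B] B in auto)
      moreover have "(B \<inter> cell n x) \<union> (B - B \<inter> cell n x) = B" by auto
      ultimately show ?thesis by (simp add: eq)
    qed
    have cB: "B - cell n x \<in> sets M" for n
    proof -
      have "B - cell n x = B - B \<inter> cell n x" by auto
      then show ?thesis using B cell_sets[OF B] by auto
    qed
    have "(SUP n. ennreal (q x t B - q x t (B \<inter> cell n x))) = (SUP n. emeasure (q_plus M q x t) (B - cell n x))"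
      using cB by (simp add: diff emeasure_q_plus[OF x t])
    also have "\<dots> = emeasure (q_plus M q x t) (\<Union>n. B - cell n x)"
      by (rule SUP_emeasure_incseq) (use cB in \<open>auto simp: incseq_Suc_iff cell_Suc\<close>)
    also have "(\<Union>n. B - cell n x) = B - {x}"
    proof -
      have "\<exists>n. y \<notin> cell n x" if y: "y \<in> B" "y \<noteq> x" for y
      proof -
        obtain i where "x \<in> b i" "y \<notin> b i"
          using b[of x y] y x sets.sets_into_space[OF B] by blast
        then have "y \<notin> cell (Suc i) x" by (auto simp: cell_def)
        then show ?thesis ..
      qed
      moreover have "x \<in> cell n x" for n by (auto simp: cell_def)
      ultimately show ?thesis by auto
    qed
    also have "emeasure (q_plus M q x t) (B - {x}) = emeasure (q_plus M q x t) B"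
      using singleton_sets[OF x] B by (simp add: emeasure_q_plus[OF x t])
    finally show "(SUP n. ennreal (q (fst z) (snd z) B - q (fst z) (snd z) (B \<inter> cell n (fst z)))) =
        (case z of (x, t) \<Rightarrow> emeasure (q_plus M q x t) B)"
      by (simp add: z)
  qed
qed

sublocale rate_kernel M kern T
proof
  fix x s
  show "sets (kern x s) = sets M" by (simp add: kern_def)
next
  fix x s assume x: "x \<in> space M"
  then show "emeasure (kern x s) (space M) < \<infinity>"
    using emeasure_q_plus_space[OF x] by (simp add: kern_def)
next
  fix B assume B: "B \<in> sets M"
  have T0: "T0 \<in> T" using T0_less_T1 by (simp add: time_set_def)
  \<comment> \<open>Times outside \<open>T\<close> are sent to \<open>T0\<close>, which makes the
    map land in the restricted space; the value obtained there is discarded by the outer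
    \<open>if\<close>.\<close>
  have "(\<lambda>(x, s). (x, if s \<in> T then s else T0)) \<in> M \<Otimes>\<^sub>M borel \<rightarrow>\<^sub>M M \<Otimes>\<^sub>M restrict_space borel T"
    unfolding case_prod_unfold
    by (intro measurable_Pair measurable_restrict_space2) (use T0 in auto)
  from measurable_compose[OF this measurable_q_plus[OF B]]
  have [measurable]: "(\<lambda>z. emeasure (q_plus M q (fst z) (if snd z \<in> T then snd z else T0)) B) \<in> borel_measurable (M \<Otimes>\<^sub>M borel)"
    by (simp add: case_prod_unfold)
  have "(\<lambda>z. if snd z \<in> T then emeasure (q_plus M q (fst z) (if snd z \<in> T then snd z else T0)) B else 0) \<in> borel_measurable (M \<Otimes>\<^sub>M borel)"
    by measurable
  also have "(\<lambda>z. if snd z \<in> T then emeasure (q_plus M q (fst z) (if snd z \<in> T then snd z else T0)) B else 0)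
      = (\<lambda>(x, s). emeasure (kern x s) B)"
    by (auto simp: fun_eq_iff kern_def)
  finally show "(\<lambda>(x, s). emeasure (kern x s) B) \<in> borel_measurable (M \<Otimes>\<^sub>M borel)" .
next
  fix u t assume "u \<in> T" "t \<in> T"
  then show "{u..t} \<subseteq> T" by (rule T_interval)
next
  fix x u t assume x: "x \<in> space M" and ut: "u \<in> T" "t \<in> T"
  show "(\<integral>\<^sup>+ s\<in>{u..t}. emeasure (kern x s) (space M) \<partial>lborel) < \<infinity>"
  proof (cases "u < t")
    case True
    have "(\<integral>\<^sup>+ s\<in>{u..t}. emeasure (kern x s) (space M) \<partial>lborel) \<le> (\<integral>\<^sup>+ s\<in>{T0..t}. ennreal (q_rate q x s) \<partial>lborel)"
      using ut T_interval[OF ut]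
      by (intro nn_integral_mono)
         (auto split: split_indicator simp: kern_def emeasure_q_plus_space[OF x] time_set_def)
    also have "\<dots> < \<infinity>"
      using ut True by (intro locally_integrable[OF x]) (auto simp: time_set_def)
    finally show ?thesis .
  next
    case False
    have "(\<integral>\<^sup>+ s\<in>{u..t}. emeasure (kern x s) (space M) \<partial>lborel) = 0"
      by (rule nn_integral_null_set) (use False in \<open>cases "u = t"; simp add: finite_imp_null_set_lborel\<close>)
    then show ?thesis by simp
  qed
qed

lemma kern_eq: "s \<in> T \<Longrightarrow> kern x s = q_plus M q x s"
  unfolding kern_def by (rule if_P)

lemma rate_eq: "x \<in> space M \<Longrightarrow> s \<in> T \<Longrightarrow> rate x s = ennreal (q_rate q x s)"
  unfolding rate_def by (simp only: kern_eq emeasure_q_plus_space)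

text \<open>The bridge between the Bochner integral in \<open>survival\<close> and the nonnegative
  integral in \<open>cum\<close>: the rates are nonnegative on \<open>T\<close>, so both give the
  same real number.\<close>

lemma surv_eq:
  assumes x: "x \<in> space M" and ut: "u \<in> T" "t \<in> T"
  shows "surv x u t = ennreal (survival q x u t)"
proof -
  note [measurable] = x
  have T: "s \<in> T" if "s \<in> {u..t}" for s using that T_interval[OF ut] by auto
  have "(LBINT s:{u..t}. q_rate q x s) = (\<integral>s. enn2real (rate x s * indicator {u..t} s) \<partial>lborel)"
    unfolding set_lebesgue_integral_def
    by (intro Bochner_Integration.integral_cong)
       (auto split: split_indicator simp: rate_eq[OF x T] q_rate_nonneg[OF x T])
  also have "\<dots> = enn2real (\<integral>\<^sup>+s. ennreal (enn2real (rate x s * indicator {u..t} s)) \<partial>lborel)"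
    by (intro integral_eq_nn_integral) auto
  also have "(\<integral>\<^sup>+s. ennreal (enn2real (rate x s * indicator {u..t} s)) \<partial>lborel) = cum x u t"
    unfolding cum_def
    by (intro nn_integral_cong) (auto split: split_indicator simp: rate_eq[OF x T] q_rate_nonneg[OF x T])
  finally show ?thesis by (simp add: surv_def survival_def)
qed

section \<open>Identification of \<open>P_bar\<close> with the recursion, and its transition
  property\<close>

lemma P_bar_step_eq:
  assumes "x \<in> space M" "u \<in> T" "t \<in> T"
  shows "P_bar_step M q n u x t B = J n (indicator B) u x t"
  using assms
proof (induction n arbitrary: u x)
  case 0
  then show ?case by (simp add: surv_eq)
next
  case (Suc n)
  have "(\<integral>\<^sup>+ y. ennreal (survival q x u w) * P_bar_step M q n w y t B \<partial>q_plus M q x w) =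
      (\<integral>\<^sup>+ y. surv x u w * J n (indicator B) w y t \<partial>kern x w)" if "w \<in> {u<..<t}" for w
  proof -
    have w: "w \<in> T" using that Suc.prems T_interval[of u t] by auto
    show ?thesis
      unfolding kern_eq[OF w] surv_eq[OF Suc.prems(1,2) w]
      by (intro nn_integral_cong arg_cong2[where f="(*)"] refl)
         (simp add: Suc.IH w Suc.prems(3))
  qed
  then show ?case
    unfolding P_bar_step.simps J.simps
    by (intro nn_integral_cong) (simp split: split_indicator)
qed

lemma P_bar_eq:
  assumes "x \<in> space M" "u \<in> T" "t \<in> T"
  shows "P_bar M q u x t B = (\<Sum>n. J n (indicator B) u x t)"
  using assms by (simp add: P_bar_def P_bar_step_eq)

text \<open>The map from \<open>f\<close> to the sum of all \<open>J n f u x t\<close> is a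
  countably additive functional whose values at indicators are \<open>P_bar\<close>. Integration
  against \<open>P_bar\<close> is therefore this functional, which gives the integral in the
  Chapman-Kolmogorov equation its analytic form.\<close>

lemma
  assumes x: "x \<in> space M" and ut: "u \<in> T" "t \<in> T"
  shows measure_space_P_bar: "measure_space (space M) (sets M) (P_bar M q u x t)"
    and nn_integral_P_bar: "f \<in> borel_measurable M \<Longrightarrow>
      (\<integral>\<^sup>+ y. f y \<partial>measure_of (space M) (sets M) (P_bar M q u x t)) = (\<Sum>n. J n f u x t)"
proof -
  let ?I = "\<lambda>f. \<Sum>n. J n f u x t"
  have cong: "?I f = ?I g" if "\<And>y. y \<in> space M \<Longrightarrow> f y = g y" for f g
    by (intro suminf_cong J_cong that x)
  have cmult: "?I (\<lambda>y. c * f y) = c * ?I f" if "f \<in> borel_measurable M" for f c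
    by (simp add: J_cmult[OF that x])
  have suminf: "?I (\<lambda>y. \<Sum>i. f i y) = (\<Sum>i. ?I (f i))" if "\<And>i::nat. f i \<in> borel_measurable M" for f
    by (subst suminf_swap_ennreal) (simp add: J_suminf[OF that x])
  have P: "P_bar M q u x t = (\<lambda>B. ?I (indicator B))"
    using P_bar_eq[OF x ut] by auto
  show "measure_space (space M) (sets M) (P_bar M q u x t)"
    unfolding P by (rule measure_space_functional[OF cong cmult suminf])
  show "(\<integral>\<^sup>+ y. f y \<partial>measure_of (space M) (sets M) (P_bar M q u x t)) = ?I f" if "f \<in> borel_measurable M"
    unfolding P by (rule nn_integral_functional[OF cong cmult suminf that])
qed

lemma transition_function_P_bar: "transition_function M T0 T1 (P_bar M q)"
  unfolding transition_function_def
proof (intro conjI ballI impI)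
  fix u t x assume "u \<in> T" "t \<in> T" "u < t" "x \<in> space M"
  then show "measure_space (space M) (sets M) (P_bar M q u x t)" by (intro measure_space_P_bar)
next
  fix u t x B assume *: "u \<in> T" "t \<in> T" "u < t" "x \<in> space M" "B \<in> sets M"
  then show "P_bar M q u x t B \<le> 1"
    unfolding P_bar_eq[OF *(4,1,2)] by (intro suminf_J_le_1) (auto split: split_indicator)
next
  fix B assume [measurable]: "B \<in> sets M"
  let ?S = "{(u, x, t). u \<in> T \<and> t \<in> T \<and> u < t \<and> x \<in> space M}"
  have "(\<lambda>(u, x, t). \<Sum>n. J n (indicator B) u x t) \<in> borel_measurable (borel \<Otimes>\<^sub>M M \<Otimes>\<^sub>M borel)"
    unfolding case_prod_unfold by measurable
  then have "(\<lambda>(u, x, t). \<Sum>n. J n (indicator B) u x t) \<in> borel_measurable (restrict_space (borel \<Otimes>\<^sub>M M \<Otimes>\<^sub>M borel) ?S)"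
    by (rule measurable_restrict_space1)
  then show "(\<lambda>(u, x, t). P_bar M q u x t B) \<in> borel_measurable (restrict_space (borel \<Otimes>\<^sub>M M \<Otimes>\<^sub>M borel) ?S)"
    by (rule measurable_cong[THEN iffD1, rotated]) (auto simp: space_restrict_space P_bar_eq)
next
  fix u s t x B assume *: "u \<in> T" "s \<in> T" "t \<in> T" "u < s" "s < t" "x \<in> space M" "B \<in> sets M"
  note [measurable] = *(7)
  have m: "(\<lambda>y. \<Sum>n. J n (indicator B) s y t) \<in> borel_measurable M" by measurable
  have "P_bar M q u x t B = (\<Sum>i. J i (\<lambda>y. \<Sum>n. J n (indicator B) s y t) u x s)"
    using * by (simp add: P_bar_eq suminf_J_Chapman_Kolmogorov[of "indicator B" x u t s])
  also have "\<dots> = (\<integral>\<^sup>+ y. (\<Sum>n. J n (indicator B) s y t) \<partial>measure_of (space M) (sets M) (P_bar M q u x s))"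
    using * by (intro nn_integral_P_bar[symmetric] m) auto
  also have "\<dots> = (\<integral>\<^sup>+ y. P_bar M q s y t B \<partial>measure_of (space M) (sets M) (P_bar M q u x s))"
    using * by (intro nn_integral_cong) (simp add: P_bar_eq)
  finally show "P_bar M q u x t B = \<dots>" .
qed

end


section \<open>Paths\<close>

text \<open>Keeps \<open>jump_time T0 (Suc n)\<close> from unfolding to a component of the sequence,
  so that facts on jump times apply to all indices alike.\<close>

declare jump_time.simps(2) [simp del]

lemma space_extended_space: "space (extended_space M) = insert None (Some ` space M)"
  unfolding extended_space_def
  by (rule space_measure_of) (use sets.sets_into_space in auto)

lemma sets_extended_space:
  "sets (extended_space M) = sigma_sets (insert None (Some ` space M)) (insert {None} ((\<lambda>B. Some ` B) ` sets M))"
  unfolding extended_space_def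
  by (rule sets_measure_of) (use sets.sets_into_space in auto)

lemma Some_sets_extended_space: "B \<in> sets M \<Longrightarrow> Some ` B \<in> sets (extended_space M)"
  unfolding sets_extended_space by (auto intro: sigma_sets.Basic)

lemma None_sets_extended_space: "{None} \<in> sets (extended_space M)"
  unfolding sets_extended_space by (auto intro: sigma_sets.Basic)

lemma measurable_extended_spaceI:
  assumes "\<And>z. z \<in> space N \<Longrightarrow> f z \<in> insert None (Some ` space M)"
    and "\<And>B. B \<in> sets M \<Longrightarrow> {z \<in> space N. f z \<in> Some ` B} \<in> sets N"
  shows "f \<in> N \<rightarrow>\<^sub>M extended_space M"
  unfolding extended_space_def
proof (rule measurable_measure_of)
  show "insert {None} ((`) Some ` sets M) \<subseteq> Pow (insert None (Some ` space M))"
    using sets.sets_into_space by auto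
  show "f \<in> space N \<rightarrow> insert None (Some ` space M)" using assms(1) by auto
  fix y assume "y \<in> insert {None} ((`) Some ` sets M)"
  then consider "y = {None}" | B where "B \<in> sets M" "y = Some ` B" by auto
  then show "f -` y \<inter> space N \<in> sets N"
  proof cases
    case 1
    then have "f -` y \<inter> space N = space N - {z \<in> space N. f z \<in> Some ` space M}"
      using assms(1) by auto
    then show ?thesis using assms(2)[of "space M"] by auto
  next
    case 2
    have "f -` y \<inter> space N = {z \<in> space N. f z \<in> Some ` B}" using 2 by auto
    then show ?thesis using assms(2)[of B] 2 by simp
  qed
qed

lemma measurable_case_extended_space:
  fixes f :: "'a \<Rightarrow> 'b::topological_space"
  assumes [measurable]: "f \<in> borel_measurable M"
  shows "(\<lambda>z. case z of None \<Rightarrow> c | Some x \<Rightarrow> f x) \<in> borel_measurable (extended_space M)"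
proof (rule measurableI)
  fix S :: "'b set" assume [measurable]: "S \<in> sets borel"
  let ?g = "\<lambda>z. case z of None \<Rightarrow> c | Some x \<Rightarrow> f x"
  have "?g -` S \<inter> space (extended_space M) = Some ` (f -` S \<inter> space M) \<union> (if c \<in> S then {None} else {})"
    by (auto simp: space_extended_space split: option.splits)
  also have "\<dots> \<in> sets (extended_space M)"
    by (intro sets.Un Some_sets_extended_space) (auto simp: None_sets_extended_space)
  finally show "?g -` S \<inter> space (extended_space M) \<in> sets (extended_space M)" .
qed simp

section \<open>Elementary facts on a single path\<close>

context
  fixes M :: "'a measure" and T0 :: real and T1 :: ereal and \<omega> :: "'a jump_seq"
  assumes \<omega>: "\<omega> \<in> Omega M T0 T1" and T01: "ereal T0 < T1"
begin

lemma jump_time_bounds: "ereal T0 \<le> jump_time T0 n \<omega>" "jump_time T0 n \<omega> \<le> T1"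
  using \<omega> T01 by (cases n; auto simp: Omega_def intro: less_imp_le)+

lemma jump_time_gt_T0: "ereal T0 < jump_time T0 (Suc n) \<omega>"
  using \<omega> by (auto simp: Omega_def)

lemma jump_before_T1:
  assumes "jump_time T0 n \<omega> < T1"
  shows "jump_time T0 n \<omega> < jump_time T0 (Suc n) \<omega>" "jump_state n \<omega> \<in> Some ` space M"
  using \<omega> assms by (cases n; auto simp: Omega_def)+

lemma jump_at_T1:
  assumes "jump_time T0 n \<omega> = T1"
  shows "jump_time T0 (Suc n) \<omega> = T1" "jump_state n \<omega> = None"
  using \<omega> assms T01 by (cases n; auto simp: Omega_def)+

lemma incseq_jump_time: "incseq (\<lambda>n. jump_time T0 n \<omega>)"
proof (rule incseq_SucI)
  fix n
  show "jump_time T0 n \<omega> \<le> jump_time T0 (Suc n) \<omega>"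
    using jump_before_T1(1)[of n] jump_at_T1(1)[of n] jump_time_bounds(2)[of n]
    by (cases "jump_time T0 n \<omega> < T1") (auto simp: less_imp_le)
qed

lemma jump_time_mono: "i \<le> n \<Longrightarrow> jump_time T0 i \<omega> \<le> jump_time T0 n \<omega>"
  using incseq_jump_time by (auto simp: incseq_def)

lemma jump_interval_unique:
  assumes "jump_time T0 i \<omega> < s" "s \<le> jump_time T0 (Suc i) \<omega>"
    and "jump_time T0 n \<omega> < s" "s \<le> jump_time T0 (Suc n) \<omega>"
  shows "i = n"
proof (rule ccontr)
  assume "i \<noteq> n"
  then consider "Suc i \<le> n" | "Suc n \<le> i" by linarith
  then show False
    using jump_time_mono[of "Suc i" n] jump_time_mono[of "Suc n" i] assms by cases auto
qed

text \<open>Right-open intervals are those of the process; the left-open ones of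
  \<open>jump_interval_unique\<close> are those of the compensator.\<close>

lemma jump_interval_unique':
  assumes "jump_time T0 i \<omega> \<le> s" "s < jump_time T0 (Suc i) \<omega>"
    and "jump_time T0 n \<omega> \<le> s" "s < jump_time T0 (Suc n) \<omega>"
  shows "i = n"
proof (rule ccontr)
  assume "i \<noteq> n"
  then consider "Suc i \<le> n" | "Suc n \<le> i" by linarith
  then show False
    using jump_time_mono[of "Suc i" n] jump_time_mono[of "Suc n" i] assms by cases auto
qed

text \<open>Jump times increase strictly below \<open>T1\<close>, so \<open>]t_j, t_(j+1)]\<close>
  contains no later one. At \<open>T1\<close> all further times coincide, whence the last
  assumption.\<close>

lemma jump_time_in_interval:
  assumes "jump_time T0 j \<omega> < jump_time T0 n \<omega>" "jump_time T0 n \<omega> \<le> jump_time T0 (Suc j) \<omega>"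
    and "jump_time T0 n \<omega> < T1"
  shows "n = Suc j"
proof -
  have "n > j" using assms(1) jump_time_mono[of n j] by (cases "n \<le> j") auto
  moreover have "\<not> n > Suc j"
  proof
    assume "n > Suc j"
    then have "jump_time T0 (Suc (Suc j)) \<omega> \<le> jump_time T0 n \<omega>" by (intro jump_time_mono) auto
    moreover have "jump_time T0 (Suc j) \<omega> < T1"
      using \<open>n > Suc j\<close> assms(3) jump_time_mono[of "Suc j" n] by auto
    ultimately show False using jump_before_T1(1)[of "Suc j"] assms(2) by auto
  qed
  ultimately show ?thesis by linarith
qed

lemma explosion_time_eq: "explosion_time T0 \<omega> = (SUP n. jump_time T0 n \<omega>)"
  unfolding explosion_time_def by (intro limI LIMSEQ_SUP incseq_jump_time)

lemma explosion_time_le_iff: "explosion_time T0 \<omega> \<le> s \<longleftrightarrow> (\<forall>n. jump_time T0 n \<omega> \<le> s)"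
  by (simp add: explosion_time_eq SUP_le_iff)

lemma jump_process_eq_state:
  assumes "jump_time T0 n \<omega> \<le> ereal s" "ereal s < jump_time T0 (Suc n) \<omega>"
  shows "jump_process T0 s \<omega> = jump_state n \<omega>"
proof -
  have "(THE n. jump_time T0 n \<omega> \<le> ereal s \<and> ereal s < jump_time T0 (Suc n) \<omega>) = n"
    using assms by (intro the_equality conjI) (auto intro: jump_interval_unique')
  moreover have "\<not> explosion_time T0 \<omega> \<le> ereal s"
    using assms(2) by (auto simp: explosion_time_le_iff not_le)
  ultimately show ?thesis by (simp add: jump_process_def)
qed

lemma jump_process_eq_None:
  assumes "\<And>n. jump_time T0 n \<omega> \<le> ereal s"
  shows "jump_process T0 s \<omega> = None"
  using assms by (simp add: jump_process_def explosion_time_le_iff)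

lemma jump_time_cases:
  assumes "T0 \<le> s"
  obtains n where "jump_time T0 n \<omega> \<le> ereal s" "ereal s < jump_time T0 (Suc n) \<omega>"
  | "\<And>n. jump_time T0 n \<omega> \<le> ereal s"
proof (cases "\<exists>n. ereal s < jump_time T0 n \<omega>")
  case True
  define n where "n = (LEAST n. ereal s < jump_time T0 n \<omega>)"
  have n: "ereal s < jump_time T0 n \<omega>" unfolding n_def using True by (rule LeastI_ex)
  then obtain m where m: "n = Suc m" using assms by (cases n) auto
  then have "\<not> ereal s < jump_time T0 m \<omega>"
    unfolding n_def by (metis lessI not_less_Least)
  then show thesis using that(1)[of m] n m by auto
next
  case False
  then show thesis using that(2) by (auto simp: not_less)
qed

end

text \<open>The pieces are the intervals between consecutive jump times and the rest after
  explosion. Each contains its left end and, near any of its points, an interval to the right;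
  discontinuities can thus only sit at left ends, that is, at jump times or at the explosion
  time.\<close>

lemma jump_path_jump_process:
  assumes \<omega>: "\<omega> \<in> Omega M T0 T1" and T01: "ereal T0 < T1"
  shows "jump_path T0 T1 (\<lambda>t. jump_process T0 t \<omega>)"
proof -
  note facts = jump_process_eq_state[OF \<omega> T01] jump_process_eq_None[OF \<omega> T01]
  define K where "K n = {t \<in> time_set T0 T1. jump_time T0 n \<omega> \<le> ereal t \<and> ereal t < jump_time T0 (Suc n) \<omega>}" for n
  define L where "L = {t \<in> time_set T0 T1. \<forall>n. jump_time T0 n \<omega> \<le> ereal t}"
  have interval: "is_interval (K n)" "is_interval L" for n
    unfolding is_interval_1 K_def L_def time_set_def
    by (auto intro: le_less_trans[of "ereal _" "ereal _"] order_trans[of _ "ereal _" "ereal _"])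
  have const: "(\<lambda>t. jump_process T0 t \<omega>) constant_on K n" "(\<lambda>t. jump_process T0 t \<omega>) constant_on L" for n
    unfolding constant_on_def K_def L_def using facts by auto
  have disj: "K i \<inter> K n = {}" if "i \<noteq> n" for i n
    using jump_interval_unique'[OF \<omega> T01] that by (auto simp: K_def)
  have disjL: "K i \<inter> L = {}" for i
    by (auto simp: K_def L_def not_le[symmetric])
  have cover: "\<Union> (insert L (range K)) = time_set T0 T1"
  proof (intro equalityI subsetI)
    fix t assume t: "t \<in> time_set T0 T1"
    then have "T0 \<le> t" by (simp add: time_set_def)
    consider (jump) n where "jump_time T0 n \<omega> \<le> ereal t" "ereal t < jump_time T0 (Suc n) \<omega>"
      | (exploded) "\<forall>n. jump_time T0 n \<omega> \<le> ereal t"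
      using jump_time_cases[OF \<omega> T01 \<open>T0 \<le> t\<close>] by metis
    then show "t \<in> \<Union> (insert L (range K))"
      by cases (use t in \<open>auto simp: K_def L_def\<close>)
  qed (auto simp: K_def L_def)
  have right: "eventually (\<lambda>s. jump_process T0 s \<omega> = jump_process T0 t \<omega>) (at_right t)"
    if t: "t \<in> time_set T0 T1" for t
  proof -
    have "T0 \<le> t" using t by (simp add: time_set_def)
    consider (jump) n where "jump_time T0 n \<omega> \<le> ereal t" "ereal t < jump_time T0 (Suc n) \<omega>"
      | (exploded) "\<forall>n. jump_time T0 n \<omega> \<le> ereal t"
      using jump_time_cases[OF \<omega> T01 \<open>T0 \<le> t\<close>] by metis
    then show ?thesis
    proof cases
      case (jump n)
      obtain c where c: "ereal t < ereal c" "ereal c < jump_time T0 (Suc n) \<omega>"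
        using ereal_dense2[OF jump(2)] by auto
      show ?thesis
      proof (rule eventually_at_rightI[of t c])
        fix s assume s: "s \<in> {t<..<c}"
        then have "jump_time T0 n \<omega> \<le> ereal s" "ereal s < jump_time T0 (Suc n) \<omega>"
          using jump c order_trans[OF jump(1), of "ereal s"] less_trans[of "ereal s" "ereal c"] by auto
        then show "jump_process T0 s \<omega> = jump_process T0 t \<omega>" using facts(1) jump by metis
      qed (use c in auto)
    next
      case exploded
      show ?thesis
      proof (rule eventually_at_rightI[of t "t + 1"])
        fix s assume s: "s \<in> {t<..<t + 1}"
        then have "jump_time T0 n \<omega> \<le> ereal s" for n
          using order_trans[OF exploded[rule_format], of "ereal s" n] by auto
        then show "jump_process T0 s \<omega> = jump_process T0 t \<omega>" using facts(2) exploded by metis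
      qed auto
    qed
  qed
  have lim: "limitin (discrete_topology UNIV) (\<lambda>t. jump_process T0 t \<omega>) (jump_process T0 t \<omega>) F \<longleftrightarrow>
      eventually (\<lambda>s. jump_process T0 s \<omega> = jump_process T0 t \<omega>) F" for t F
    unfolding limitin_def by (auto elim: eventually_mono dest: spec[of _ "{jump_process T0 t \<omega>}"])
  let ?disc = "{t \<in> time_set T0 T1. \<not> limitin (discrete_topology UNIV) (\<lambda>t. jump_process T0 t \<omega>)
      (jump_process T0 t \<omega>) (at t within time_set T0 T1)}"
  \<comment> \<open>\<open>real_of_ereal\<close> sends infinite times to 0; this only enlarges the
    countable set on the right.\<close>
  have "?disc \<subseteq> insert (real_of_ereal (explosion_time T0 \<omega>)) (range (\<lambda>n. real_of_ereal (jump_time T0 n \<omega>)))"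
  proof
    fix t assume "t \<in> ?disc"
    then have t: "t \<in> time_set T0 T1"
      and nl: "\<not> eventually (\<lambda>s. jump_process T0 s \<omega> = jump_process T0 t \<omega>) (at t within time_set T0 T1)"
      by (auto simp: lim)
    have left: "eventually (\<lambda>s. jump_process T0 s \<omega> = jump_process T0 t \<omega>) (at t within time_set T0 T1)"
      if "eventually (\<lambda>s. jump_process T0 s \<omega> = jump_process T0 t \<omega>) (at_left t)"
    proof -
      have "eventually (\<lambda>s. jump_process T0 s \<omega> = jump_process T0 t \<omega>) (at t)"
        unfolding eventually_at_split using that right[OF t] by auto
      then show ?thesis by (rule filter_leD[OF at_le, rotated]) auto
    qed
    have "T0 \<le> t" using t by (simp add: time_set_def)
    consider (jump) n where "jump_time T0 n \<omega> \<le> ereal t" "ereal t < jump_time T0 (Suc n) \<omega>"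
      | (exploded) "\<forall>n. jump_time T0 n \<omega> \<le> ereal t"
      using jump_time_cases[OF \<omega> T01 \<open>T0 \<le> t\<close>] by metis
    then show "t \<in> insert (real_of_ereal (explosion_time T0 \<omega>)) (range (\<lambda>n. real_of_ereal (jump_time T0 n \<omega>)))"
    proof cases
      case (jump n)
      have "jump_time T0 n \<omega> = ereal t"
      proof (rule ccontr)
        assume "jump_time T0 n \<omega> \<noteq> ereal t"
        then have "jump_time T0 n \<omega> < ereal t" using jump by auto
        then obtain c where c: "jump_time T0 n \<omega> < ereal c" "ereal c < ereal t"
          using ereal_dense2 by blast
        have "eventually (\<lambda>s. jump_process T0 s \<omega> = jump_process T0 t \<omega>) (at_left t)"
        proof (rule eventually_at_leftI[of c])
          fix s assume s: "s \<in> {c<..<t}"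
          then have "jump_time T0 n \<omega> \<le> ereal s" "ereal s < jump_time T0 (Suc n) \<omega>"
            using jump c less_trans[OF c(1), of "ereal s"] less_trans[of "ereal s" "ereal t"] by auto
          then show "jump_process T0 s \<omega> = jump_process T0 t \<omega>" using facts(1) jump by metis
        qed (use c in auto)
        then show False using left nl by auto
      qed
      then have "t = real_of_ereal (jump_time T0 n \<omega>)" by simp
      then show ?thesis by blast
    next
      case exploded
      have "explosion_time T0 \<omega> = ereal t"
      proof (rule ccontr)
        assume "explosion_time T0 \<omega> \<noteq> ereal t"
        then have "explosion_time T0 \<omega> < ereal t"
          using exploded explosion_time_le_iff[OF \<omega> T01, of "ereal t"] by auto
        then obtain c where c: "explosion_time T0 \<omega> < ereal c" "ereal c < ereal t"
          using ereal_dense2 by blast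
        have "eventually (\<lambda>s. jump_process T0 s \<omega> = jump_process T0 t \<omega>) (at_left t)"
        proof (rule eventually_at_leftI[of c])
          fix s assume s: "s \<in> {c<..<t}"
          then have "explosion_time T0 \<omega> \<le> ereal s" using less_trans[OF c(1), of "ereal s"] by auto
          then have "jump_time T0 n \<omega> \<le> ereal s" for n
            using explosion_time_le_iff[OF \<omega> T01, of "ereal s"] by auto
          then show "jump_process T0 s \<omega> = jump_process T0 t \<omega>" using facts(2) exploded by metis
        qed (use c in auto)
        then show False using left nl by auto
      qed
      then have "t = real_of_ereal (explosion_time T0 \<omega>)" by simp
      then show ?thesis by blast
    qed
  qed
  then have disc: "countable ?disc" by (rule countable_subset) auto
  show ?thesis
    unfolding jump_path_def
  proof (intro conjI exI[of _ "insert L (range K)"] ballI)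
    show "disjoint (insert L (range K))"
    proof -
      have "K a \<inter> K b = {}" if "K a \<noteq> K b" for a b
        using disj[of a b] that by (cases "a = b") auto
      then show ?thesis using disjL unfolding disjoint_def by (auto simp: Int_commute)
    qed
    show "\<Union> (insert L (range K)) = time_set T0 T1" by (rule cover)
    show "countable ?disc" by (rule disc)
  qed (use interval const right lim in auto)
qed


section \<open>Histories and predictable sets\<close>

locale jump_law = jump_rates M T0 T1 q
  for M :: "'a measure" and T0 :: real and T1 :: ereal
    and q :: "'a \<Rightarrow> real \<Rightarrow> 'a set \<Rightarrow> real" +
  fixes Pr :: "'a jump_seq measure"
  assumes prob_space_Pr: "prob_space Pr"
    and space_Pr: "space Pr = Omega M T0 T1"
    and sets_Pr: "sets Pr = sets (sequence_space M T0 T1)"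
    and compensates: "compensates M T0 T1 Pr (predicted_measure M T0 T1 q) (jump_measure M T0 T1)"
begin

sublocale Pr: prob_space Pr by (rule prob_space_Pr)

abbreviation "\<Omega> \<equiv> Omega M T0 T1"
abbreviation "jt \<equiv> jump_time T0"
abbreviation "F \<equiv> history M T0 T1"
abbreviation "Pred \<equiv> predictable_space M T0 T1"

text \<open>The value \<open>x0\<close> makes \<open>X n\<close> a total \<open>M\<close>-valued random variable; it is taken only where
  \<open>t\<^sub>n = T1\<close>.\<close>

definition x0 :: 'a where "x0 = (SOME x. x \<in> space M)"

definition X :: "nat \<Rightarrow> 'a jump_seq \<Rightarrow> 'a" where
  "X n \<omega> = (if jt n \<omega> < T1 then the (jump_state n \<omega>) else x0)"

definition \<tau> :: "nat \<Rightarrow> 'a jump_seq \<Rightarrow> real" where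
  "\<tau> n \<omega> = real_of_ereal (jt n \<omega>)"

lemma Omega_nonempty: "\<Omega> \<noteq> {}"
  using Pr.not_empty by (simp add: space_Pr)

lemma x0: "x0 \<in> space M"
proof -
  obtain \<omega> where "\<omega> \<in> \<Omega>" using Omega_nonempty by auto
  then have "space M \<noteq> {}" by (auto simp: Omega_def)
  then show ?thesis unfolding x0_def by (simp add: some_in_eq)
qed

lemma X_space: "\<omega> \<in> \<Omega> \<Longrightarrow> X n \<omega> \<in> space M"
  using jump_before_T1(2)[OF _ T0_less_T1] x0 by (force simp: X_def)

lemma jump_state_eq_X: "\<omega> \<in> \<Omega> \<Longrightarrow> jt n \<omega> < T1 \<Longrightarrow> jump_state n \<omega> = Some (X n \<omega>)"
  using jump_before_T1(2)[OF _ T0_less_T1] by (force simp: X_def)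

lemma jt_less_T1: "s \<in> T \<Longrightarrow> jt n \<omega> \<le> ereal s \<Longrightarrow> jt n \<omega> < T1"
  by (auto simp: time_set_def intro: le_less_trans)

lemma jt_eq_\<tau>:
  assumes \<omega>: "\<omega> \<in> \<Omega>" and "jt n \<omega> < T1"
  shows "jt n \<omega> = ereal (\<tau> n \<omega>)" "\<tau> n \<omega> \<in> T"
proof -
  have "\<bar>jt n \<omega>\<bar> \<noteq> \<infinity>"
    using jump_time_bounds(1)[OF \<omega> T0_less_T1, of n] assms(2) by auto
  then show eq: "jt n \<omega> = ereal (\<tau> n \<omega>)" by (simp add: \<tau>_def ereal_real)
  show "\<tau> n \<omega> \<in> T"
    using jump_time_bounds(1)[OF \<omega> T0_less_T1, of n] assms(2) by (simp add: time_set_def eq)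
qed

lemma space_history [simp]: "space (F u) = \<Omega>"
  unfolding history_def by (rule space_measure_of) auto

lemma sets_history: "sets (F u) = sigma_sets \<Omega>
    ({{\<omega> \<in> \<Omega>. jump_state 0 \<omega> \<in> Some ` B} | B. B \<in> sets M} \<union>
     {{\<omega> \<in> \<Omega>. jump_state n \<omega> \<in> Some ` B \<and> jt n \<omega> \<le> ereal s} | n s B.
        1 \<le> n \<and> T0 \<le> s \<and> s \<le> u \<and> B \<in> sets M})"
  unfolding history_def by (rule sets_measure_of) auto

text \<open>Index 0 is included: its generator carries no time condition, but
  \<open>t_0 = T0\<close> satisfies that condition anyway.\<close>

lemma history_mark:
  assumes "T0 \<le> s" "s \<le> u" "B \<in> sets M"
  shows "{\<omega> \<in> \<Omega>. jump_state n \<omega> \<in> Some ` B \<and> jt n \<omega> \<le> ereal s} \<in> sets (F u)"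
proof (cases n)
  case 0
  then have "{\<omega> \<in> \<Omega>. jump_state n \<omega> \<in> Some ` B \<and> jt n \<omega> \<le> ereal s} = {\<omega> \<in> \<Omega>. jump_state 0 \<omega> \<in> Some ` B}"
    using assms(1) by auto
  then show ?thesis
    unfolding sets_history using assms(3) by (auto intro!: sigma_sets.Basic)
next
  case (Suc m)
  then show ?thesis
    unfolding sets_history by (intro sigma_sets.Basic UnI2 CollectI exI[of _ n] exI[of _ s] exI[of _ B]) (use assms in auto)
qed

text \<open>The generators of the history involve marks. Before \<open>T1\<close> the mark is never
  \<open>None\<close>, so the event is recovered by letting the mark range over the whole
  space.\<close>

lemma history_time:
  assumes "s \<in> T" "s \<le> u"
  shows "{\<omega> \<in> \<Omega>. jt n \<omega> \<le> ereal s} \<in> sets (F u)"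
proof -
  have "{\<omega> \<in> \<Omega>. jt n \<omega> \<le> ereal s} = {\<omega> \<in> \<Omega>. jump_state n \<omega> \<in> Some ` space M \<and> jt n \<omega> \<le> ereal s}"
    using jump_state_eq_X[OF _ jt_less_T1[OF assms(1)]] X_space by auto
  then show ?thesis using history_mark[of s u "space M" n] assms by (simp add: time_set_def)
qed

lemma measurable_jump_state: "jump_state n \<in> Pr \<rightarrow>\<^sub>M extended_space M"
proof -
  have "(\<lambda>\<omega>. fst (\<omega> n)) \<in> sequence_space M T0 T1 \<rightarrow>\<^sub>M extended_space M"
    unfolding sequence_space_def by (intro measurable_restrict_space1) measurable
  then show ?thesis
    by (simp add: jump_state_def[abs_def] measurable_cong_sets[OF sets_Pr refl])
qed

lemma measurable_jump_time [measurable]: "jt n \<in> borel_measurable Pr"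
proof (cases n)
  case 0
  have eq: "jt 0 = (\<lambda>_. ereal T0)" by (simp add: fun_eq_iff)
  show ?thesis unfolding 0 eq by simp
next
  case (Suc m)
  have "(\<lambda>\<omega>. snd (\<omega> m)) \<in> borel_measurable (sequence_space M T0 T1)"
    unfolding sequence_space_def by (intro measurable_restrict_space1) measurable
  then show ?thesis
    by (simp add: Suc jump_time.simps(2)[abs_def] measurable_cong_sets[OF sets_Pr refl])
qed

lemma sets_history_subset: "sets (F u) \<subseteq> sets Pr"
proof -
  have state: "{\<omega> \<in> \<Omega>. jump_state n \<omega> \<in> Some ` B} \<in> sets Pr" if "B \<in> sets M" for n B
    using measurable_sets[OF measurable_jump_state[of n] Some_sets_extended_space[OF that]]
    by (simp add: vimage_def space_Pr Int_def conj_commute)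
  have time: "{\<omega> \<in> \<Omega>. jt n \<omega> \<le> ereal s} \<in> sets Pr" for n s
    unfolding space_Pr[symmetric] by measurable
  have "{\<omega> \<in> \<Omega>. jump_state n \<omega> \<in> Some ` B \<and> jt n \<omega> \<le> ereal s} \<in> sets Pr" if "B \<in> sets M" for n s B
  proof -
    have "{\<omega> \<in> \<Omega>. jump_state n \<omega> \<in> Some ` B \<and> jt n \<omega> \<le> ereal s} =
        {\<omega> \<in> \<Omega>. jump_state n \<omega> \<in> Some ` B} \<inter> {\<omega> \<in> \<Omega>. jt n \<omega> \<le> ereal s}" by auto
    then show ?thesis using state[OF that] time by auto
  qed
  then show ?thesis
    unfolding sets_history space_Pr[symmetric]
    by (intro sets.sigma_sets_subset) (auto simp: state space_Pr)
qed

lemma subalgebra_history: "subalgebra Pr (F u)"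
  using sets_history_subset by (simp add: subalgebra_def space_Pr)

lemma measurable_X [measurable]: "X n \<in> Pr \<rightarrow>\<^sub>M M"
proof (rule measurableI)
  fix \<omega> assume "\<omega> \<in> space Pr"
  then show "X n \<omega> \<in> space M" by (simp add: X_space space_Pr)
next
  fix B assume B: "B \<in> sets M"
  have state: "{\<omega> \<in> \<Omega>. jump_state n \<omega> \<in> Some ` B} \<in> sets Pr"
    using measurable_sets[OF measurable_jump_state[of n] Some_sets_extended_space[OF B]]
    by (simp add: vimage_def space_Pr Int_def conj_commute)
  have "{\<omega> \<in> \<Omega>. T1 \<le> jt n \<omega>} \<in> sets Pr"
    unfolding space_Pr[symmetric] by measurable
  moreover have "X n -` B \<inter> space Pr =
      {\<omega> \<in> \<Omega>. jump_state n \<omega> \<in> Some ` B} \<union> (if x0 \<in> B then {\<omega> \<in> \<Omega>. T1 \<le> jt n \<omega>} else {})"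
    (is "_ = ?R")
  proof (intro set_eqI)
    fix \<omega>
    show "\<omega> \<in> X n -` B \<inter> space Pr \<longleftrightarrow> \<omega> \<in> ?R"
    proof (cases "jt n \<omega> < T1")
      case True
      then show ?thesis using jump_state_eq_X[of \<omega> n] by (auto simp: space_Pr)
    next
      case False
      then have "\<omega> \<in> \<Omega> \<Longrightarrow> jump_state n \<omega> = None"
        using jump_at_T1(2)[of \<omega> M T0 T1 n] jump_time_bounds(2)[of \<omega> M T0 T1 n] T0_less_T1 by auto
      then show ?thesis using False by (auto simp: space_Pr X_def not_less)
    qed
  qed
  ultimately show "X n -` B \<inter> space Pr \<in> sets Pr"
    using state by auto
qed

lemma measurable_\<tau> [measurable]: "\<tau> n \<in> borel_measurable Pr"
  unfolding \<tau>_def[abs_def] by measurable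

section \<open>The predictable sigma-field\<close>

lemma predictable_generators:
  "{A \<times> {s<..r} \<times> B | A s r B.
      T0 \<le> s \<and> s < r \<and> ereal r < T1 \<and> A \<in> sets (F s) \<and> B \<in> sets M} \<union>
   {A \<times> {T0} \<times> B | A B. A \<in> sets (F T0) \<and> B \<in> sets M} \<subseteq> Pow (\<Omega> \<times> T \<times> space M)"
proof -
  have A: "A \<subseteq> \<Omega>" if "A \<in> sets (F s)" for A s
    using sets.sets_into_space[OF that] by simp
  have T: "{s<..r} \<subseteq> T" "{T0} \<subseteq> T" if "T0 \<le> s" "ereal r < T1" for s r
    using that T0_less_T1 by (auto simp: time_set_def intro: le_less_trans[of _ "ereal r"])
  show ?thesis
  proof (intro Un_least subsetI PowI; elim CollectE exE conjE; hypsubst)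
    fix z A s r B assume "z \<in> A \<times> {s<..r} \<times> B" "T0 \<le> s" "ereal r < T1" "A \<in> sets (F s)" "B \<in> sets M"
    then show "z \<in> \<Omega> \<times> T \<times> space M"
      using A[of A s] T(1)[of s r] sets.sets_into_space[of B M] by auto
  next
    fix z A B assume "z \<in> A \<times> {T0} \<times> B" "A \<in> sets (F T0)" "B \<in> sets M"
    then show "z \<in> \<Omega> \<times> T \<times> space M"
      using A[of A T0] T0_less_T1 sets.sets_into_space[of B M] by (auto simp: time_set_def)
  qed
qed

lemma space_Pred [simp]: "space Pred = \<Omega> \<times> T \<times> space M"
  unfolding predictable_space_def by (rule space_measure_of) (rule predictable_generators)

lemma sets_Pred: "sets Pred = sigma_sets (\<Omega> \<times> T \<times> space M)
  ({A \<times> {s<..r} \<times> B | A s r B.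
      T0 \<le> s \<and> s < r \<and> ereal r < T1 \<and> A \<in> sets (F s) \<and> B \<in> sets M} \<union>
   {A \<times> {T0} \<times> B | A B. A \<in> sets (F T0) \<and> B \<in> sets M})"
  unfolding predictable_space_def by (rule sets_measure_of) (rule predictable_generators)

lemma T_rational:
  assumes "r \<in> T"
  obtains c where "c \<in> \<rat>" "r < c" "ereal c < T1"
proof -
  obtain d where d: "ereal r < ereal d" "ereal d < T1"
    using assms ereal_dense2[of "ereal r" T1] by (auto simp: time_set_def)
  then obtain c where "c \<in> \<rat>" "r < c" "c < d" using Rats_dense_in_real[of r d] by auto
  then show thesis using that[of c] d less_trans[of "ereal c" "ereal d" T1] by auto
qed

text \<open>Generating rectangles are bounded in time with right end below \<open>T1\<close>, so
  rational right ends exhaust the rest of the time set.\<close>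

lemma Pred_sets_after:
  assumes s: "s \<in> T" and A: "A \<in> sets (F s)" and B: "B \<in> sets M"
  shows "A \<times> {r \<in> T. s < r} \<times> B \<in> sets Pred"
proof -
  let ?C = "{c \<in> \<rat>. s < c \<and> ereal c < T1}"
  have "A \<times> {r \<in> T. s < r} \<times> B = (\<Union>c\<in>?C. A \<times> {s<..c} \<times> B)"
  proof -
    have "{r \<in> T. s < r} = (\<Union>c\<in>?C. {s<..c})"
    proof (intro equalityI subsetI)
      fix r assume r: "r \<in> {r \<in> T. s < r}"
      then have "r \<in> T" by auto
      then obtain c where "c \<in> \<rat>" "r < c" "ereal c < T1" by (rule T_rational)
      then show "r \<in> (\<Union>c\<in>?C. {s<..c})" using r by force
    next
      fix r assume "r \<in> (\<Union>c\<in>?C. {s<..c})"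
      then obtain c where "ereal c < T1" "s < r" "r \<le> c" by auto
      then show "r \<in> {r \<in> T. s < r}"
        using s by (auto simp: time_set_def intro: le_less_trans[of _ "ereal c"])
    qed
    then show ?thesis by auto
  qed
  moreover have "A \<times> {s<..c} \<times> B \<in> sets Pred" if "c \<in> ?C" for c
    unfolding sets_Pred using that s A B by (intro sigma_sets.Basic UnI1) (auto simp: time_set_def)
  ultimately show ?thesis
    by (auto intro!: sets.countable_UN'' countable_subset[OF _ countable_rat])
qed

lemma measurable_Pred_time [measurable]: "(\<lambda>z. fst (snd z)) \<in> borel_measurable Pred"
proof (rule borel_measurable_iff_greater[THEN iffD2, rule_format])
  fix a
  have top: "\<Omega> \<in> sets (F s)" for s using sets.top[of "F s"] by simp
  consider "a < T0" | "a \<in> T" | "T1 \<le> ereal a" unfolding time_set_def by fastforce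
  then show "{z \<in> space Pred. a < fst (snd z)} \<in> sets Pred"
  proof cases
    case 1
    then have "{z \<in> space Pred. a < fst (snd z)} = space Pred" by (auto simp: time_set_def)
    then show ?thesis by (metis sets.top)
  next
    case 2
    have "{z \<in> space Pred. a < fst (snd z)} = \<Omega> \<times> {r \<in> T. a < r} \<times> space M" by auto
    then show ?thesis using Pred_sets_after[OF 2 top sets.top] by simp
  next
    case 3
    have "\<not> a < r" if "r \<in> T" for r
      using that 3 less_trans[of "ereal a" "ereal r" T1] by (auto simp: time_set_def)
    then have "{z \<in> space Pred. a < fst (snd z)} = {}" by auto
    then show ?thesis by (metis sets.empty_sets)
  qed
qed

lemma measurable_Pred_mark [measurable]: "(\<lambda>z. snd (snd z)) \<in> Pred \<rightarrow>\<^sub>M M"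
proof (rule measurableI)
  fix B assume B: "B \<in> sets M"
  have top: "\<Omega> \<in> sets (F s)" for s using sets.top[of "F s"] by simp
  have T0: "T0 \<in> T" using T0_less_T1 by (simp add: time_set_def)
  have "\<Omega> \<times> {T0} \<times> B \<in> sets Pred"
    unfolding sets_Pred using B top by (intro sigma_sets.Basic UnI2) auto
  moreover have "(\<lambda>z. snd (snd z)) -` B \<inter> space Pred = (\<Omega> \<times> {T0} \<times> B) \<union> (\<Omega> \<times> {r \<in> T. T0 < r} \<times> B)"
    using sets.sets_into_space[OF B] T0 by (auto simp: time_set_def)
  ultimately show "(\<lambda>z. snd (snd z)) -` B \<inter> space Pred \<in> sets Pred"
    using Pred_sets_after[OF T0 top B] by auto
qed auto

text \<open>A rational \<open>c\<close> with \<open>t_n \<le> c < s\<close> turns the event into a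
  countable union of products of an event of the history at \<open>c\<close> and the times after
  \<open>c\<close>. The strict inequality \<open>t_n < s\<close> is what leaves room for
  \<open>c\<close>.\<close>

lemma Pred_sets_mark_before:
  assumes B: "B \<in> sets M"
  shows "{z \<in> space Pred. jt n (fst z) < ereal (fst (snd z)) \<and> jump_state n (fst z) \<in> Some ` B} \<in> sets Pred"
proof -
  let ?C = "\<rat> \<inter> T"
  have "{z \<in> space Pred. jt n (fst z) < ereal (fst (snd z)) \<and> jump_state n (fst z) \<in> Some ` B} =
      (\<Union>c\<in>?C. {\<omega> \<in> \<Omega>. jump_state n \<omega> \<in> Some ` B \<and> jt n \<omega> \<le> ereal c} \<times> {r \<in> T. c < r} \<times> space M)"
    (is "?L = ?R")
  proof (intro equalityI subsetI)
    fix z assume z: "z \<in> ?L"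
    obtain \<omega> r y where zz: "z = (\<omega>, r, y)" by (cases z) auto
    then have \<omega>: "\<omega> \<in> \<Omega>" and r: "r \<in> T" and lt: "jt n \<omega> < ereal r" using z by auto
    then have "jt n \<omega> < T1" using jt_less_T1[OF r, of n \<omega>] lt by simp
    then have eq: "jt n \<omega> = ereal (\<tau> n \<omega>)" and \<tau>T: "\<tau> n \<omega> \<in> T" using jt_eq_\<tau>[OF \<omega>] by auto
    then have "\<tau> n \<omega> < r" using lt by simp
    then obtain c where c: "c \<in> \<rat>" "\<tau> n \<omega> < c" "c < r" using Rats_dense_in_real by blast
    then have "c \<in> T" using T_interval[OF \<tau>T r] by auto
    then show "z \<in> ?R" using c z zz eq by (intro UN_I[of c]) auto
  next
    fix z assume "z \<in> ?R"
    then show "z \<in> ?L" by (auto intro: le_less_trans)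
  qed
  also have "\<dots> \<in> sets Pred"
    using B by (intro sets.countable_UN'' Pred_sets_after history_mark)
      (auto simp: time_set_def intro!: countable_subset[OF _ countable_rat])
  finally show ?thesis .
qed

lemma Pred_sets_before: "{z \<in> space Pred. jt n (fst z) < ereal (fst (snd z))} \<in> sets Pred"
proof -
  have "{z \<in> space Pred. jt n (fst z) < ereal (fst (snd z))} =
     {z \<in> space Pred. jt n (fst z) < ereal (fst (snd z)) \<and> jump_state n (fst z) \<in> Some ` space M}"
    using jump_state_eq_X[OF _ jt_less_T1] X_space by (auto simp: less_imp_le)
  then show ?thesis using Pred_sets_mark_before[OF sets.top] by simp
qed

text \<open>The state \<open>x_n\<close> is predictable only after \<open>t_n\<close>, so it is
  masked by \<open>x0\<close> up to that time.\<close>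

lemma measurable_Pred_state [measurable]:
  "(\<lambda>z. if jt n (fst z) < ereal (fst (snd z)) then X n (fst z) else x0) \<in> Pred \<rightarrow>\<^sub>M M"
proof (rule measurableI)
  fix z assume "z \<in> space Pred"
  then show "(if jt n (fst z) < ereal (fst (snd z)) then X n (fst z) else x0) \<in> space M"
    using X_space x0 by auto
next
  fix B assume B: "B \<in> sets M"
  have "(\<lambda>z. if jt n (fst z) < ereal (fst (snd z)) then X n (fst z) else x0) -` B \<inter> space Pred =
      {z \<in> space Pred. jt n (fst z) < ereal (fst (snd z)) \<and> jump_state n (fst z) \<in> Some ` B} \<union>
      (if x0 \<in> B then space Pred - {z \<in> space Pred. jt n (fst z) < ereal (fst (snd z))} else {})"
    using jump_state_eq_X[OF _ jt_less_T1] by (auto simp: less_imp_le split: if_splits)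
  also have "\<dots> \<in> sets Pred"
  proof -
    have "space Pred - {z \<in> space Pred. jt n (fst z) < ereal (fst (snd z))} \<in> sets Pred"
      by (intro sets.Diff sets.top Pred_sets_before)
    then show ?thesis
      by (cases "x0 \<in> B")
        (simp_all only: if_True if_False Pred_sets_mark_before[OF B] sets.Un sets.empty_sets)
  qed
  finally show "(\<lambda>z. if jt n (fst z) < ereal (fst (snd z)) then X n (fst z) else x0) -` B \<inter> space Pred \<in> sets Pred" .
qed

lemma measurable_Pred_history:
  assumes "u \<in> T" "A \<in> sets (F u)"
  shows "{z \<in> space Pred. fst z \<in> A \<and> u < fst (snd z)} \<in> sets Pred"
proof -
  have "{z \<in> space Pred. fst z \<in> A \<and> u < fst (snd z)} = A \<times> {r \<in> T. u < r} \<times> space M"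
    using sets.sets_into_space[OF assms(2)] by auto
  then show ?thesis using Pred_sets_after[OF assms sets.top] by simp
qed

lemma space_mark_space [simp]: "space (mark_space M T0 T1) = T \<times> space M"
  by (auto simp: mark_space_def space_pair_measure space_restrict_space)

text \<open>Makes the sections of a predictable integrand at fixed \<open>\<omega>\<close>
  measurable, so that the integrals over jump measure and compensator can be computed path by
  path.\<close>

lemma measurable_Pair_Pred:
  assumes \<omega>: "\<omega> \<in> \<Omega>"
  shows "Pair \<omega> \<in> mark_space M T0 T1 \<rightarrow>\<^sub>M Pred"
  unfolding predictable_space_def
proof (rule measurable_measure_of[OF predictable_generators])
  show "Pair \<omega> \<in> space (mark_space M T0 T1) \<rightarrow> \<Omega> \<times> T \<times> space M"
    using \<omega> by auto
  have box: "{s<..r} \<times> B \<in> sets (mark_space M T0 T1)" if "T0 \<le> s" "ereal r < T1" "B \<in> sets M" for s r B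
  proof -
    have "{s<..r} \<subseteq> T" using that by (auto simp: time_set_def intro: le_less_trans[of _ "ereal r"])
    then have "{s<..r} \<in> sets (restrict_space borel T)"
      by (subst sets_restrict_space_iff) auto
    then show ?thesis using that unfolding mark_space_def by auto
  qed
  have box0: "{T0} \<times> B \<in> sets (mark_space M T0 T1)" if "B \<in> sets M" for B
  proof -
    have "{T0} \<subseteq> T" using T0_less_T1 by (auto simp: time_set_def)
    then have "{T0} \<in> sets (restrict_space borel T)"
      by (subst sets_restrict_space_iff) auto
    then show ?thesis using that unfolding mark_space_def by auto
  qed
  fix Y assume "Y \<in> {A \<times> {s<..r} \<times> B | A s r B.
      T0 \<le> s \<and> s < r \<and> ereal r < T1 \<and> A \<in> sets (F s) \<and> B \<in> sets M} \<union>
   {A \<times> {T0} \<times> B | A B. A \<in> sets (F T0) \<and> B \<in> sets M}"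
  then obtain A E where Y: "Y = A \<times> E" and E: "E \<in> sets (mark_space M T0 T1)"
    using box box0 by blast
  have "Pair \<omega> -` Y \<inter> space (mark_space M T0 T1) = (if \<omega> \<in> A then E else {})"
    using sets.sets_into_space[OF E] Y by auto
  then show "Pair \<omega> -` Y \<inter> space (mark_space M T0 T1) \<in> sets (mark_space M T0 T1)"
    using E by simp
qed

end


section \<open>The compensator identity\<close>

context jump_law
begin

text \<open>Written with \<open>if\<close> so that the measurability prover and the simplifier act
  on the condition directly.\<close>

abbreviation chi :: "bool \<Rightarrow> ennreal" where "chi P \<equiv> (if P then 1 else 0)"

lemma nn_integral_jump_measure:
  assumes \<omega>: "\<omega> \<in> \<Omega>" and f: "f \<in> borel_measurable (mark_space M T0 T1)"
  shows "(\<integral>\<^sup>+ z. f z \<partial>jump_measure M T0 T1 \<omega>) =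
    (\<integral>\<^sup>+ n. f (\<tau> n \<omega>, X n \<omega>) \<partial>count_space {n. 1 \<le> n \<and> jt n \<omega> < T1})"
proof -
  have eq: "(real_of_ereal (jt n \<omega>), the (jump_state n \<omega>)) = (\<tau> n \<omega>, X n \<omega>)" if "jt n \<omega> < T1" for n
    using that by (simp add: \<tau>_def X_def)
  have meas: "(\<lambda>n. (real_of_ereal (jt n \<omega>), the (jump_state n \<omega>))) \<in>
      count_space {n. 1 \<le> n \<and> jt n \<omega> < T1} \<rightarrow>\<^sub>M mark_space M T0 T1"
    using jt_eq_\<tau>(2)[OF \<omega>] X_space[OF \<omega>] by (auto simp: eq)
  show ?thesis
    unfolding jump_measure_def
    by (subst nn_integral_distr[OF meas]) (use f in \<open>auto simp: eq intro!: nn_integral_cong\<close>)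
qed

text \<open>The compensator is given by its values on sets. These are the values at indicators of a
  countably additive functional \<open>I\<close>, so \<open>nn_integral_functional\<close>
  identifies the integral with \<open>I\<close>.\<close>

lemma nn_integral_predicted_measure:
  assumes \<omega>: "\<omega> \<in> \<Omega>" and f: "f \<in> borel_measurable (mark_space M T0 T1)"
  shows "(\<integral>\<^sup>+ z. f z \<partial>predicted_measure M T0 T1 q \<omega>) =
    (\<integral>\<^sup>+ s\<in>T. (\<Sum>n. chi (jt n \<omega> < ereal s \<and> ereal s \<le> jt (Suc n) \<omega>) *
       (\<integral>\<^sup>+ y. f (s, y) \<partial>kern (X n \<omega>) s)) \<partial>lborel)"
proof -
  let ?K = "mark_space M T0 T1"
  \<comment> \<open>Redirecting times outside \<open>T\<close> to \<open>T0\<close> makes every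
    section \<open>g (c s, y)\<close> measurable in \<open>y\<close>; the integral over
    \<open>T\<close> does not see the change.\<close>
  define c where "c s = (if s \<in> T then s else T0)" for s
  have cT: "c s \<in> T" for s using T0_less_T1 by (simp add: c_def time_set_def)
  have [measurable]: "c \<in> borel \<rightarrow>\<^sub>M restrict_space borel T"
    by (rule measurable_restrict_space2) (use cT in \<open>simp_all add: c_def[abs_def]\<close>)
  have [measurable]: "X n \<omega> \<in> space M" for n by (rule X_space[OF \<omega>])
  define G where "G n g s = (\<integral>\<^sup>+ y. g (c s, y) \<partial>kern (X n \<omega>) s)" for n and g :: "real \<times> 'a \<Rightarrow> ennreal" and s
  have sec: "(\<lambda>y. g (c s, y)) \<in> borel_measurable M" if "g \<in> borel_measurable ?K" for g :: "real \<times> 'a \<Rightarrow> ennreal" and s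
    by (rule measurable_compose[OF measurable_Pair1' that[unfolded mark_space_def]])
      (use cT in \<open>simp add: space_restrict_space\<close>)
  have meas_G [measurable]: "G n g \<in> borel_measurable borel" if "g \<in> borel_measurable ?K" for n g
  proof -
    have "(\<lambda>z. (c (fst z), snd z)) \<in> borel \<Otimes>\<^sub>M M \<rightarrow>\<^sub>M ?K"
      unfolding mark_space_def by measurable
    from measurable_compose[OF this that]
    have [measurable]: "(\<lambda>z. g (c (fst z), snd z)) \<in> borel_measurable (borel \<Otimes>\<^sub>M M)" .
    show ?thesis unfolding G_def[abs_def] by measurable
  qed
  define I where "I g = (\<integral>\<^sup>+ s\<in>T. (\<Sum>n. chi (jt n \<omega> < ereal s \<and> ereal s \<le> jt (Suc n) \<omega>) * G n g s) \<partial>lborel)" for g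
  have cong: "I g = I h" if "\<And>z. z \<in> space ?K \<Longrightarrow> g z = h z" for g h
  proof -
    have "G n g s = G n h s" for n s
      unfolding G_def by (intro nn_integral_cong that) (use cT in auto)
    then show ?thesis by (simp add: I_def)
  qed
  have cmult: "I (\<lambda>z. a * g z) = a * I g" if [measurable]: "g \<in> borel_measurable ?K" for g a
  proof -
    have G: "G n (\<lambda>z. a * g z) s = a * G n g s" for n s
      unfolding G_def by (rule nn_integral_cmult) (use sec[OF that] in measurable)
    have "I (\<lambda>z. a * g z) = (\<integral>\<^sup>+ s. a * ((\<Sum>n. chi (jt n \<omega> < ereal s \<and> ereal s \<le> jt (Suc n) \<omega>) * G n g s) * indicator T s) \<partial>lborel)"
      unfolding I_def G by (intro nn_integral_cong) (simp add: mult.left_commute mult.assoc)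
    also have "\<dots> = a * I g"
      unfolding I_def by (rule nn_integral_cmult) measurable
    finally show ?thesis .
  qed
  have suminf: "I (\<lambda>z. \<Sum>i. g i z) = (\<Sum>i. I (g i))" if [measurable]: "\<And>i::nat. g i \<in> borel_measurable ?K" for g
  proof -
    have G: "G n (\<lambda>z. \<Sum>i. g i z) s = (\<Sum>i. G n (g i) s)" for n s
      unfolding G_def by (rule nn_integral_suminf) (use sec[OF that] in measurable)
    have "I (\<lambda>z. \<Sum>i. g i z) = (\<integral>\<^sup>+ s. (\<Sum>i. (\<Sum>n. chi (jt n \<omega> < ereal s \<and> ereal s \<le> jt (Suc n) \<omega>) * G n (g i) s) * indicator T s) \<partial>lborel)"
      unfolding I_def G
    proof (intro nn_integral_cong)
      fix s
      let ?b = "\<lambda>i n. chi (jt n \<omega> < ereal s \<and> ereal s \<le> jt (Suc n) \<omega>) * G n (g i) s"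
      have "(\<Sum>n. chi (jt n \<omega> < ereal s \<and> ereal s \<le> jt (Suc n) \<omega>) * (\<Sum>i. G n (g i) s)) = (\<Sum>n. \<Sum>i. ?b i n)"
        by (simp only: ennreal_suminf_cmult)
      also have "\<dots> = (\<Sum>i. \<Sum>n. ?b i n)" by (rule suminf_swap_ennreal)
      finally show "(\<Sum>n. chi (jt n \<omega> < ereal s \<and> ereal s \<le> jt (Suc n) \<omega>) * (\<Sum>i. G n (g i) s)) * indicator T s =
          (\<Sum>i. (\<Sum>n. ?b i n) * indicator T s)"
        by (simp only: ennreal_suminf_multc)
    qed
    also have "\<dots> = (\<Sum>i. I (g i))"
      unfolding I_def by (rule nn_integral_suminf) measurable
    finally show ?thesis .
  qed
  have pm: "predicted_measure M T0 T1 q \<omega> = measure_of (space ?K) (sets ?K) (\<lambda>E. I (indicator E))"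
    unfolding predicted_measure_def
  proof (rule measure_of_eq[OF sets.space_closed])
    fix E assume "E \<in> sigma_sets (space ?K) (sets ?K)"
    then have E: "E \<in> sets ?K" by (simp only: sets.sigma_sets_eq)
    show "(\<integral>\<^sup>+ s\<in>T. (\<Sum>n. indicator {s. jt n \<omega> < ereal s \<and> ereal s \<le> jt (Suc n) \<omega>} s *
        emeasure (q_plus M q (the (jump_state n \<omega>)) s) {x. (s, x) \<in> E}) \<partial>lborel) = I (indicator E)"
      unfolding I_def
    proof (intro nn_integral_cong)
      fix s
      have "indicator {s. jt n \<omega> < ereal s \<and> ereal s \<le> jt (Suc n) \<omega>} s *
          emeasure (q_plus M q (the (jump_state n \<omega>)) s) {x. (s, x) \<in> E} =
        chi (jt n \<omega> < ereal s \<and> ereal s \<le> jt (Suc n) \<omega>) * G n (indicator E) s" if s: "s \<in> T" for n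
      proof (cases "jt n \<omega> < ereal s")
        case True
        \<comment> \<open>For \<open>s\<close> in \<open>T\<close>, \<open>t_n < s\<close> forces
          \<open>t_n < T1\<close>, so \<open>the\<close> is not applied to
          \<open>None\<close>.\<close>
        then have "the (jump_state n \<omega>) = X n \<omega>"
          using jt_less_T1[OF s, of n \<omega>] by (simp add: X_def)
        moreover have "G n (indicator E) s = emeasure (q_plus M q (X n \<omega>) s) {x. (s, x) \<in> E}"
        proof -
          have "Pair s -` E \<in> sets M" using sets_Pair1[of E] E by (simp add: mark_space_def)
          moreover have "(\<lambda>y. indicator E (s, y) :: ennreal) = indicator (Pair s -` E)"
            by (auto split: split_indicator)
          ultimately show ?thesis
            using s by (simp add: G_def c_def kern_eq vimage_def)
        qed
        ultimately show ?thesis by (simp add: indicator_def)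
      qed simp
      then show "(\<Sum>n. indicator {s. jt n \<omega> < ereal s \<and> ereal s \<le> jt (Suc n) \<omega>} s *
          emeasure (q_plus M q (the (jump_state n \<omega>)) s) {x. (s, x) \<in> E}) * indicator T s =
        (\<Sum>n. chi (jt n \<omega> < ereal s \<and> ereal s \<le> jt (Suc n) \<omega>) * G n (indicator E) s) * indicator T s"
        by (auto split: split_indicator intro!: suminf_cong)
    qed
  qed
  have "(\<integral>\<^sup>+ z. f z \<partial>predicted_measure M T0 T1 q \<omega>) = I f"
    unfolding pm by (rule nn_integral_functional[where I=I, OF cong cmult suminf f])
  also have "\<dots> = (\<integral>\<^sup>+ s\<in>T. (\<Sum>n. chi (jt n \<omega> < ereal s \<and> ereal s \<le> jt (Suc n) \<omega>) *
       (\<integral>\<^sup>+ y. f (s, y) \<partial>kern (X n \<omega>) s)) \<partial>lborel)"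
    unfolding I_def G_def c_def by (intro nn_integral_cong) (simp split: split_indicator)
  finally show ?thesis .
qed

text \<open>For an integrand that vanishes outside \<open>]t\<^sub>j, t\<^sub>j\<^sub>+\<^sub>1]\<close>, the jump measure sees only the jump at
  \<open>t\<^sub>j\<^sub>+\<^sub>1\<close>, and only the \<open>j\<close>-th summand of the predicted measure remains.\<close>

lemma compensation:
  assumes u: "u \<in> T" and w: "w \<in> T" and A: "A \<in> sets (F u)"
    and Aj: "\<And>\<omega>. \<omega> \<in> A \<Longrightarrow> ereal u < jt (Suc j) \<omega>"
    and H [measurable]: "H \<in> borel_measurable (M \<Otimes>\<^sub>M (borel \<Otimes>\<^sub>M M))"
  shows "(\<integral>\<^sup>+ \<omega>\<in>A. chi (jt (Suc j) \<omega> < ereal w) * H (X j \<omega>, \<tau> (Suc j) \<omega>, X (Suc j) \<omega>) \<partial>Pr) =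
    (\<integral>\<^sup>+ \<omega>\<in>A. (\<integral>\<^sup>+ s\<in>{u<..<w}. chi (jt j \<omega> < ereal s \<and> ereal s \<le> jt (Suc j) \<omega>) *
      (\<integral>\<^sup>+ y. H (X j \<omega>, s, y) \<partial>kern (X j \<omega>) s) \<partial>lborel) \<partial>Pr)"
proof -
  \<comment> \<open>The predictable version of the integrand: \<open>A\<close> enters only at times
    after \<open>u\<close>, the condition \<open>s \<le> t_(j+1)\<close> as the complement of a
    predictable set, and \<open>x_j\<close> only after \<open>t_j\<close>.\<close>
  define W where "W z = chi (fst z \<in> A \<and> u < fst (snd z)) * chi (fst (snd z) < w) *
    chi (jt j (fst z) < ereal (fst (snd z))) * chi (\<not> jt (Suc j) (fst z) < ereal (fst (snd z))) *
    H (if jt j (fst z) < ereal (fst (snd z)) then X j (fst z) else x0, fst (snd z), snd (snd z))" for z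
  have [measurable]: "Measurable.pred Pred (\<lambda>z. jt n (fst z) < ereal (fst (snd z)))" for n
    unfolding pred_def by (rule Pred_sets_before)
  have [measurable]: "Measurable.pred Pred (\<lambda>z. fst z \<in> A \<and> u < fst (snd z))"
    unfolding pred_def by (rule measurable_Pred_history[OF u A])
  have W: "W \<in> borel_measurable Pred"
    unfolding W_def by measurable
  have sec: "(\<lambda>z. W (\<omega>, z)) \<in> borel_measurable (mark_space M T0 T1)" if "\<omega> \<in> \<Omega>" for \<omega>
    using measurable_compose[OF measurable_Pair_Pred[OF that] W] .
  have "(\<integral>\<^sup>+ \<omega>. (\<integral>\<^sup>+ z. W (\<omega>, z) \<partial>jump_measure M T0 T1 \<omega>) \<partial>Pr) =
      (\<integral>\<^sup>+ \<omega>. (\<integral>\<^sup>+ z. W (\<omega>, z) \<partial>predicted_measure M T0 T1 q \<omega>) \<partial>Pr)"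
    using compensates W by (auto simp: compensates_def)
  moreover have "(\<integral>\<^sup>+ z. W (\<omega>, z) \<partial>jump_measure M T0 T1 \<omega>) =
      chi (jt (Suc j) \<omega> < ereal w) * H (X j \<omega>, \<tau> (Suc j) \<omega>, X (Suc j) \<omega>) * indicator A \<omega>"
    (is "_ = ?v") if \<omega>: "\<omega> \<in> \<Omega>" for \<omega>
  proof -
    let ?N = "{n. 1 \<le> n \<and> jt n \<omega> < T1}"
    have "(\<integral>\<^sup>+ z. W (\<omega>, z) \<partial>jump_measure M T0 T1 \<omega>) = (\<integral>\<^sup>+ n. W (\<omega>, \<tau> n \<omega>, X n \<omega>) \<partial>count_space ?N)"
      by (rule nn_integral_jump_measure[OF \<omega> sec[OF \<omega>]])
    also have "\<dots> = (\<Sum>n\<in>{Suc j} \<inter> ?N. W (\<omega>, \<tau> n \<omega>, X n \<omega>))"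
    proof (rule nn_integral_count_space')
      fix n assume n: "n \<in> ?N" "n \<notin> {Suc j} \<inter> ?N"
      then have "ereal (\<tau> n \<omega>) = jt n \<omega>" "n \<noteq> Suc j" using jt_eq_\<tau>(1)[OF \<omega>, of n] by auto
      then show "W (\<omega>, \<tau> n \<omega>, X n \<omega>) = 0"
        using jump_time_in_interval[OF \<omega> T0_less_T1, of j n] n by (auto simp: W_def not_less)
    qed auto
    also have "\<dots> = ?v"
    proof (cases "jt (Suc j) \<omega> < T1")
      case True
      have eq: "ereal (\<tau> (Suc j) \<omega>) = jt (Suc j) \<omega>" using jt_eq_\<tau>(1)[OF \<omega> True] by simp
      have "jt j \<omega> < T1" using jump_time_mono[OF \<omega> T0_less_T1, of j "Suc j"] True by auto
      then have "jt j \<omega> < jt (Suc j) \<omega>" by (rule jump_before_T1(1)[OF \<omega> T0_less_T1])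
      moreover have "u < \<tau> (Suc j) \<omega>" if "\<omega> \<in> A" using Aj[OF that] by (simp add: eq[symmetric])
      moreover have "\<tau> (Suc j) \<omega> < w \<longleftrightarrow> jt (Suc j) \<omega> < ereal w" by (simp add: eq[symmetric])
      moreover have "{Suc j} \<inter> ?N = {Suc j}" using True by auto
      ultimately show ?thesis by (auto simp: W_def eq)
    \<comment> \<open>If \<open>t_(j+1) = T1\<close>, the jump measure omits it, and
      \<open>t_(j+1) < w\<close> fails because \<open>w\<close> lies before
      \<open>T1\<close>.\<close>
    next
      case False
      then have "{Suc j} \<inter> ?N = {}" by auto
      moreover have "\<not> jt (Suc j) \<omega> < ereal w" using jt_less_T1[OF w, of "Suc j" \<omega>] False less_imp_le by blast
      ultimately show ?thesis by simp
    qed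
    finally show ?thesis .
  qed
  moreover have "(\<integral>\<^sup>+ z. W (\<omega>, z) \<partial>predicted_measure M T0 T1 q \<omega>) =
      (\<integral>\<^sup>+ s\<in>{u<..<w}. chi (jt j \<omega> < ereal s \<and> ereal s \<le> jt (Suc j) \<omega>) *
        (\<integral>\<^sup>+ y. H (X j \<omega>, s, y) \<partial>kern (X j \<omega>) s) \<partial>lborel) * indicator A \<omega>"
    (is "_ = ?v") if \<omega>: "\<omega> \<in> \<Omega>" for \<omega>
  proof -
    have [measurable]: "X j \<omega> \<in> space M" by (rule X_space[OF \<omega>])
    have "(\<integral>\<^sup>+ z. W (\<omega>, z) \<partial>predicted_measure M T0 T1 q \<omega>) =
      (\<integral>\<^sup>+ s\<in>T. (\<Sum>n. chi (jt n \<omega> < ereal s \<and> ereal s \<le> jt (Suc n) \<omega>) *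
       (\<integral>\<^sup>+ y. W (\<omega>, s, y) \<partial>kern (X n \<omega>) s)) \<partial>lborel)"
      by (rule nn_integral_predicted_measure[OF \<omega> sec[OF \<omega>]])
    also have "\<dots> = (\<integral>\<^sup>+ s. chi (\<omega> \<in> A) * (chi (jt j \<omega> < ereal s \<and> ereal s \<le> jt (Suc j) \<omega>) *
        (\<integral>\<^sup>+ y. H (X j \<omega>, s, y) \<partial>kern (X j \<omega>) s) * indicator {u<..<w} s) \<partial>lborel)"
    proof (intro nn_integral_cong)
      fix s
      have W0: "W (\<omega>, s, y) = 0" if "\<not> (jt j \<omega> < ereal s \<and> ereal s \<le> jt (Suc j) \<omega>)" for y
        using that by (auto simp: W_def not_less)
      have W1: "W (\<omega>, s, y) = chi (\<omega> \<in> A \<and> u < s \<and> s < w) * H (X j \<omega>, s, y)"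
        if "jt j \<omega> < ereal s" "ereal s \<le> jt (Suc j) \<omega>" for y
        using that by (auto simp: W_def not_less)
      have "(\<Sum>n. chi (jt n \<omega> < ereal s \<and> ereal s \<le> jt (Suc n) \<omega>) * (\<integral>\<^sup>+ y. W (\<omega>, s, y) \<partial>kern (X n \<omega>) s))
          = (\<Sum>n\<in>{j}. chi (jt n \<omega> < ereal s \<and> ereal s \<le> jt (Suc n) \<omega>) * (\<integral>\<^sup>+ y. W (\<omega>, s, y) \<partial>kern (X n \<omega>) s))"
      proof (rule suminf_finite)
        fix n assume "n \<notin> {j}"
        then show "chi (jt n \<omega> < ereal s \<and> ereal s \<le> jt (Suc n) \<omega>) * (\<integral>\<^sup>+ y. W (\<omega>, s, y) \<partial>kern (X n \<omega>) s) = 0"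
          using W0 jump_interval_unique[OF \<omega> T0_less_T1, of j "ereal s" n]
          by (cases "jt j \<omega> < ereal s \<and> ereal s \<le> jt (Suc j) \<omega>") auto
      qed simp
      also have "\<dots> = chi (jt j \<omega> < ereal s \<and> ereal s \<le> jt (Suc j) \<omega>) * chi (\<omega> \<in> A \<and> u < s \<and> s < w) *
          (\<integral>\<^sup>+ y. H (X j \<omega>, s, y) \<partial>kern (X j \<omega>) s)"
        by (auto simp: W1)
      finally show "(\<Sum>n. chi (jt n \<omega> < ereal s \<and> ereal s \<le> jt (Suc n) \<omega>) *
          (\<integral>\<^sup>+ y. W (\<omega>, s, y) \<partial>kern (X n \<omega>) s)) * indicator T s =
        chi (\<omega> \<in> A) * (chi (jt j \<omega> < ereal s \<and> ereal s \<le> jt (Suc j) \<omega>) *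
        (\<integral>\<^sup>+ y. H (X j \<omega>, s, y) \<partial>kern (X j \<omega>) s) * indicator {u<..<w} s)"
        using subsetD[OF T_interval[OF u w], of s] by (auto split: split_indicator)
    qed
    also have "\<dots> = ?v"
      by (cases "\<omega> \<in> A") auto
    finally show ?thesis .
  qed
  ultimately show ?thesis
    by (simp add: space_Pr cong: nn_integral_cong_simp)
qed

end


section \<open>Conditional law of the next jump\<close>

context jump_law
begin

text \<open>Weighting the jump after \<open>t\<^sub>j\<close> at time \<open>s\<close> by the probability of no jump in \<open>]s, w]\<close> makes both
  sides of the compensator identity explicit; cancelling the finite left side leaves the
  conditional survival probability.\<close>

lemma no_jump_set:
  assumes u: "u \<in> T" and w: "w \<in> T" and uw: "u < w" and A: "A \<in> sets (F u)"
    and Aj: "\<And>\<omega>. \<omega> \<in> A \<Longrightarrow> ereal u < jt (Suc j) \<omega>"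
    and C [measurable]: "C \<in> sets M"
  shows "(\<integral>\<^sup>+ \<omega>\<in>A. chi (jt j \<omega> < ereal w \<and> ereal w \<le> jt (Suc j) \<omega>) * indicator C (X j \<omega>) \<partial>Pr) =
    (\<integral>\<^sup>+ \<omega>\<in>A. chi (jt j \<omega> < ereal w) * surv (X j \<omega>) (max u (\<tau> j \<omega>)) w * indicator C (X j \<omega>) \<partial>Pr)"
    (is "(\<integral>\<^sup>+ \<omega>. ?d \<omega> \<partial>Pr) = (\<integral>\<^sup>+ \<omega>. ?c \<omega> \<partial>Pr)")
proof -
  have [measurable]: "A \<in> sets Pr" using A sets_history_subset by auto
  let ?H = "\<lambda>z. indicator C (fst z) * surv (fst z) (fst (snd z)) w :: ennreal"
  let ?a = "\<lambda>\<omega>. chi (jt (Suc j) \<omega> < ereal w) * (indicator C (X j \<omega>) * surv (X j \<omega>) (\<tau> (Suc j) \<omega>) w) * indicator A \<omega>"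
  let ?b = "\<lambda>\<omega>. (\<integral>\<^sup>+ s\<in>{u<..<w}. chi (jt j \<omega> < ereal s \<and> ereal s \<le> jt (Suc j) \<omega>) *
      (\<integral>\<^sup>+ y. indicator C (X j \<omega>) * surv (X j \<omega>) s w \<partial>kern (X j \<omega>) s) \<partial>lborel) * indicator A \<omega>"
  have "(\<integral>\<^sup>+ \<omega>\<in>A. chi (jt (Suc j) \<omega> < ereal w) * ?H (X j \<omega>, \<tau> (Suc j) \<omega>, X (Suc j) \<omega>) \<partial>Pr) =
    (\<integral>\<^sup>+ \<omega>\<in>A. (\<integral>\<^sup>+ s\<in>{u<..<w}. chi (jt j \<omega> < ereal s \<and> ereal s \<le> jt (Suc j) \<omega>) *
      (\<integral>\<^sup>+ y. ?H (X j \<omega>, s, y) \<partial>kern (X j \<omega>) s) \<partial>lborel) \<partial>Pr)"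
    by (rule compensation[OF u w A Aj]) measurable
  then have ab: "(\<integral>\<^sup>+ \<omega>. ?a \<omega> \<partial>Pr) = (\<integral>\<^sup>+ \<omega>. ?b \<omega> \<partial>Pr)" by simp
  \<comment> \<open>The identity holds on each path. \<open>?a\<close> and \<open>?b\<close> are the
    two sides of the compensator identity; \<open>?c\<close> is survival from the start of
    observation and \<open>?d\<close> the event of no jump before \<open>w\<close>.\<close>
  have "?b \<omega> + ?c \<omega> = ?a \<omega> + ?d \<omega>" if \<omega>: "\<omega> \<in> \<Omega>" for \<omega>
  proof (cases "\<omega> \<in> A \<and> jt j \<omega> < ereal w \<and> X j \<omega> \<in> C")
    case False
    have "?b \<omega> = (\<integral>\<^sup>+ s. 0 \<partial>(lborel :: real measure)) * indicator A \<omega>"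
    proof (cases "\<omega> \<in> A")
      case True
      have "chi (jt j \<omega> < ereal s \<and> ereal s \<le> jt (Suc j) \<omega>) *
          (\<integral>\<^sup>+ y. indicator C (X j \<omega>) * surv (X j \<omega>) s w \<partial>kern (X j \<omega>) s) * indicator {u<..<w} s = 0" for s
        using False True less_trans[of "jt j \<omega>" "ereal s" "ereal w"] by (cases "X j \<omega> \<in> C") (auto split: split_indicator)
      then show ?thesis by (simp only:)
    qed simp
    moreover have "?a \<omega> = 0"
      using False jump_time_mono[OF \<omega> T0_less_T1, of j "Suc j"] by auto
    ultimately show ?thesis using False by auto
  next
    case True
    have X [measurable]: "X j \<omega> \<in> space M" by (rule X_space[OF \<omega>])
    have "jt j \<omega> < T1" using jt_less_T1[OF w, of j \<omega>] True by auto
    then have tj: "jt j \<omega> = ereal (\<tau> j \<omega>)" "\<tau> j \<omega> \<in> T" using jt_eq_\<tau>[OF \<omega>] by auto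
    define p where "p = max u (\<tau> j \<omega>)"
    \<comment> \<open>The end of observation: the minimum of \<open>t_(j+1)\<close> and
      \<open>w\<close>, made real.\<close>
    define e where "e = (if jt (Suc j) \<omega> < ereal w then \<tau> (Suc j) \<omega> else w)"
    have pT: "p \<in> T" using u tj by (auto simp: p_def max_def)
    have e: "e \<le> w \<and> p \<le> e \<and> (ereal s \<le> jt (Suc j) \<omega> \<and> s < w \<longleftrightarrow> s \<le> e \<and> s < w)" for s
    proof (cases "jt (Suc j) \<omega> < ereal w")
      case less: True
      then have "jt (Suc j) \<omega> < T1" using jt_less_T1[OF w, of "Suc j" \<omega>] by auto
      then have eq: "jt (Suc j) \<omega> = ereal (\<tau> (Suc j) \<omega>)" using jt_eq_\<tau>[OF \<omega>] by auto
      show ?thesis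
        using less Aj[of \<omega>] True jump_time_mono[OF \<omega> T0_less_T1, of j "Suc j"]
        by (auto simp: e_def p_def eq tj)
    next
      case False
      then show ?thesis using True uw tj less_le_trans[of "ereal s" "ereal w" "jt (Suc j) \<omega>"]
        by (auto simp: e_def p_def not_less)
    qed
    have "?b \<omega> = (\<integral>\<^sup>+ s\<in>{u<..<w}. chi (jt j \<omega> < ereal s \<and> ereal s \<le> jt (Suc j) \<omega>) *
        (rate (X j \<omega>) s * surv (X j \<omega>) s w) \<partial>lborel)"
      using True by (simp add: rate_def mult.commute)
    also have "\<dots> = (\<integral>\<^sup>+ s\<in>{p<..<e}. rate (X j \<omega>) s * surv (X j \<omega>) s w \<partial>lborel)"
    \<comment> \<open>The compensator interval includes its right end \<open>t_(j+1)\<close>; it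
      differs from \<open>{p<..<e}\<close> within the window at most at \<open>e\<close>.\<close>
    proof (rule nn_integral_cong_AE, rule AE_I[of _ _ "{e}"])
      have "chi (jt j \<omega> < ereal s \<and> ereal s \<le> jt (Suc j) \<omega>) *
          (rate (X j \<omega>) s * surv (X j \<omega>) s w) * indicator {u<..<w} s =
          rate (X j \<omega>) s * surv (X j \<omega>) s w * indicator {p<..<e} s" if "s \<noteq> e" for s
      proof -
        have "(jt j \<omega> < ereal s \<and> ereal s \<le> jt (Suc j) \<omega>) \<and> (u < s \<and> s < w) \<longleftrightarrow> p < s \<and> s < e"
          using e[of s] that unfolding p_def tj by auto
        then show ?thesis
          by (cases "jt j \<omega> < ereal s \<and> ereal s \<le> jt (Suc j) \<omega>"; cases "u < s \<and> s < w")
            (auto simp: indicator_def)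
      qed
      then show "{s \<in> space lborel. chi (jt j \<omega> < ereal s \<and> ereal s \<le> jt (Suc j) \<omega>) *
          (rate (X j \<omega>) s * surv (X j \<omega>) s w) * indicator {u<..<w} s \<noteq>
          rate (X j \<omega>) s * surv (X j \<omega>) s w * indicator {p<..<e} s} \<subseteq> {e}"
        by blast
    qed auto
    finally have "?b \<omega> + ?c \<omega> = (\<integral>\<^sup>+ s\<in>{p<..<e}. rate (X j \<omega>) s * surv (X j \<omega>) s w \<partial>lborel) + surv (X j \<omega>) p w"
      using True by (simp add: p_def)
    also have "\<dots> = surv (X j \<omega>) e w"
      using e by (intro nn_integral_rate_surv_backward X pT w) auto
    \<comment> \<open>If the jump comes before \<open>w\<close>, \<open>surv\<close> from
      \<open>e\<close> is its weight \<open>?a\<close>; otherwise \<open>e = w\<close>, and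
      \<open>surv\<close> is 1, which is \<open>?d\<close>.\<close>
    also have "\<dots> = ?a \<omega> + ?d \<omega>"
      using True by (auto simp: e_def)
    finally show ?thesis .
  qed
  then have "(\<integral>\<^sup>+ \<omega>. ?b \<omega> + ?c \<omega> \<partial>Pr) = (\<integral>\<^sup>+ \<omega>. ?a \<omega> + ?d \<omega> \<partial>Pr)"
    by (intro nn_integral_cong) (simp add: space_Pr)
  moreover have "(\<integral>\<^sup>+ \<omega>. ?b \<omega> + ?c \<omega> \<partial>Pr) = (\<integral>\<^sup>+ \<omega>. ?b \<omega> \<partial>Pr) + (\<integral>\<^sup>+ \<omega>. ?c \<omega> \<partial>Pr)"
    by (rule nn_integral_add) (unfold indicator_def, measurable)
  moreover have "(\<integral>\<^sup>+ \<omega>. ?a \<omega> + ?d \<omega> \<partial>Pr) = (\<integral>\<^sup>+ \<omega>. ?a \<omega> \<partial>Pr) + (\<integral>\<^sup>+ \<omega>. ?d \<omega> \<partial>Pr)"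
    by (rule nn_integral_add) measurable
  ultimately have "(\<integral>\<^sup>+ \<omega>. ?a \<omega> \<partial>Pr) + (\<integral>\<^sup>+ \<omega>. ?c \<omega> \<partial>Pr) = (\<integral>\<^sup>+ \<omega>. ?a \<omega> \<partial>Pr) + (\<integral>\<^sup>+ \<omega>. ?d \<omega> \<partial>Pr)"
    by (simp only: ab)
  \<comment> \<open>Cancellation in \<open>ennreal\<close> requires a finite common term; the weight
    is at most 1 under a probability measure.\<close>
  moreover have "(\<integral>\<^sup>+ \<omega>. ?a \<omega> \<partial>Pr) \<noteq> \<top>"
  proof -
    have "(\<integral>\<^sup>+ \<omega>. ?a \<omega> \<partial>Pr) \<le> (\<integral>\<^sup>+ \<omega>. 1 \<partial>Pr)"
      by (intro nn_integral_mono) (auto simp: surv_le_1 split: split_indicator)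
    also have "\<dots> = 1" by (simp add: Pr.emeasure_space_1)
    finally show ?thesis by (auto simp: top_unique)
  qed
  ultimately show ?thesis by (simp add: ennreal_add_left_cancel)
qed

text \<open>The set version says that two weighted laws of \<open>x_j\<close> agree on all
  measurable sets, so they integrate every nonnegative \<open>G\<close> alike.\<close>

lemma no_jump:
  assumes u: "u \<in> T" and w: "w \<in> T" and uw: "u < w" and A: "A \<in> sets (F u)"
    and Aj: "\<And>\<omega>. \<omega> \<in> A \<Longrightarrow> ereal u < jt (Suc j) \<omega>"
    and G: "G \<in> borel_measurable M"
  shows "(\<integral>\<^sup>+ \<omega>\<in>A. chi (jt j \<omega> < ereal w \<and> ereal w \<le> jt (Suc j) \<omega>) * G (X j \<omega>) \<partial>Pr) =
    (\<integral>\<^sup>+ \<omega>\<in>A. chi (jt j \<omega> < ereal w) * surv (X j \<omega>) (max u (\<tau> j \<omega>)) w * G (X j \<omega>) \<partial>Pr)"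
proof -
  have [measurable]: "A \<in> sets Pr" using A sets_history_subset by auto
  define law where "law f = distr (density Pr (\<lambda>\<omega>. f \<omega> * indicator A \<omega>)) M (X j)" for f :: "'a jump_seq \<Rightarrow> ennreal"
  have law: "(\<integral>\<^sup>+ x. g x \<partial>law f) = (\<integral>\<^sup>+ \<omega>\<in>A. f \<omega> * g (X j \<omega>) \<partial>Pr)"
    if [measurable]: "f \<in> borel_measurable Pr" "g \<in> borel_measurable M" for f g
    unfolding law_def
    by (subst nn_integral_distr) (auto simp: nn_integral_density ac_simps)
  let ?f = "\<lambda>\<omega>. chi (jt j \<omega> < ereal w \<and> ereal w \<le> jt (Suc j) \<omega>)"
  let ?g = "\<lambda>\<omega>. chi (jt j \<omega> < ereal w) * surv (X j \<omega>) (max u (\<tau> j \<omega>)) w"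
  have [measurable]: "?f \<in> borel_measurable Pr" "?g \<in> borel_measurable Pr" by measurable
  have "law ?f = law ?g"
  proof (rule measure_eqI)
    fix C assume "C \<in> sets (law ?f)"
    then have C [measurable]: "C \<in> sets M" by (simp add: law_def)
    have ind: "emeasure (law f) C = (\<integral>\<^sup>+ x. indicator C x \<partial>law f)" for f
      using C by (simp add: law_def)
    show "emeasure (law ?f) C = emeasure (law ?g) C"
      unfolding ind using no_jump_set[OF u w uw A Aj C] by (simp add: law)
  qed (simp add: law_def)
  then have "(\<integral>\<^sup>+ x. G x \<partial>law ?f) = (\<integral>\<^sup>+ x. G x \<partial>law ?g)" by simp
  then show ?thesis using G by (simp add: law)
qed

text \<open>The compensator is absolutely continuous in time and gives \<open>{t}\<close> no mass,
  hence neither does the expected jump measure. This reconciles the left-open intervals of the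
  compensator with the right-open ones of the process.\<close>

lemma AE_jump_time_neq:
  assumes t: "t \<in> T" "T0 < t"
  shows "AE \<omega> in Pr. jt n \<omega> \<noteq> ereal t"
proof (cases n)
  case 0
  then show ?thesis using t by simp
next
  case (Suc j)
  \<comment> \<open>\<open>compensation\<close> registers only jumps strictly before
    \<open>w\<close>, so \<open>w\<close> has to lie beyond \<open>t\<close>.\<close>
  obtain w where w: "t < w" "ereal w < T1" using T_rational[OF t(1)] by auto
  then have wT: "w \<in> T" using t by (auto simp: time_set_def)
  have T0: "T0 \<in> T" using T0_less_T1 by (simp add: time_set_def)
  let ?H = "\<lambda>z :: 'a \<times> real \<times> 'a. chi (fst (snd z) = t)"
  have \<Omega>: "\<Omega> \<in> sets (F T0)" using sets.top[of "F T0"] by simp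
  have "(\<integral>\<^sup>+ \<omega>\<in>\<Omega>. chi (jt (Suc j) \<omega> < ereal w) * ?H (X j \<omega>, \<tau> (Suc j) \<omega>, X (Suc j) \<omega>) \<partial>Pr) =
    (\<integral>\<^sup>+ \<omega>\<in>\<Omega>. (\<integral>\<^sup>+ s\<in>{T0<..<w}. chi (jt j \<omega> < ereal s \<and> ereal s \<le> jt (Suc j) \<omega>) *
      (\<integral>\<^sup>+ y. ?H (X j \<omega>, s, y) \<partial>kern (X j \<omega>) s) \<partial>lborel) \<partial>Pr)"
    by (rule compensation[OF T0 wT \<Omega> jump_time_gt_T0[OF _ T0_less_T1]]) measurable
  also have "\<dots> = 0"
  proof -
    have "(\<integral>\<^sup>+ s\<in>{T0<..<w}. chi (jt j \<omega> < ereal s \<and> ereal s \<le> jt (Suc j) \<omega>) *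
      (\<integral>\<^sup>+ y. ?H (X j \<omega>, s, y) \<partial>kern (X j \<omega>) s) \<partial>lborel) = (\<integral>\<^sup>+ s. 0 \<partial>(lborel :: real measure))" for \<omega>
      by (rule nn_integral_cong_AE, rule AE_I[of _ _ "{t}"]) auto
    then show ?thesis by simp
  qed
  finally have "(\<integral>\<^sup>+ \<omega>. chi (jt (Suc j) \<omega> < ereal w) * chi (\<tau> (Suc j) \<omega> = t) \<partial>Pr) = 0"
    by (simp add: space_Pr cong: nn_integral_cong_simp)
  then have "AE \<omega> in Pr. chi (jt (Suc j) \<omega> < ereal w) * chi (\<tau> (Suc j) \<omega> = t) = 0"
    by (subst (asm) nn_integral_0_iff_AE) auto
  then show ?thesis
  proof (rule AE_mp, intro AE_I2 impI)
    fix \<omega> assume *: "chi (jt (Suc j) \<omega> < ereal w) * chi (\<tau> (Suc j) \<omega> = t) = 0"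
    show "jt n \<omega> \<noteq> ereal t"
    proof
      assume "jt n \<omega> = ereal t"
      then show False using * w Suc by (auto simp: \<tau>_def split: if_splits)
    qed
  qed
qed

text \<open>The backward recursion along a path: the jump at \<open>t\<^sub>j\<^sub>+\<^sub>1\<close> performs the outermost integration
  of \<open>J (Suc n)\<close>.\<close>

lemma jump_step:
  assumes u: "u \<in> T" and t: "t \<in> T" and ut: "u < t" and A: "A \<in> sets (F u)"
    and Aj: "\<And>\<omega>. \<omega> \<in> A \<Longrightarrow> ereal u < jt (Suc j) \<omega>"
    and f [measurable]: "f \<in> borel_measurable M"
  shows "(\<integral>\<^sup>+ \<omega>\<in>A. chi (jt j \<omega> < ereal t) * J (Suc n) f (max u (\<tau> j \<omega>)) (X j \<omega>) t \<partial>Pr) =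
    (\<integral>\<^sup>+ \<omega>\<in>A. chi (jt (Suc j) \<omega> < ereal t) * J n f (max u (\<tau> (Suc j) \<omega>)) (X (Suc j) \<omega>) t \<partial>Pr)"
proof -
  have [measurable]: "A \<in> sets Pr" using A sets_history_subset by auto
  interpret P: pair_sigma_finite Pr lborel
    by (intro pair_sigma_finite.intro) unfold_locales
  let ?G = "\<lambda>x s. \<integral>\<^sup>+ y. J n f s y t \<partial>kern x s"
  \<comment> \<open>On \<open>A\<close> the next jump comes after \<open>u\<close>, so the maximum
    is the jump time itself.\<close>
  have "(\<integral>\<^sup>+ \<omega>\<in>A. chi (jt (Suc j) \<omega> < ereal t) * J n f (max u (\<tau> (Suc j) \<omega>)) (X (Suc j) \<omega>) t \<partial>Pr) =
      (\<integral>\<^sup>+ \<omega>\<in>A. chi (jt (Suc j) \<omega> < ereal t) * J n f (\<tau> (Suc j) \<omega>) (X (Suc j) \<omega>) t \<partial>Pr)"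
  proof (rule nn_integral_cong)
    fix \<omega> assume "\<omega> \<in> space Pr"
    then have \<omega>: "\<omega> \<in> \<Omega>" by (simp add: space_Pr)
    have "u \<le> \<tau> (Suc j) \<omega>" if "\<omega> \<in> A" "jt (Suc j) \<omega> < ereal t"
      using Aj[OF that(1)] jt_eq_\<tau>(1)[OF \<omega>, of "Suc j"] jt_less_T1[OF t, of "Suc j" \<omega>] that(2) by auto
    then show "chi (jt (Suc j) \<omega> < ereal t) * J n f (max u (\<tau> (Suc j) \<omega>)) (X (Suc j) \<omega>) t * indicator A \<omega> =
        chi (jt (Suc j) \<omega> < ereal t) * J n f (\<tau> (Suc j) \<omega>) (X (Suc j) \<omega>) t * indicator A \<omega>"
      by (auto simp: max_def split: split_indicator)
  qed
  also have "\<dots> = (\<integral>\<^sup>+ \<omega>\<in>A. (\<integral>\<^sup>+ s\<in>{u<..<t}. chi (jt j \<omega> < ereal s \<and> ereal s \<le> jt (Suc j) \<omega>) *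
      ?G (X j \<omega>) s \<partial>lborel) \<partial>Pr)"
    using compensation[OF u t A Aj, of "\<lambda>z. J n f (fst (snd z)) (snd (snd z)) t"] by simp
  also have "\<dots> = (\<integral>\<^sup>+ \<omega>. (\<integral>\<^sup>+ s. chi (jt j \<omega> < ereal s \<and> ereal s \<le> jt (Suc j) \<omega>) *
      ?G (X j \<omega>) s * chi (u < s \<and> s < t) * indicator A \<omega> \<partial>lborel) \<partial>Pr)"
    (is "_ = (\<integral>\<^sup>+ \<omega>. ?R \<omega> \<partial>Pr)")
  proof (rule nn_integral_cong)
    fix \<omega>
    show "(\<integral>\<^sup>+ s\<in>{u<..<t}. chi (jt j \<omega> < ereal s \<and> ereal s \<le> jt (Suc j) \<omega>) *
        ?G (X j \<omega>) s \<partial>lborel) * indicator A \<omega> = ?R \<omega>"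
      by (cases "\<omega> \<in> A") (auto intro!: nn_integral_cong split: split_indicator)
  qed
  \<comment> \<open>The order of integration is exchanged because \<open>no_jump\<close> works at a
    fixed time \<open>s\<close>. It replaces the event \<open>t_j < s \<le> t_(j+1)\<close> by the
    survival factor of \<open>J (Suc n)\<close>, after which the order is restored.\<close>
  also have "\<dots> = (\<integral>\<^sup>+ s. (\<integral>\<^sup>+ \<omega>. chi (jt j \<omega> < ereal s \<and> ereal s \<le> jt (Suc j) \<omega>) *
      ?G (X j \<omega>) s * chi (u < s \<and> s < t) * indicator A \<omega> \<partial>Pr) \<partial>lborel)"
    by (rule P.Fubini'[symmetric]) measurable
  also have "\<dots> = (\<integral>\<^sup>+ s. (\<integral>\<^sup>+ \<omega>. chi (jt j \<omega> < ereal s) * surv (X j \<omega>) (max u (\<tau> j \<omega>)) s *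
      ?G (X j \<omega>) s * chi (u < s \<and> s < t) * indicator A \<omega> \<partial>Pr) \<partial>lborel)"
  proof (rule nn_integral_cong)
    fix s
    show "(\<integral>\<^sup>+ \<omega>. chi (jt j \<omega> < ereal s \<and> ereal s \<le> jt (Suc j) \<omega>) *
        ?G (X j \<omega>) s * chi (u < s \<and> s < t) * indicator A \<omega> \<partial>Pr) =
      (\<integral>\<^sup>+ \<omega>. chi (jt j \<omega> < ereal s) * surv (X j \<omega>) (max u (\<tau> j \<omega>)) s *
        ?G (X j \<omega>) s * chi (u < s \<and> s < t) * indicator A \<omega> \<partial>Pr)"
    proof (cases "u < s \<and> s < t")
      case True
      then have s: "s \<in> T" using T_interval[OF u t] by auto
      have "(\<lambda>x. ?G x s) \<in> borel_measurable M" by measurable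
      from no_jump[OF u s _ A Aj this] True show ?thesis by simp
    next
      case False
      then have "chi (u < s \<and> s < t) = 0" by simp
      then show ?thesis by (simp only: mult_zero_right mult_zero_left)
    qed
  qed
  also have "\<dots> = (\<integral>\<^sup>+ \<omega>. (\<integral>\<^sup>+ s. chi (jt j \<omega> < ereal s) * surv (X j \<omega>) (max u (\<tau> j \<omega>)) s *
      ?G (X j \<omega>) s * chi (u < s \<and> s < t) * indicator A \<omega> \<partial>lborel) \<partial>Pr)"
    by (rule P.Fubini') measurable
  also have "\<dots> = (\<integral>\<^sup>+ \<omega>\<in>A. chi (jt j \<omega> < ereal t) * J (Suc n) f (max u (\<tau> j \<omega>)) (X j \<omega>) t \<partial>Pr)"
  proof (rule nn_integral_cong)
    fix \<omega> assume "\<omega> \<in> space Pr"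
    then have \<omega>: "\<omega> \<in> \<Omega>" by (simp add: space_Pr)
    show "(\<integral>\<^sup>+ s. chi (jt j \<omega> < ereal s) * surv (X j \<omega>) (max u (\<tau> j \<omega>)) s *
        ?G (X j \<omega>) s * chi (u < s \<and> s < t) * indicator A \<omega> \<partial>lborel) =
      chi (jt j \<omega> < ereal t) * J (Suc n) f (max u (\<tau> j \<omega>)) (X j \<omega>) t * indicator A \<omega>"
    proof (cases "\<omega> \<in> A \<and> jt j \<omega> < ereal t")
      case True
      then have tj: "jt j \<omega> = ereal (\<tau> j \<omega>)"
        using jt_eq_\<tau>(1)[OF \<omega>] jt_less_T1[OF t, of j \<omega>] by auto
      show ?thesis
        unfolding J_Suc'[OF f] using True
        by (auto intro!: nn_integral_cong simp: tj split: split_indicator)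
    next
      case False
      have "\<not> jt j \<omega> < ereal s" if "s < t" "\<omega> \<in> A" for s
        using False that less_trans[of "jt j \<omega>" "ereal s" "ereal t"] by auto
      then have "chi (jt j \<omega> < ereal s) * surv (X j \<omega>) (max u (\<tau> j \<omega>)) s *
        ?G (X j \<omega>) s * chi (u < s \<and> s < t) * indicator A \<omega> = 0" for s
        by (auto split: split_indicator)
      then have "(\<integral>\<^sup>+ s. chi (jt j \<omega> < ereal s) * surv (X j \<omega>) (max u (\<tau> j \<omega>)) s *
        ?G (X j \<omega>) s * chi (u < s \<and> s < t) * indicator A \<omega> \<partial>lborel) = (\<integral>\<^sup>+ s. 0 \<partial>(lborel :: real measure))"
        by (intro nn_integral_cong)
      then show ?thesis using False by auto
    qed
  qed
  finally show ?thesis by simp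
qed

end


section \<open>The Markov property\<close>

context jump_law
begin

text \<open>On \<open>A\<close> the number \<open>m\<close> of jumps up to \<open>u\<close> is
  fixed, so the state at \<open>u\<close> is \<open>X m\<close>, and \<open>n\<close> further jumps
  by time \<open>t\<close> lead to index \<open>m + n\<close>. Fixing \<open>m\<close> lets
  \<open>jump_step\<close> apply with one index for the whole event.\<close>

lemma integral_jump_process_on_interval:
  assumes u: "u \<in> T" and t: "t \<in> T" and ut: "u < t" and A: "A \<in> sets (F u)"
    and Am: "\<And>\<omega>. \<omega> \<in> A \<Longrightarrow> jt m \<omega> \<le> ereal u \<and> ereal u < jt (Suc m) \<omega>"
    and B: "B \<in> sets M"
  shows "(\<integral>\<^sup>+ \<omega>\<in>A. indicator (Some ` B) (jump_process T0 t \<omega>) \<partial>Pr) =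
    (\<integral>\<^sup>+ \<omega>\<in>A. (\<Sum>n. J n (indicator B) u (X m \<omega>) t) \<partial>Pr)"
proof -
  have [measurable]: "A \<in> sets Pr" using A sets_history_subset by auto
  have A_sub: "A \<subseteq> \<Omega>" using sets.sets_into_space[OF A] by simp
  note [measurable] = B
  let ?a = "\<lambda>i n. \<integral>\<^sup>+ \<omega>\<in>A. chi (jt i \<omega> < ereal t) * J n (indicator B) (max u (\<tau> i \<omega>)) (X i \<omega>) t \<partial>Pr"
  have after: "ereal u < jt (Suc i) \<omega>" if "\<omega> \<in> A" "m \<le> i" for i \<omega>
    using Am[OF that(1)] jump_time_mono[of \<omega> M T0 T1 "Suc m" "Suc i"] that A_sub T0_less_T1
    by (auto intro: less_le_trans)
  \<comment> \<open>Each jump moves one unit from the remaining count \<open>n\<close> to the index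
    \<open>i\<close>; at \<open>n = 0\<close> only the survival factor is left, which
    \<open>no_jump\<close> interprets.\<close>
  have shift: "?a i n = ?a (i + n) 0" if "m \<le> i" for i n
    using that
  proof (induction n arbitrary: i)
    case (Suc n)
    have "?a i (Suc n) = ?a (Suc i) n"
      by (rule jump_step[OF u t ut A after]) (use Suc.prems in auto)
    also have "\<dots> = ?a (Suc i + n) 0" using Suc.prems by (intro Suc.IH) simp
    finally show ?case by (simp only: add_Suc_shift)
  qed simp
  have "(\<integral>\<^sup>+ \<omega>\<in>A. J n (indicator B) u (X m \<omega>) t \<partial>Pr) =
      (\<integral>\<^sup>+ \<omega>\<in>A. chi (jt (m + n) \<omega> < ereal t \<and> ereal t \<le> jt (Suc (m + n)) \<omega>) * indicator B (X (m + n) \<omega>) \<partial>Pr)" for n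
  proof -
    have "(\<integral>\<^sup>+ \<omega>\<in>A. J n (indicator B) u (X m \<omega>) t \<partial>Pr) = ?a m n"
    proof (rule nn_integral_cong)
      fix \<omega> assume "\<omega> \<in> space Pr"
      then have \<omega>: "\<omega> \<in> \<Omega>" by (simp add: space_Pr)
      show "J n (indicator B) u (X m \<omega>) t * indicator A \<omega> =
          chi (jt m \<omega> < ereal t) * J n (indicator B) (max u (\<tau> m \<omega>)) (X m \<omega>) t * indicator A \<omega>"
      proof (cases "\<omega> \<in> A")
        case True
        then have "jt m \<omega> \<le> ereal u" using Am by auto
        moreover from this have "\<tau> m \<omega> \<le> u"
          using jt_eq_\<tau>(1)[OF \<omega>, of m] jt_less_T1[OF u, of m \<omega>] by auto
        moreover have "jt m \<omega> < ereal t"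
          using \<open>jt m \<omega> \<le> ereal u\<close> ut le_less_trans[of "jt m \<omega>" "ereal u" "ereal t"] by simp
        ultimately show ?thesis by (simp add: max_def)
      qed simp
    qed
    also have "\<dots> = ?a (m + n) 0" by (rule shift) simp
    also have "\<dots> = (\<integral>\<^sup>+ \<omega>\<in>A. chi (jt (m + n) \<omega> < ereal t) * surv (X (m + n) \<omega>) (max u (\<tau> (m + n) \<omega>)) t *
        indicator B (X (m + n) \<omega>) \<partial>Pr)"
      by (intro nn_integral_cong) (simp add: ac_simps)
    also have "\<dots> = (\<integral>\<^sup>+ \<omega>\<in>A. chi (jt (m + n) \<omega> < ereal t \<and> ereal t \<le> jt (Suc (m + n)) \<omega>) * indicator B (X (m + n) \<omega>) \<partial>Pr)"
      by (rule no_jump[OF u t ut A after, symmetric]) auto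
    finally show ?thesis .
  qed
  then have "(\<Sum>n. \<integral>\<^sup>+ \<omega>\<in>A. J n (indicator B) u (X m \<omega>) t \<partial>Pr) =
      (\<Sum>n. \<integral>\<^sup>+ \<omega>\<in>A. chi (jt (m + n) \<omega> < ereal t \<and> ereal t \<le> jt (Suc (m + n)) \<omega>) * indicator B (X (m + n) \<omega>) \<partial>Pr)"
    by simp
  moreover have "(\<Sum>n. \<integral>\<^sup>+ \<omega>\<in>A. J n (indicator B) u (X m \<omega>) t \<partial>Pr) =
      (\<integral>\<^sup>+ \<omega>. (\<Sum>n. J n (indicator B) u (X m \<omega>) t * indicator A \<omega>) \<partial>Pr)"
    by (rule nn_integral_suminf[symmetric]) measurable
  moreover have "(\<Sum>n. \<integral>\<^sup>+ \<omega>\<in>A. chi (jt (m + n) \<omega> < ereal t \<and> ereal t \<le> jt (Suc (m + n)) \<omega>) * indicator B (X (m + n) \<omega>) \<partial>Pr) =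
      (\<integral>\<^sup>+ \<omega>. (\<Sum>n. chi (jt (m + n) \<omega> < ereal t \<and> ereal t \<le> jt (Suc (m + n)) \<omega>) * indicator B (X (m + n) \<omega>) * indicator A \<omega>) \<partial>Pr)"
    by (rule nn_integral_suminf[symmetric]) measurable
  moreover have "(\<integral>\<^sup>+ \<omega>. (\<Sum>n. chi (jt (m + n) \<omega> < ereal t \<and> ereal t \<le> jt (Suc (m + n)) \<omega>) * indicator B (X (m + n) \<omega>) * indicator A \<omega>) \<partial>Pr) =
      (\<integral>\<^sup>+ \<omega>\<in>A. indicator (Some ` B) (jump_process T0 t \<omega>) \<partial>Pr)"
  \<comment> \<open>Almost surely \<open>t\<close> is not a jump time. Outside this null set at most
    one summand survives, the one of the interval in which the process is at time \<open>t\<close>;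
    after explosion all of them vanish.\<close>
  proof (rule nn_integral_cong_AE)
    have T0t: "T0 < t" using u ut by (simp add: time_set_def)
    have "AE \<omega> in Pr. \<forall>n. jt n \<omega> \<noteq> ereal t"
      using AE_jump_time_neq[OF t T0t] by (simp add: AE_all_countable)
    then show "AE \<omega> in Pr. (\<Sum>n. chi (jt (m + n) \<omega> < ereal t \<and> ereal t \<le> jt (Suc (m + n)) \<omega>) * indicator B (X (m + n) \<omega>) * indicator A \<omega>)
        = indicator (Some ` B) (jump_process T0 t \<omega>) * indicator A \<omega>"
    proof (rule AE_mp, intro AE_I2 impI)
      fix \<omega> assume "\<omega> \<in> space Pr" and neq: "\<forall>n. jt n \<omega> \<noteq> ereal t"
      then have \<omega>: "\<omega> \<in> \<Omega>" by (simp add: space_Pr)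
      let ?f = "\<lambda>n. chi (jt (m + n) \<omega> < ereal t \<and> ereal t \<le> jt (Suc (m + n)) \<omega>) * indicator B (X (m + n) \<omega>) * indicator A \<omega>"
      have "T0 \<le> t" using T0t by simp
      then consider (jump) i where "jt i \<omega> \<le> ereal t" "ereal t < jt (Suc i) \<omega>"
        | (exploded) "\<forall>n. jt n \<omega> \<le> ereal t"
        using jump_time_cases[OF \<omega> T0_less_T1] by metis
      then show "(\<Sum>n. ?f n) = indicator (Some ` B) (jump_process T0 t \<omega>) * indicator A \<omega>"
      proof cases
        case jump
        show ?thesis
        proof (cases "\<omega> \<in> A")
          case True
          have "m \<le> i"
          proof (rule ccontr)
            assume "\<not> m \<le> i"
            then have "jt (Suc i) \<omega> \<le> jt m \<omega>" by (intro jump_time_mono[OF \<omega> T0_less_T1]) simp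
            also have "\<dots> \<le> ereal u" using Am[OF True] by simp
            also have "\<dots> < ereal t" using ut by simp
            finally show False using jump(2) by simp
          qed
          then obtain n0 where i: "i = m + n0" by (metis le_add_diff_inverse)
          have lt: "jt i \<omega> < ereal t" using jump neq by (simp add: less_le)
          have "(\<Sum>n. ?f n) = ?f n0"
          proof (rule suminf_single)
            fix n assume n: "n \<noteq> n0"
            have "\<not> (jt (m + n) \<omega> < ereal t \<and> ereal t \<le> jt (Suc (m + n)) \<omega>)"
              using jump_interval_unique[OF \<omega> T0_less_T1 lt less_imp_le[OF jump(2)], of "m + n"] n i by auto
            then show "?f n = 0" by (simp only: if_False mult_zero_left)
          qed
          also have "\<dots> = indicator B (X i \<omega>) * indicator A \<omega>"
            using lt jump(2) by (simp add: i less_imp_le)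
          also have "jump_process T0 t \<omega> = Some (X i \<omega>)"
            using jump_process_eq_state[OF \<omega> T0_less_T1 jump] jump_state_eq_X[OF \<omega> jt_less_T1[OF t jump(1)]] by simp
          then have "indicator B (X i \<omega>) = (indicator (Some ` B) (jump_process T0 t \<omega>) :: ennreal)"
            by (auto simp: indicator_def)
          finally show ?thesis .
        qed simp
      next
        case exploded
        then have "\<not> ereal t \<le> jt (Suc (m + n)) \<omega>" for n
          using neq by (auto simp: not_le less_le)
        moreover have "jump_process T0 t \<omega> = None"
          using exploded by (intro jump_process_eq_None[OF \<omega> T0_less_T1]) simp
        ultimately show ?thesis by (auto simp: indicator_def)
      qed
    qed
  qed
  ultimately show ?thesis by simp
qed

section \<open>From a fixed number of jumps to conditional probabilities\<close>

lemma interval_in_history: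
  assumes "u \<in> T"
  shows "{\<omega> \<in> \<Omega>. jt m \<omega> \<le> ereal u \<and> ereal u < jt (Suc m) \<omega>} \<in> sets (F u)"
proof -
  have "{\<omega> \<in> \<Omega>. jt m \<omega> \<le> ereal u \<and> ereal u < jt (Suc m) \<omega>} =
      {\<omega> \<in> \<Omega>. jt m \<omega> \<le> ereal u} - {\<omega> \<in> \<Omega>. jt (Suc m) \<omega> \<le> ereal u}" by auto
  then show ?thesis using history_time[OF assms order_refl] by auto
qed

lemma jump_process_cases:
  assumes \<omega>: "\<omega> \<in> \<Omega>" and u: "u \<in> T"
  obtains m where "jt m \<omega> \<le> ereal u" "ereal u < jt (Suc m) \<omega>" "jump_process T0 u \<omega> = Some (X m \<omega>)"
    "jump_state m \<omega> = Some (X m \<omega>)"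
  | "\<forall>n. jt n \<omega> \<le> ereal u" "jump_process T0 u \<omega> = None"
proof -
  have "T0 \<le> u" using u by (simp add: time_set_def)
  then consider (jump) i where "jt i \<omega> \<le> ereal u" "ereal u < jt (Suc i) \<omega>"
    | (exploded) "\<forall>n. jt n \<omega> \<le> ereal u"
    using jump_time_cases[OF \<omega> T0_less_T1] by metis
  then show thesis
  proof cases
    case jump
    have "jump_state i \<omega> = Some (X i \<omega>)"
      by (rule jump_state_eq_X[OF \<omega> jt_less_T1[OF u jump(1)]])
    then show thesis using that(1)[OF jump] jump_process_eq_state[OF \<omega> T0_less_T1 jump] by simp
  next
    case exploded
    then show thesis
      using that(2) jump_process_eq_None[OF \<omega> T0_less_T1, of u] by simp
  qed
qed

lemma measurable_jump_process:
  assumes u: "u \<in> T"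
  shows "jump_process T0 u \<in> F u \<rightarrow>\<^sub>M extended_space M"
proof (rule measurable_extended_spaceI)
  fix \<omega> assume "\<omega> \<in> space (F u)"
  then have \<omega>: "\<omega> \<in> \<Omega>" by simp
  show "jump_process T0 u \<omega> \<in> insert None (Some ` space M)"
    by (rule jump_process_cases[OF \<omega> u]) (use X_space[OF \<omega>] in auto)
next
  fix B assume B: "B \<in> sets M"
  have "{\<omega> \<in> \<Omega>. jump_process T0 u \<omega> \<in> Some ` B} =
    (\<Union>m. {\<omega> \<in> \<Omega>. jt m \<omega> \<le> ereal u \<and> ereal u < jt (Suc m) \<omega>} \<inter>
      {\<omega> \<in> \<Omega>. jump_state m \<omega> \<in> Some ` B \<and> jt m \<omega> \<le> ereal u})" (is "?L = ?R")
  proof (intro equalityI subsetI)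
    fix \<omega> assume "\<omega> \<in> ?L"
    then have \<omega>: "\<omega> \<in> \<Omega>" and in_B: "jump_process T0 u \<omega> \<in> Some ` B" by auto
    show "\<omega> \<in> ?R"
      by (rule jump_process_cases[OF \<omega> u]) (use \<omega> in_B in auto)
  next
    fix \<omega> assume "\<omega> \<in> ?R"
    then obtain m where \<omega>: "\<omega> \<in> \<Omega>" and m: "jt m \<omega> \<le> ereal u" "ereal u < jt (Suc m) \<omega>"
      and "jump_state m \<omega> \<in> Some ` B" by auto
    then show "\<omega> \<in> ?L" using jump_process_eq_state[OF \<omega> T0_less_T1 m] by simp
  qed
  also have "\<dots> \<in> sets (F u)"
    using u by (intro sets.countable_UN sets.Int image_subsetI interval_in_history history_mark B)
      (auto simp: time_set_def)
  finally show "{\<omega> \<in> space (F u). jump_process T0 u \<omega> \<in> Some ` B} \<in> sets (F u)" by simp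
qed

text \<open>The events \<open>D m\<close> of exactly \<open>m\<close> jumps up to \<open>u\<close>
  belong to the history at \<open>u\<close> and partition the paths not yet exploded. On exploded
  paths both integrands are 0, since such a path is in \<open>None\<close> at \<open>t\<close> as
  well.\<close>

lemma integral_jump_process:
  assumes u: "u \<in> T" and t: "t \<in> T" and ut: "u < t" and A: "A \<in> sets (F u)" and B: "B \<in> sets M"
  shows "(\<integral>\<^sup>+ \<omega>\<in>A. indicator (Some ` B) (jump_process T0 t \<omega>) \<partial>Pr) =
    (\<integral>\<^sup>+ \<omega>\<in>A. (case jump_process T0 u \<omega> of None \<Rightarrow> 0 | Some x \<Rightarrow> P_bar M q u x t B) \<partial>Pr)"
    (is "(\<integral>\<^sup>+ \<omega>\<in>A. ?l \<omega> \<partial>Pr) = (\<integral>\<^sup>+ \<omega>\<in>A. ?r \<omega> \<partial>Pr)")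
proof -
  note [measurable] = B
  define D where "D m = {\<omega> \<in> \<Omega>. jt m \<omega> \<le> ereal u \<and> ereal u < jt (Suc m) \<omega>}" for m
  have D: "A \<inter> D m \<in> sets (F u)" for m
    using interval_in_history[OF u] A by (auto simp: D_def)
  then have AD [measurable]: "A \<inter> D m \<in> sets Pr" for m using sets_history_subset by auto
  have XPr [measurable]: "jump_process T0 v \<in> Pr \<rightarrow>\<^sub>M extended_space M" if "v \<in> T" for v
    using measurable_from_subalg[OF subalgebra_history measurable_jump_process[OF that]] .
  have l: "?l \<in> borel_measurable Pr"
    by (rule measurable_compose[OF XPr[OF t]]) (intro borel_measurable_indicator Some_sets_extended_space B)
  have P_eq: "?r \<omega> = (\<Sum>n. J n (indicator B) u (X m \<omega>) t)" if "\<omega> \<in> D m" for \<omega> m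
  proof -
    have \<omega>: "\<omega> \<in> \<Omega>" and m: "jt m \<omega> \<le> ereal u" "ereal u < jt (Suc m) \<omega>" using that by (auto simp: D_def)
    have "jump_process T0 u \<omega> = Some (X m \<omega>)"
      using jump_process_eq_state[OF \<omega> T0_less_T1 m] jump_state_eq_X[OF \<omega> jt_less_T1[OF u m(1)]] by simp
    then show ?thesis using P_bar_eq[OF X_space[OF \<omega>] u t] by simp
  qed
  have decomp: "g \<omega> * indicator A \<omega> = (\<Sum>m. g \<omega> * indicator (A \<inter> D m) \<omega>)"
    if \<omega>: "\<omega> \<in> \<Omega>" and g: "\<forall>n. jt n \<omega> \<le> ereal u \<Longrightarrow> g \<omega> = 0" for g :: "'a jump_seq \<Rightarrow> ennreal" and \<omega>
  proof (rule jump_process_cases[OF \<omega> u])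
    fix m assume m: "jt m \<omega> \<le> ereal u" "ereal u < jt (Suc m) \<omega>"
    have "(\<Sum>m. g \<omega> * indicator (A \<inter> D m) \<omega>) = g \<omega> * indicator (A \<inter> D m) \<omega>"
    proof (rule suminf_single)
      fix n assume "n \<noteq> m"
      then have "\<omega> \<notin> D n"
        using jump_interval_unique'[OF \<omega> T0_less_T1 m, of n] by (auto simp: D_def)
      then show "g \<omega> * indicator (A \<inter> D n) \<omega> = 0" by simp
    qed
    also have "\<dots> = g \<omega> * indicator A \<omega>"
      using m \<omega> by (auto simp: D_def indicator_def)
    finally show ?thesis by simp
  qed (use g in simp)
  have "(\<integral>\<^sup>+ \<omega>\<in>A. ?l \<omega> \<partial>Pr) = (\<integral>\<^sup>+ \<omega>. (\<Sum>m. ?l \<omega> * indicator (A \<inter> D m) \<omega>) \<partial>Pr)"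
  proof (rule nn_integral_cong)
    fix \<omega> assume "\<omega> \<in> space Pr"
    then have \<omega>: "\<omega> \<in> \<Omega>" by (simp add: space_Pr)
    have "?l \<omega> = 0" if "\<forall>n. jt n \<omega> \<le> ereal u"
    proof -
      have "jt n \<omega> \<le> ereal t" for n
        using that ut order_trans[of "jt n \<omega>" "ereal u" "ereal t"] by simp
      then have "jump_process T0 t \<omega> = None" by (rule jump_process_eq_None[OF \<omega> T0_less_T1])
      then show ?thesis by auto
    qed
    then show "?l \<omega> * indicator A \<omega> = (\<Sum>m. ?l \<omega> * indicator (A \<inter> D m) \<omega>)"
      by (rule decomp[OF \<omega>])
  qed
  also have "\<dots> = (\<Sum>m. \<integral>\<^sup>+ \<omega>\<in>A \<inter> D m. ?l \<omega> \<partial>Pr)"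
    by (intro nn_integral_suminf borel_measurable_times_ennreal l borel_measurable_indicator AD)
  also have "\<dots> = (\<Sum>m. \<integral>\<^sup>+ \<omega>\<in>A \<inter> D m. (\<Sum>n. J n (indicator B) u (X m \<omega>) t) \<partial>Pr)"
    by (intro suminf_cong integral_jump_process_on_interval[OF u t ut D _ B]) (auto simp: D_def)
  also have "\<dots> = (\<integral>\<^sup>+ \<omega>. (\<Sum>m. (\<Sum>n. J n (indicator B) u (X m \<omega>) t) * indicator (A \<inter> D m) \<omega>) \<partial>Pr)"
    by (rule nn_integral_suminf[symmetric]) measurable
  also have "\<dots> = (\<integral>\<^sup>+ \<omega>\<in>A. ?r \<omega> \<partial>Pr)"
  proof (rule nn_integral_cong)
    fix \<omega> assume "\<omega> \<in> space Pr"
    then have \<omega>: "\<omega> \<in> \<Omega>" by (simp add: space_Pr)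
    have "(\<Sum>m. (\<Sum>n. J n (indicator B) u (X m \<omega>) t) * indicator (A \<inter> D m) \<omega>) =
        (\<Sum>m. ?r \<omega> * indicator (A \<inter> D m) \<omega>)"
      by (intro suminf_cong) (simp add: P_eq[symmetric] split: split_indicator)
    also have "\<dots> = ?r \<omega> * indicator A \<omega>"
    proof (rule decomp[OF \<omega>, symmetric])
      assume "\<forall>n. jt n \<omega> \<le> ereal u"
      then have "jump_process T0 u \<omega> = None" by (intro jump_process_eq_None[OF \<omega> T0_less_T1]) simp
      then show "?r \<omega> = 0" by simp
    qed
    finally show "(\<Sum>m. (\<Sum>n. J n (indicator B) u (X m \<omega>) t) * indicator (A \<inter> D m) \<omega>) = ?r \<omega> * indicator A \<omega>" .
  qed
  finally show ?thesis .
qed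

text \<open>Stated for every sub-sigma-field \<open>G\<close> of the history for which the state at
  \<open>u\<close> is measurable. Taking \<open>G\<close> as the full history and as the sigma-field
  of the state gives the same right-hand side, hence the Markov property and the transition function
  together.\<close>

lemma cond_prob_jump_process:
  assumes u: "u \<in> T" and t: "t \<in> T" and ut: "u < t" and B: "B \<in> sets M"
    and G: "subalgebra Pr G" "sets G \<subseteq> sets (F u)" and XG: "jump_process T0 u \<in> G \<rightarrow>\<^sub>M extended_space M"
  shows "AE \<omega> in Pr. cond_prob_given Pr G (jump_process T0) t B \<omega> =
    (case jump_process T0 u \<omega> of None \<Rightarrow> 0 | Some x \<Rightarrow> enn2real (P_bar M q u x t B))"
proof -
  note [measurable] = B
  let ?f = "indicator {\<omega> \<in> space Pr. jump_process T0 t \<omega> \<in> Some ` B} :: 'a jump_seq \<Rightarrow> real"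
  let ?g = "\<lambda>\<omega>. case jump_process T0 u \<omega> of None \<Rightarrow> 0 | Some x \<Rightarrow> enn2real (P_bar M q u x t B)"
  have P1: "P_bar M q u x t B \<le> 1" if "x \<in> space M" for x
    using transition_function_P_bar u t ut B that by (auto simp: transition_function_def)
  have "(\<lambda>x. \<Sum>n. J n (indicator B) u x t) \<in> borel_measurable M" by measurable
  then have "(\<lambda>x. P_bar M q u x t B) \<in> borel_measurable M"
    by (rule measurable_cong[THEN iffD1, rotated]) (simp add: P_bar_eq u t)
  then have Pm: "(\<lambda>x. enn2real (P_bar M q u x t B)) \<in> borel_measurable M"
    by measurable
  have gG: "?g \<in> borel_measurable G"
    using measurable_compose[OF XG measurable_case_extended_space[OF Pm]] .
  then have g [measurable]: "?g \<in> borel_measurable Pr" by (rule measurable_from_subalg[OF G(1)])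
  have Xt: "jump_process T0 t \<in> Pr \<rightarrow>\<^sub>M extended_space M"
    using measurable_from_subalg[OF subalgebra_history measurable_jump_process[OF t]] .
  have f [measurable]: "?f \<in> borel_measurable Pr"
    using measurable_sets[OF Xt Some_sets_extended_space[OF B]]
    by (intro borel_measurable_indicator) (simp add: vimage_def Int_def conj_commute)
  have g01: "0 \<le> ?g \<omega> \<and> ?g \<omega> \<le> 1 \<and>
      ennreal (?g \<omega>) = (case jump_process T0 u \<omega> of None \<Rightarrow> 0 | Some x \<Rightarrow> P_bar M q u x t B)"
    if \<omega>: "\<omega> \<in> \<Omega>" for \<omega>
  proof (rule jump_process_cases[OF \<omega> u])
    fix m assume X: "jump_process T0 u \<omega> = Some (X m \<omega>)"
    have le: "P_bar M q u (X m \<omega>) t B \<le> 1" by (rule P1[OF X_space[OF \<omega>]])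
    then have "P_bar M q u (X m \<omega>) t B < \<top>" by (rule le_less_trans) simp
    then show ?thesis using le enn2real_mono[OF le] by (simp add: X)
  qed simp
  have intf: "integrable Pr ?f"
    by (rule Pr.integrable_const_bound[where B=1, OF AE_I2 f]) (simp add: indicator_def)
  have intg: "integrable Pr ?g"
    by (rule Pr.integrable_const_bound[where B=1, OF AE_I2 g]) (use g01 in \<open>simp add: space_Pr\<close>)
  \<comment> \<open>Finiteness of \<open>Pr\<close> supplies the sigma-finiteness required for
    characterising \<open>real_cond_exp\<close> by integrals over events of
    \<open>G\<close>.\<close>
  interpret G: sigma_finite_subalgebra Pr G
    by (rule finite_measure_subalgebra_is_sigma_finite[OF finite_measure_subalgebra.intro[OF Pr.finite_measure_axioms finite_measure_subalgebra_axioms.intro[OF G(1)]]])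
  have "AE \<omega> in Pr. real_cond_exp Pr G ?f \<omega> = ?g \<omega>"
  proof (rule G.real_cond_exp_charact)
    fix A assume "A \<in> sets G"
    then have A: "A \<in> sets (F u)" using G(2) by auto
    then have [measurable]: "A \<in> sets Pr" using sets_history_subset by auto
    have "(LINT \<omega>:A|Pr. ?f \<omega>) = enn2real (\<integral>\<^sup>+ \<omega>\<in>A. indicator (Some ` B) (jump_process T0 t \<omega>) \<partial>Pr)"
      unfolding set_lebesgue_integral_def
    proof (subst integral_eq_nn_integral)
      show "(\<lambda>\<omega>. indicator A \<omega> *\<^sub>R ?f \<omega>) \<in> borel_measurable Pr" by measurable
    qed (auto intro!: arg_cong[where f=enn2real] nn_integral_cong simp: indicator_def)
    also have "\<dots> = enn2real (\<integral>\<^sup>+ \<omega>\<in>A. (case jump_process T0 u \<omega> of None \<Rightarrow> 0 | Some x \<Rightarrow> P_bar M q u x t B) \<partial>Pr)"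
      by (simp only: integral_jump_process[OF u t ut A B])
    also have "\<dots> = (LINT \<omega>:A|Pr. ?g \<omega>)"
      unfolding set_lebesgue_integral_def
    proof (subst integral_eq_nn_integral)
      show "AE \<omega> in Pr. 0 \<le> indicator A \<omega> *\<^sub>R ?g \<omega>"
        using g01 by (intro AE_I2) (simp add: space_Pr)
      show "enn2real (\<integral>\<^sup>+ \<omega>\<in>A. (case jump_process T0 u \<omega> of None \<Rightarrow> 0 | Some x \<Rightarrow> P_bar M q u x t B) \<partial>Pr) =
          enn2real (\<integral>\<^sup>+ \<omega>. ennreal (indicator A \<omega> *\<^sub>R ?g \<omega>) \<partial>Pr)"
      proof (intro arg_cong[where f=enn2real] nn_integral_cong)
        fix \<omega> assume "\<omega> \<in> space Pr"
        then have "\<omega> \<in> \<Omega>" by (simp add: space_Pr)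
        from g01[OF this]
        show "(case jump_process T0 u \<omega> of None \<Rightarrow> 0 | Some x \<Rightarrow> P_bar M q u x t B) * indicator A \<omega> =
            ennreal (indicator A \<omega> *\<^sub>R ?g \<omega>)"
          by (cases "\<omega> \<in> A") simp_all
      qed
    qed measurable
    finally show "(LINT \<omega>:A|Pr. ?f \<omega>) = (LINT \<omega>:A|Pr. ?g \<omega>)" .
  qed (fact intf intg gG)+
  then show ?thesis by (simp add: cond_prob_given_def)
qed

lemma sigma_gen_jump_process:
  assumes u: "u \<in> T"
  shows "subalgebra Pr (sigma_gen M Pr (jump_process T0) u)"
    and "sets (sigma_gen M Pr (jump_process T0) u) \<subseteq> sets (F u)"
    and "jump_process T0 u \<in> sigma_gen M Pr (jump_process T0) u \<rightarrow>\<^sub>M extended_space M"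
proof -
  have X: "jump_process T0 u \<in> space Pr \<rightarrow> space (extended_space M)"
    using measurable_space[OF measurable_jump_process[OF u]] by (auto simp: space_Pr)
  show "jump_process T0 u \<in> sigma_gen M Pr (jump_process T0) u \<rightarrow>\<^sub>M extended_space M"
    unfolding sigma_gen_def by (rule measurable_vimage_algebra1[OF X])
  show sub: "sets (sigma_gen M Pr (jump_process T0) u) \<subseteq> sets (F u)"
    unfolding sigma_gen_def sets_vimage_algebra2[OF X]
    using measurable_sets[OF measurable_jump_process[OF u]] by (auto simp: space_Pr)
  show "subalgebra Pr (sigma_gen M Pr (jump_process T0) u)"
    using sub sets_history_subset by (auto simp: subalgebra_def sigma_gen_def)
qed

lemma jump_markov_process_jump_process: "jump_markov_process M T0 T1 Pr F (jump_process T0)"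
  unfolding jump_markov_process_def markov_process_def
proof (intro conjI ballI impI)
  fix u t B assume u: "u \<in> T" and t: "t \<in> T" and ut: "u < t" and B: "B \<in> sets M"
  show "AE \<omega> in Pr. cond_prob_given Pr (F u) (jump_process T0) t B \<omega> =
      cond_prob_given Pr (sigma_gen M Pr (jump_process T0) u) (jump_process T0) t B \<omega>"
    using cond_prob_jump_process[OF u t ut B subalgebra_history order_refl measurable_jump_process[OF u]]
      cond_prob_jump_process[OF u t ut B sigma_gen_jump_process[OF u]]
    by eventually_elim simp
next
  fix \<omega> assume "\<omega> \<in> space Pr"
  then show "jump_path T0 T1 (\<lambda>t. jump_process T0 t \<omega>)"
    using jump_path_jump_process[OF _ T0_less_T1] by (simp add: space_Pr)
qed (use subalgebra_history measurable_jump_process in auto)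

lemma has_transition_function_P_bar: "has_transition_function M T0 T1 Pr (jump_process T0) (P_bar M q)"
  unfolding has_transition_function_def
  using transition_function_P_bar cond_prob_jump_process[OF _ _ _ _ sigma_gen_jump_process] by auto

end

theorem theorem1:
  fixes M \<gamma> :: "'a measure"
    and T0 :: real and T1 :: ereal
    and q :: "'a \<Rightarrow> real \<Rightarrow> 'a set \<Rightarrow> real"
    and Pr :: "'a jump_seq measure"
  assumes "standard_borel M"
    and "0 \<le> T0" and "ereal T0 < T1"
    and "prob_space \<gamma>" and "sets \<gamma> = sets M"
    and "Q_function M T0 T1 q" and "conservative M T0 T1 q"
    and "\<And>x s. x \<in> space M \<Longrightarrow> T0 < s \<Longrightarrow> ereal s < T1 \<Longrightarrow>
           (\<integral>\<^sup>+ t\<in>{T0..s}. ennreal (q_rate q x t) \<partial>lborel) < \<infinity>"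
    and "jump_process_law M T0 T1 \<gamma> q Pr"
  shows "jump_markov_process M T0 T1 Pr (history M T0 T1) (jump_process T0)
    \<and> has_transition_function M T0 T1 Pr (jump_process T0) (P_bar M q)"
proof -
  interpret jump_law M T0 T1 q Pr
    by (intro jump_law.intro jump_rates.intro jump_law_axioms.intro)
       (use assms in \<open>auto simp: jump_process_law_def\<close>)
  show ?thesis
    using jump_markov_process_jump_process has_transition_function_P_bar by (rule conjI)
qed


end
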